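(* Let $X=\{X_t;t\ge 0\}$ be a symmetric stable process of order $\beta$ in $\mathbb{R}^d$ with characteristic exponent $\psi$, where $2d/3<\beta\le d$, and let $\gamma_t$ be its renormalized self-intersection local time. If $\beta<d$, then $$\liminf_{t\to\infty}\frac{\gamma_t}{t^{2-d/\beta}(\log\log t)^{d/\beta-1}}=-b_\psi^{-(d/\beta-1)}\qquad\text{a.s.},$$ where $b_\psi\in(0,\infty)$ is the constant determined by $\lim_{t\to\infty}\frac1t\log P(-\gamma_t\ge t)=-b_\psi$. If $\beta=d$, then $$\liminf_{t\to\infty}\frac{1}{t\log\log\log t}\,\gamma_t=-p_1(0)\qquad\text{a.s.},$$ where $p_t(x)$ is the continuous density function of $X_t$.
   Context: A symmetric stable process of order (index) $\beta$ in $\mathbb{R}^d$ here means a nondegenerate $d$-dimensional Lévy process $X_t$ (started at $0$) with $E(e^{i\lambda\cdot X_t})=e^{-t\psi(\lambda)}$, where $\psi\ge 0$ is continuous, $\psi(-\lambda)=\psi(\lambda)$, $\psi(r\lambda)=r^\beta\psi(\lambda)$ for all $r\ge0$, and $c|\lambda|^\beta\le\psi(\lambda)\le C|\lambda|^\beta$ for some $0<c<C<\infty$. Spherical symmetry is not assumed. Let $f\in\mathcal S(\mathbb{R}^d)$ (Schwartz class) be a positive, symmetric function with $\int f\,dx=1$, and $f_\varepsilon(x)=\varepsilon^{-d}f(x/\varepsilon)$. Set $$\gamma_{t,\varepsilon}=\int_0^t\int_0^s f_\varepsilon(X_s-X_r)\,dr\,ds-E\Big\{\int_0^t\int_0^s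 f_\varepsilon(X_s-X_r)\,dr\,ds\Big\}.$$ For $2d/3<\beta\le d$ the limit $\gamma_t=\lim_{\varepsilon\to0}\gamma_{t,\varepsilon}$ exists (a.s. and in all $L^p$ spaces), and $\gamma_t$ is almost surely continuous in $t$; it is called the renormalized self-intersection local time of $X$. For $2d/3<\beta<d$ there is a constant $b_\psi\in(0,\infty)$ with $\lim_{t\to\infty}\frac1t\log P(-\gamma_t\ge t)=-b_\psi$; its existence is part of the setting. *)

theory Defs
  imports "HOL-Probability.Probability"
begin

section \<open>Symmetric stable processes\<close>

definition cadlag :: "(real \<Rightarrow> 'a::topological_space) \<Rightarrow> bool" where
  "cadlag g \<longleftrightarrow>
     (\<forall>t\<ge>0. (g \<longlongrightarrow> g t) (at_right t)) \<and>
     (\<forall>t>0. \<exists>l. (g \<longlongrightarrow> l) (at_left t))"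

text \<open>
  The time set is \<open>[0, \<infinity>)\<close>; the values of \<open>X t\<close> at negative \<open>t\<close> are irrelevant.
  Every path (not only almost every path) is right continuous with left limits, so that
  path integrals of \<open>X\<close> are random variables without completing \<open>M\<close>.
\<close>

locale levy_process = prob_space M
  for M :: "'w measure" and X :: "real \<Rightarrow> 'w \<Rightarrow> 'a::euclidean_space" +
  assumes random_variable_X: "\<And>t. 0 \<le> t \<Longrightarrow> random_variable borel (X t)"
    and start_at_0: "AE \<omega> in M. X 0 \<omega> = 0"
    and independent_increments:
      "\<And>(n::nat) (t :: nat \<Rightarrow> real). 0 \<le> t 0 \<Longrightarrow> (\<And>i. i < n \<Longrightarrow> t i \<le> t (Suc i)) \<Longrightarrow>
         indep_vars (\<lambda>_. borel) (\<lambda>i \<omega>. X (t (Suc i)) \<omega> - X (t i) \<omega>) {..<n}"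
    and stationary_increments:
      "\<And>s h. 0 \<le> s \<Longrightarrow> 0 \<le> h \<Longrightarrow>
         distr M borel (\<lambda>\<omega>. X (s + h) \<omega> - X s \<omega>) = distr M borel (X h)"
    and cadlag_paths: "\<And>\<omega>. \<omega> \<in> space M \<Longrightarrow> cadlag (\<lambda>t. X t \<omega>)"

text \<open>
  Nondegeneracy of the process is the lower bound in \<open>exponent_bounds\<close>.
\<close>

locale symmetric_stable_process = levy_process M X
  for M :: "'w measure" and X :: "real \<Rightarrow> 'w \<Rightarrow> 'a::euclidean_space" +
  fixes \<beta> :: real and \<psi> :: "'a \<Rightarrow> real"
  assumes order_pos: "0 < \<beta>"
    and characteristic_exponent:
      "\<And>t l. 0 \<le> t \<Longrightarrow> (CLINT \<omega>|M. iexp (l \<bullet> X t \<omega>)) = complex_of_real (exp (- t * \<psi> l))"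
    and exponent_continuous: "continuous_on UNIV \<psi>"
    and exponent_nonneg: "\<And>l. 0 \<le> \<psi> l"
    and exponent_symmetric: "\<And>l. \<psi> (- l) = \<psi> l"
    and exponent_homogeneous: "\<And>r l. 0 \<le> r \<Longrightarrow> \<psi> (r *\<^sub>R l) = r powr \<beta> * \<psi> l"
    and exponent_bounds:
      "\<exists>c C. 0 < c \<and> c < C \<and> (\<forall>l. c * norm l powr \<beta> \<le> \<psi> l \<and> \<psi> l \<le> C * norm l powr \<beta>)"

definition continuous_density :: "'w measure \<Rightarrow> ('w \<Rightarrow> 'a::euclidean_space) \<Rightarrow> ('a \<Rightarrow> real) \<Rightarrow> bool" where
  "continuous_density M Y q \<longleftrightarrow>
     continuous_on UNIV q \<and> (\<forall>x. 0 \<le> q x) \<and> distributed M lborel Y (\<lambda>x. ennreal (q x))"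

section \<open>Schwartz functions and mollifiers\<close>

text \<open>
  \<open>iterated_partial [b\<^sub>1, \<dots>, b\<^sub>m] f\<close> is the partial derivative of \<open>f\<close> of order \<open>m\<close> in the
  directions \<open>b\<^sub>1, \<dots>, b\<^sub>m\<close>; it is meaningful where the derivatives of lower order
  are differentiable, which \<open>schwartz\<close> demands everywhere.
\<close>

fun iterated_partial :: "'a::euclidean_space list \<Rightarrow> ('a \<Rightarrow> real) \<Rightarrow> 'a \<Rightarrow> real" where
  "iterated_partial [] f = f"
| "iterated_partial (b # bs) f = (\<lambda>x. frechet_derivative (iterated_partial bs f) (at x) b)"

definition schwartz :: "('a::euclidean_space \<Rightarrow> real) \<Rightarrow> bool" where
  "schwartz f \<longleftrightarrow>
     (\<forall>bs. set bs \<subseteq> Basis \<longrightarrow>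
        (\<forall>x. iterated_partial bs f differentiable (at x)) \<and>
        (\<forall>k::nat. bounded (range (\<lambda>x. norm x ^ k * iterated_partial bs f x))))"

definition mollifier_kernel :: "('a::euclidean_space \<Rightarrow> real) \<Rightarrow> bool" where
  "mollifier_kernel f \<longleftrightarrow>
     schwartz f \<and> (\<forall>x. 0 < f x) \<and> (\<forall>x. f (- x) = f x) \<and> (LBINT x. f x) = 1"

definition rescale :: "('a::euclidean_space \<Rightarrow> real) \<Rightarrow> real \<Rightarrow> 'a \<Rightarrow> real" where
  "rescale f \<epsilon> x = f (x /\<^sub>R \<epsilon>) / \<epsilon> ^ DIM('a)"

section \<open>Renormalized self-intersection local time\<close>

definition approx_silt ::
    "(real \<Rightarrow> 'w \<Rightarrow> 'a::euclidean_space) \<Rightarrow> ('a \<Rightarrow> real) \<Rightarrow> real \<Rightarrow> real \<Rightarrow> 'w \<Rightarrow> real" where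
  "approx_silt X f \<epsilon> t \<omega> = (LBINT s:{0..t}. (LBINT r:{0..s}. rescale f \<epsilon> (X s \<omega> - X r \<omega>)))"

definition renorm_approx_silt ::
    "'w measure \<Rightarrow> (real \<Rightarrow> 'w \<Rightarrow> 'a::euclidean_space) \<Rightarrow> ('a \<Rightarrow> real) \<Rightarrow> real \<Rightarrow> real \<Rightarrow> 'w \<Rightarrow> real" where
  "renorm_approx_silt M X f \<epsilon> t \<omega> = approx_silt X f \<epsilon> t \<omega> - (LINT \<omega>'|M. approx_silt X f \<epsilon> t \<omega>')"

text \<open>
  \<open>\<gamma>\<close> is a version of the limit of \<open>\<gamma>\<^bsub>t,\<epsilon>\<^esub>\<close> as \<open>\<epsilon> \<rightarrow> 0\<close>, almost surely and in \<open>L\<^sup>p\<close> for all finite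
  \<open>p \<ge> 1\<close>, that is almost surely continuous in time; this determines \<open>\<gamma>\<close> up to
  indistinguishability. The \<open>L\<^sup>p\<close> distances are nonnegative integrals because the Bochner
  integral is 0 on non-integrable functions.
\<close>

definition renormalized_silt ::
    "'w measure \<Rightarrow> (real \<Rightarrow> 'w \<Rightarrow> 'a::euclidean_space) \<Rightarrow> ('a \<Rightarrow> real) \<Rightarrow> (real \<Rightarrow> 'w \<Rightarrow> real) \<Rightarrow> bool" where
  "renormalized_silt M X f \<gamma> \<longleftrightarrow>
     (\<forall>t\<ge>0.
        \<gamma> t \<in> borel_measurable M \<and>
        (AE \<omega> in M. ((\<lambda>\<epsilon>. renorm_approx_silt M X f \<epsilon> t \<omega>) \<longlongrightarrow> \<gamma> t \<omega>) (at_right 0)) \<and>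
        (\<forall>p::real. 1 \<le> p \<longrightarrow>
           ((\<lambda>\<epsilon>. \<integral>\<^sup>+\<omega>. ennreal (\<bar>renorm_approx_silt M X f \<epsilon> t \<omega> - \<gamma> t \<omega>\<bar> powr p) \<partial>M) \<longlongrightarrow> 0)
             (at_right 0))) \<and>
     (AE \<omega> in M. continuous_on {0..} (\<lambda>t. \<gamma> t \<omega>))"

end

(* The increments of X over a time segment, rescaled to unit length, have a law independent of the
   segment, and increments over disjoint segments are independent. As gamma is an L^1 limit of
   centred occupation integrals, gamma over a segment of length L is L^(2 - d/beta) times a fixed
   functional of the normalized path, and the interaction of two adjacent segments is positive up
   to its mean. So -gamma is subadditive up to an explicit error, and the iterated-logarithm law
   reduces to the tail of -gamma_1: a dyadic chaining over times and Borel-Cantelli give the upper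
   bound for -gamma, independent blocks along a sparse sequence of times the lower one.
   For beta < d the tail is the hypothesis defining b. For beta = d, subadditivity over n unit
   segments costs p_1(0) n log n, and n is free; averaging n independent copies first gives an
   exponential and then the double exponential tail exp(-exp(y / p_1(0) - c)). Conversely, on
   an event of probability c^n the path drifts away in one direction, distant segments do not
   meet, and -gamma collects the mean p_1(0) n log n of their interaction. *)

theory Submission imports Defs "HOL-Real_Asymp.Real_Asymp" begin

section \<open>Gaussian regularization on Euclidean space\<close>

text \<open>Two obstacles shape the proof. First, \<open>\<gamma> t\<close> is known only almost
  surely for each fixed t, and nothing is assumed about its law. So one measurable functional is
  built on the countably many dyadic values of a normalized segment, and every segment is fed to it;
  laws and independence then reduce to finitely many increments. Inequalities between values of
  \<gamma> hold off null sets that depend on the times, hence only countably many times are compared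
  and continuity supplies the rest. Second, the interaction of two segments is used only through its
  sign and its mean at fixed \<epsilon>; what holds for all small \<epsilon> passes to limits in
  L^1. The constant p_1(0) arises as follows. For \<beta> = d the mean of f_\<epsilon>(X_s - X_r) is
  at most p_1(0) / (s - r) and tends to it, so a unit segment that starts at time i meets the past
  with mean p_1(0) ln i + O(1). That p_1(0) is an upper bound, and not only a limit, comes from the
  characteristic function exp(-\<psi>) being nonnegative, so that the density is largest at the
  origin. This calls for Fourier inversion.\<close>

definition gauss :: "'a::euclidean_space \<Rightarrow> real" where
  "gauss x = (\<Prod>b\<in>Basis. std_normal_density (x \<bullet> b))"

lemma gauss_eq: "gauss (x::'a::euclidean_space) = exp (- (norm x)\<^sup>2 / 2) / sqrt (2 * pi) ^ DIM('a)"
proof -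
  have "(norm x)\<^sup>2 = (\<Sum>b\<in>Basis. (x \<bullet> b)\<^sup>2)"
    unfolding power2_norm_eq_inner by (subst euclidean_inner) (simp add: power2_eq_square)
  then have "exp (- (norm x)\<^sup>2 / 2) = (\<Prod>b\<in>Basis. exp (- (x \<bullet> b)\<^sup>2 / 2))"
    by (simp add: exp_sum[symmetric] sum_negf sum_divide_distrib)
  then show ?thesis
    unfolding gauss_def std_normal_density_def prod.distrib prod_dividef prod_constant
    by (simp add: field_simps power_divide)
qed

lemma gauss_pos: "0 < gauss x" and gauss_minus: "gauss (- x) = gauss x"
  by (simp_all add: gauss_eq)

lemma continuous_gauss: "continuous_on UNIV gauss"
  unfolding gauss_eq[abs_def] by (intro continuous_intros) auto

lemma borel_measurable_gauss [measurable]: "gauss \<in> borel_measurable borel"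
  by (intro borel_measurable_continuous_onI continuous_gauss)

lemma
  fixes f :: "'a::euclidean_space \<Rightarrow> real \<Rightarrow> 'b::{real_normed_field,banach,second_countable_topology}"
  assumes f: "\<And>b. b \<in> Basis \<Longrightarrow> integrable lborel (f b)"
  shows lborel_integrable_prod_Basis: "integrable lborel (\<lambda>x::'a. \<Prod>b\<in>Basis. f b (x \<bullet> b))"
    and lborel_integral_prod_Basis:
      "(LBINT x::'a. \<Prod>b\<in>Basis. f b (x \<bullet> b)) = (\<Prod>b\<in>Basis. LBINT x. f b x)"
proof -
  interpret product_sigma_finite "\<lambda>_::'a. lborel::real measure" ..
  have [measurable]: "b \<in> Basis \<Longrightarrow> f b \<in> borel_measurable borel" for b
    using borel_measurable_integrable[OF f[of b]] by simp
  have m: "(\<lambda>x::'a. \<Prod>b\<in>Basis. f b (x \<bullet> b)) \<in> borel_measurable borel"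
    by measurable
  have *: "(\<Prod>b\<in>Basis. f b ((\<Sum>i\<in>Basis. y i *\<^sub>R i) \<bullet> b)) = (\<Prod>b\<in>Basis. f b (y b))" for y :: "'a \<Rightarrow> real"
    by (intro prod.cong refl) simp
  show "integrable lborel (\<lambda>x::'a. \<Prod>b\<in>Basis. f b (x \<bullet> b))"
    by (subst lborel_eq, subst integrable_distr_eq[OF _ m])
       (auto simp: * intro!: product_integrable_prod f)
  show "(LBINT x::'a. \<Prod>b\<in>Basis. f b (x \<bullet> b)) = (\<Prod>b\<in>Basis. LBINT x. f b x)"
    by (subst lborel_eq, subst integral_distr[OF _ m])
       (auto simp: * intro!: product_integral_prod f)
qed

lemma integrable_std_normal_density: "integrable lborel std_normal_density"
  by (rule integrable_normal_density) simp

lemma integrable_gauss: "integrable lborel (gauss :: 'a::euclidean_space \<Rightarrow> real)"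
  unfolding gauss_def[abs_def] by (intro lborel_integrable_prod_Basis integrable_std_normal_density)

lemma integral_gauss: "(LBINT x. gauss (x :: 'a::euclidean_space)) = 1"
  unfolding gauss_def[abs_def]
  by (subst lborel_integral_prod_Basis)
     (auto intro!: integrable_std_normal_density prod.neutral integral_normal_density)

lemma nn_integral_gauss: "(\<integral>\<^sup>+x. ennreal (gauss (x :: 'a::euclidean_space)) \<partial>lborel) = 1"
  by (subst nn_integral_eq_integral) (auto simp: integrable_gauss integral_gauss less_imp_le[OF gauss_pos])

text \<open>The product form of \<open>gauss\<close> splits the integral over the coordinates, where
  it is the characteristic function of the standard normal law. Up to a constant the Gaussian is its
  own Fourier transform, so it can be written back as a superposition of characters.\<close>

lemma gauss_fourier:
  "(CLINT l|lborel. gauss l *\<^sub>R iexp (x \<bullet> l)) = complex_of_real (exp (- (norm (x::'a::euclidean_space))\<^sup>2 / 2))"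
proof -
  have i: "integrable lborel (\<lambda>y. std_normal_density y *\<^sub>R iexp (a * y))" for a
    by (rule Bochner_Integration.integrable_bound[OF integrable_std_normal_density])
       (auto simp: norm_mult)
  have c: "(CLINT y|lborel. std_normal_density y *\<^sub>R iexp (a * y)) = complex_of_real (exp (- a\<^sup>2 / 2))" for a
    using char_std_normal_distribution unfolding char_def fun_eq_iff
    by (subst (asm) integral_density) auto
  have "gauss l *\<^sub>R iexp (x \<bullet> l) = (\<Prod>b\<in>Basis. std_normal_density (l \<bullet> b) *\<^sub>R iexp ((x \<bullet> b) * (l \<bullet> b)))" for l
  proof -
    have "iexp (x \<bullet> l) = (\<Prod>b\<in>Basis. iexp ((x \<bullet> b) * (l \<bullet> b)))"
      by (subst euclidean_inner) (simp add: sum_distrib_left flip: exp_sum)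
    then show ?thesis
      by (simp add: gauss_def scaleR_conv_of_real prod.distrib)
  qed
  then have "(CLINT l|lborel. gauss l *\<^sub>R iexp (x \<bullet> l)) = (\<Prod>b\<in>Basis. complex_of_real (exp (- (x \<bullet> b)\<^sup>2 / 2)))"
    unfolding c[symmetric] by (subst lborel_integral_prod_Basis[OF i, symmetric]) (simp only:)
  also have "\<dots> = complex_of_real (exp (- (norm x)\<^sup>2 / 2))"
    unfolding power2_norm_eq_inner euclidean_inner[of x x]
    by (simp add: sum_negf sum_divide_distrib power2_eq_square flip: of_real_prod exp_sum)
  finally show ?thesis .
qed

section \<open>Smoothing a probability law by a small Gaussian; Fourier inversion\<close>

definition smooth_density :: "'a::euclidean_space measure \<Rightarrow> real \<Rightarrow> 'a \<Rightarrow> real" where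
  "smooth_density \<mu> \<sigma> z = (LINT x|\<mu>. gauss ((z - x) /\<^sub>R \<sigma>)) / \<sigma> ^ DIM('a)"

abbreviation cf :: "'a::euclidean_space measure \<Rightarrow> 'a \<Rightarrow> complex" where
  "cf \<mu> l \<equiv> (CLINT x|\<mu>. iexp (l \<bullet> x))"

context
  fixes \<mu> :: "'a::euclidean_space measure"
  assumes prob: "prob_space \<mu>" and sets_mu [measurable_cong]: "sets \<mu> = sets borel"
begin

interpretation \<mu>: prob_space \<mu> by (rule prob)

text \<open>\<open>smooth_density \<mu> \<sigma>\<close> is the density of \<mu> convolved with a
  centred normal law of standard deviation \<sigma>. Writing the Gaussian as a Fourier integral and
  exchanging integrals expresses it by the characteristic function; the weight
  \<open>gauss l\<close> makes Fubini legitimate even if the characteristic function is not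
  integrable.\<close>

lemma smooth_density_fourier:
  "complex_of_real (smooth_density \<mu> \<sigma> z) =
     (CLINT l|lborel. gauss l *\<^sub>R (iexp ((z /\<^sub>R \<sigma>) \<bullet> l) * cf \<mu> (- (l /\<^sub>R \<sigma>)))) / (sqrt (2 * pi) * \<sigma>) ^ DIM('a)"
proof -
  interpret pair_sigma_finite \<mu> "lborel :: 'a measure" ..
  have g: "complex_of_real (gauss y) = (CLINT l|lborel. gauss l *\<^sub>R iexp (y \<bullet> l)) / sqrt (2 * pi) ^ DIM('a)" for y :: 'a
    by (simp add: gauss_fourier gauss_eq[of y])
  have int: "integrable (\<mu> \<Otimes>\<^sub>M lborel) (\<lambda>(x,l). gauss l *\<^sub>R iexp (((z - x) /\<^sub>R \<sigma>) \<bullet> l))"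
  proof (rule Fubini_integrable)
    show "integrable \<mu> (\<lambda>x. LINT y|lborel. norm (case (x, y) of (x, l) \<Rightarrow> gauss l *\<^sub>R iexp (((z - x) /\<^sub>R \<sigma>) \<bullet> l)))"
      using integral_gauss gauss_pos by (simp add: less_imp_le abs_of_pos)
    show "AE x in \<mu>. integrable lborel (\<lambda>y. case (x, y) of (x, l) \<Rightarrow> gauss l *\<^sub>R iexp (((z - x) /\<^sub>R \<sigma>) \<bullet> l))"
      by (intro AE_I2 Bochner_Integration.integrable_bound[OF integrable_gauss]) (auto simp: gauss_pos)
  qed measurable
  have "complex_of_real (LINT x|\<mu>. gauss ((z - x) /\<^sub>R \<sigma>)) = (CLINT x|\<mu>. complex_of_real (gauss ((z - x) /\<^sub>R \<sigma>)))"
    by simp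
  also have "\<dots> = (CLINT x|\<mu>. (CLINT l|lborel. gauss l *\<^sub>R iexp (((z - x) /\<^sub>R \<sigma>) \<bullet> l))) / sqrt (2 * pi) ^ DIM('a)"
    unfolding g by simp
  also have "(CLINT x|\<mu>. (CLINT l|lborel. gauss l *\<^sub>R iexp (((z - x) /\<^sub>R \<sigma>) \<bullet> l))) =
      (CLINT l|lborel. (CLINT x|\<mu>. gauss l *\<^sub>R iexp (((z - x) /\<^sub>R \<sigma>) \<bullet> l)))"
    using Fubini_integral[OF int] by simp
  also have "\<dots> = (CLINT l|lborel. gauss l *\<^sub>R (iexp ((z /\<^sub>R \<sigma>) \<bullet> l) * cf \<mu> (- (l /\<^sub>R \<sigma>))))"
  proof (intro Bochner_Integration.integral_cong refl)
    fix l :: 'a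
    have "gauss l *\<^sub>R iexp (((z - x) /\<^sub>R \<sigma>) \<bullet> l) = (gauss l *\<^sub>R iexp ((z /\<^sub>R \<sigma>) \<bullet> l)) * iexp ((- (l /\<^sub>R \<sigma>)) \<bullet> x)" for x
    proof -
      have "iexp (((z - x) /\<^sub>R \<sigma>) \<bullet> l) = iexp ((z /\<^sub>R \<sigma>) \<bullet> l) * iexp ((- (l /\<^sub>R \<sigma>)) \<bullet> x)"
        unfolding exp_add[symmetric]
        by (rule arg_cong[where f = exp]) (simp add: inner_diff_left algebra_simps inner_commute)
      then show ?thesis by simp
    qed
    then have "(CLINT x|\<mu>. gauss l *\<^sub>R iexp (((z - x) /\<^sub>R \<sigma>) \<bullet> l)) =
        (CLINT x|\<mu>. (gauss l *\<^sub>R iexp ((z /\<^sub>R \<sigma>) \<bullet> l)) * iexp ((- (l /\<^sub>R \<sigma>)) \<bullet> x))"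
      by (simp only:)
    then show "(CLINT x|\<mu>. gauss l *\<^sub>R iexp (((z - x) /\<^sub>R \<sigma>) \<bullet> l)) = gauss l *\<^sub>R (iexp ((z /\<^sub>R \<sigma>) \<bullet> l) * cf \<mu> (- (l /\<^sub>R \<sigma>)))"
      by (simp only: integral_mult_right_zero) (simp only: mult_scaleR_left)
  qed
  finally show ?thesis
    by (simp add: smooth_density_def power_mult_distrib mult.commute)
qed

lemma smooth_density_nonneg: "0 < \<sigma> \<Longrightarrow> 0 \<le> smooth_density \<mu> \<sigma> z"
  unfolding smooth_density_def by (intro divide_nonneg_nonneg integral_nonneg_AE) (auto simp: less_imp_le gauss_pos)

text \<open>Substitution z = x + \<sigma> n and an exchange of integrals: the left side is the mean
  of g at a point with law \<mu> perturbed by independent Gaussian noise.\<close>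

lemma nn_integral_smoothing:
  fixes g :: "'a \<Rightarrow> ennreal"
  assumes [measurable]: "g \<in> borel_measurable borel" and s: "0 < \<sigma>"
  shows "(\<integral>\<^sup>+x. (\<integral>\<^sup>+n. g (x + \<sigma> *\<^sub>R n) * gauss n \<partial>lborel) \<partial>\<mu>) = (\<integral>\<^sup>+z. g z * smooth_density \<mu> \<sigma> z \<partial>lborel)"
proof -
  interpret pair_sigma_finite \<mu> "lborel :: 'a measure" ..
  have "(\<integral>\<^sup>+n. g (x + \<sigma> *\<^sub>R n) * gauss n \<partial>lborel) =
     (\<integral>\<^sup>+z. g z * ennreal (gauss ((z - x) /\<^sub>R \<sigma>) / \<sigma> ^ DIM('a)) \<partial>lborel)" for x
  proof -
    have e: "ennreal (\<sigma> ^ DIM('a)) * (a * ennreal (gauss m / \<sigma> ^ DIM('a))) = a * ennreal (gauss m)" for a and m :: 'a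
      using s by (simp add: mult.left_commute[of _ a] gauss_pos less_imp_le flip: ennreal_mult)
    show ?thesis
      using s by (subst (2) lborel_affine[of \<sigma> x])
        (simp_all add: nn_integral_density nn_integral_distr e)
  qed
  then have "(\<integral>\<^sup>+x. (\<integral>\<^sup>+n. g (x + \<sigma> *\<^sub>R n) * gauss n \<partial>lborel) \<partial>\<mu>) =
     (\<integral>\<^sup>+x. (\<integral>\<^sup>+z. g z * ennreal (gauss ((z - x) /\<^sub>R \<sigma>) / \<sigma> ^ DIM('a)) \<partial>lborel) \<partial>\<mu>)"
    by simp
  also have "\<dots> = (\<integral>\<^sup>+z. (\<integral>\<^sup>+x. g z * ennreal (gauss ((z - x) /\<^sub>R \<sigma>) / \<sigma> ^ DIM('a)) \<partial>\<mu>) \<partial>lborel)"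
    by (rule Fubini'[symmetric]) measurable
  also have "\<dots> = (\<integral>\<^sup>+z. g z * smooth_density \<mu> \<sigma> z \<partial>lborel)"
  proof (intro nn_integral_cong)
    fix z :: 'a
    have "integrable \<mu> (\<lambda>x. gauss ((z - x) /\<^sub>R \<sigma>))"
      by (rule \<mu>.integrable_const_bound[of _ "1 / sqrt (2 * pi) ^ DIM('a)"])
         (auto simp: gauss_eq divide_right_mono)
    then have "(\<integral>\<^sup>+x. ennreal (gauss ((z - x) /\<^sub>R \<sigma>) / \<sigma> ^ DIM('a)) \<partial>\<mu>) = smooth_density \<mu> \<sigma> z"
      unfolding smooth_density_def using s
      by (subst nn_integral_eq_integral) (auto simp: less_imp_le gauss_pos)
    then show "(\<integral>\<^sup>+x. g z * ennreal (gauss ((z - x) /\<^sub>R \<sigma>) / \<sigma> ^ DIM('a)) \<partial>\<mu>) = g z * smooth_density \<mu> \<sigma> z"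
      by (subst nn_integral_cmult) auto
  qed
  finally show ?thesis .
qed

lemma smoothing_tendsto:
  fixes g :: "'a \<Rightarrow> real"
  assumes g: "continuous_on UNIV g" "\<And>x. 0 \<le> g x" "\<And>x. g x \<le> B" and s: "\<sigma> \<longlonglongrightarrow> 0"
  shows "(\<lambda>k. \<integral>\<^sup>+x. (\<integral>\<^sup>+n. ennreal (g (x + \<sigma> k *\<^sub>R n)) * gauss n \<partial>lborel) \<partial>\<mu>) \<longlonglongrightarrow> (\<integral>\<^sup>+x. g x \<partial>\<mu>)"
proof -
  have [measurable]: "g \<in> borel_measurable borel"
    using g(1) by (rule borel_measurable_continuous_onI)
  have B: "0 \<le> B" using g(2,3)[of 0] by simp
  have inner: "(\<lambda>k. \<integral>\<^sup>+n. ennreal (g (x + \<sigma> k *\<^sub>R n)) * gauss n \<partial>lborel) \<longlonglongrightarrow> (\<integral>\<^sup>+n. ennreal (g x) * gauss (n::'a) \<partial>lborel)" for x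
  proof (rule nn_integral_dominated_convergence[where w = "\<lambda>n::'a. ennreal B * ennreal (gauss n)"])
    show "(\<integral>\<^sup>+n. ennreal B * ennreal (gauss (n::'a)) \<partial>lborel) < \<infinity>"
      by (simp add: nn_integral_cmult nn_integral_gauss)
    show "AE n in lborel. (\<lambda>k. ennreal (g (x + \<sigma> k *\<^sub>R n)) * ennreal (gauss n)) \<longlonglongrightarrow> ennreal (g x) * ennreal (gauss n)"
    proof (rule AE_I2)
      fix n
      have "(\<lambda>k. x + \<sigma> k *\<^sub>R n) \<longlonglongrightarrow> x + 0 *\<^sub>R n" by (intro tendsto_intros s)
      then have "(\<lambda>k. g (x + \<sigma> k *\<^sub>R n)) \<longlonglongrightarrow> g x"
        using continuous_on_tendsto_compose[OF g(1)] by simp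
      then show "(\<lambda>k. ennreal (g (x + \<sigma> k *\<^sub>R n)) * ennreal (gauss n)) \<longlonglongrightarrow> ennreal (g x) * ennreal (gauss n)"
        by (simp add: g gauss_pos less_imp_le tendsto_intros flip: ennreal_mult)
    qed
  qed (auto intro!: mult_right_mono ennreal_leI g)
  have "(\<lambda>k. \<integral>\<^sup>+x. (\<integral>\<^sup>+n. ennreal (g (x + \<sigma> k *\<^sub>R n)) * gauss n \<partial>lborel) \<partial>\<mu>) \<longlonglongrightarrow>
      (\<integral>\<^sup>+x. (\<integral>\<^sup>+n. ennreal (g x) * gauss (n::'a) \<partial>lborel) \<partial>\<mu>)"
  proof (rule nn_integral_dominated_convergence[where w = "\<lambda>n. ennreal B"])
    show "AE x in \<mu>. (\<integral>\<^sup>+n. ennreal (g (x + \<sigma> k *\<^sub>R n)) * gauss n \<partial>lborel) \<le> ennreal B" for k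
    proof (rule AE_I2)
      fix x
      have "(\<integral>\<^sup>+n. ennreal (g (x + \<sigma> k *\<^sub>R n)) * gauss n \<partial>lborel) \<le> (\<integral>\<^sup>+n. ennreal B * gauss (n::'a) \<partial>lborel)"
        by (intro nn_integral_mono mult_right_mono ennreal_leI g) auto
      then show "(\<integral>\<^sup>+n. ennreal (g (x + \<sigma> k *\<^sub>R n)) * gauss n \<partial>lborel) \<le> ennreal B"
        by (simp add: nn_integral_cmult nn_integral_gauss)
    qed
  qed (use inner in \<open>auto simp: \<mu>.emeasure_space_1\<close>)
  then show ?thesis
    by (simp add: nn_integral_cmult nn_integral_gauss)
qed

text \<open>For a nonnegative characteristic function the inversion integrand at z = 0 equals the
  modulus of the integrand at any other z. Nothing cancels at the origin, so the smoothed density is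
  largest there.\<close>

lemma smooth_density_le_at_zero:
  assumes phi: "\<And>l. cf \<mu> l = complex_of_real (\<phi> l)" and nn: "\<And>l. 0 \<le> \<phi> l" and s: "0 < \<sigma>"
  shows "smooth_density \<mu> \<sigma> z \<le> smooth_density \<mu> \<sigma> 0"
proof -
  have phi1: "\<phi> l \<le> 1" for l
  proof -
    have "norm (cf \<mu> l) \<le> (LINT x|\<mu>. norm (iexp (l \<bullet> x)))" by (rule integral_norm_bound)
    then show ?thesis using phi[of l] nn[of l] by (simp add: \<mu>.prob_space)
  qed
  have [measurable]: "(\<lambda>l. \<phi> (- (l /\<^sub>R \<sigma>))) \<in> borel_measurable borel"
  proof -
    have "(\<lambda>l. \<phi> (- (l /\<^sub>R \<sigma>))) = (\<lambda>l. Re (cf \<mu> (- (l /\<^sub>R \<sigma>))))" unfolding phi by simp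
    also have "\<dots> \<in> borel_measurable borel" by measurable
    finally show ?thesis .
  qed
  have int: "integrable lborel (\<lambda>l::'a. gauss l * \<phi> (- (l /\<^sub>R \<sigma>)))"
    by (rule Bochner_Integration.integrable_bound[OF integrable_gauss])
       (auto simp: abs_mult nn phi1 gauss_pos intro!: mult_left_le)
  define c where "c = (sqrt (2 * pi) * \<sigma>) ^ DIM('a)"
  have c: "0 < c" using s by (simp add: c_def)
  have eq: "complex_of_real (smooth_density \<mu> \<sigma> z) =
      (CLINT l|lborel. (gauss l * \<phi> (- (l /\<^sub>R \<sigma>))) *\<^sub>R iexp ((z /\<^sub>R \<sigma>) \<bullet> l)) / c" for z
    unfolding smooth_density_fourier phi c_def
    by (intro arg_cong2[where f = "(/)"] Bochner_Integration.integral_cong refl)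
       (simp_all add: scaleR_conv_of_real mult.commute mult.left_commute)
  have "smooth_density \<mu> \<sigma> z \<le> norm (complex_of_real (smooth_density \<mu> \<sigma> z))" by simp
  also have "\<dots> \<le> (LINT l|lborel. norm ((gauss l * \<phi> (- (l /\<^sub>R \<sigma>))) *\<^sub>R iexp ((z /\<^sub>R \<sigma>) \<bullet> l))) / c"
    unfolding eq norm_divide using c by (intro divide_mono integral_norm_bound) auto
  also have "\<dots> = (LINT l|lborel. gauss l * \<phi> (- (l /\<^sub>R \<sigma>))) / c"
    by (simp add: abs_mult nn gauss_pos abs_of_pos)
  also have "complex_of_real \<dots> = complex_of_real (smooth_density \<mu> \<sigma> 0)"
    unfolding eq by (simp add: scaleR_conv_of_real flip: of_real_mult)
  then have "(LINT l|lborel. gauss l * \<phi> (- (l /\<^sub>R \<sigma>))) / c = smooth_density \<mu> \<sigma> 0"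
    using of_real_eq_iff by blast
  finally show ?thesis .
qed

text \<open>Smooth, bound the density everywhere by its value at the origin, and let the noise
  vanish. One number per scale thus controls all test functions, whether or not \<mu> has a
  density.\<close>

lemma nn_integral_le_of_smooth_density_limit:
  fixes g :: "'a \<Rightarrow> real"
  assumes phi: "\<And>l. cf \<mu> l = complex_of_real (\<phi> l)" and nn: "\<And>l. 0 \<le> \<phi> l"
    and g: "continuous_on UNIV g" "\<And>x. 0 \<le> g x" "\<And>x. g x \<le> B" "integrable lborel g"
    and s: "\<sigma> \<longlonglongrightarrow> 0" "\<And>k. 0 < \<sigma> k"
    and K: "\<And>k. smooth_density \<mu> (\<sigma> k) 0 \<le> K k" "K \<longlonglongrightarrow> \<kappa>"
  shows "(LINT x|\<mu>. g x) \<le> \<kappa> * (LBINT x. g x)"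
proof -
  have [measurable]: "g \<in> borel_measurable borel"
    using g(1) by (rule borel_measurable_continuous_onI)
  have Kn: "0 \<le> K k" for k using smooth_density_nonneg[OF s(2), of k 0] K(1)[of k] by linarith
  have kn: "0 \<le> \<kappa>" using LIMSEQ_le_const[OF K(2)] Kn by blast
  have ig: "integrable \<mu> g"
    by (rule \<mu>.integrable_const_bound[of _ B]) (auto simp: g)
  have bound: "(\<integral>\<^sup>+x. (\<integral>\<^sup>+n. ennreal (g (x + \<sigma> k *\<^sub>R n)) * gauss n \<partial>lborel) \<partial>\<mu>) \<le> ennreal (K k * (LBINT x. g x))" for k
  proof -
    have "(\<integral>\<^sup>+x. (\<integral>\<^sup>+n. ennreal (g (x + \<sigma> k *\<^sub>R n)) * gauss n \<partial>lborel) \<partial>\<mu>) = (\<integral>\<^sup>+z. ennreal (g z) * smooth_density \<mu> (\<sigma> k) z \<partial>lborel)"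
      by (rule nn_integral_smoothing) (auto simp: s)
    also have "\<dots> \<le> (\<integral>\<^sup>+z. ennreal (g z) * ennreal (K k) \<partial>lborel)"
      using smooth_density_le_at_zero[OF phi nn s(2)] K(1)
      by (intro nn_integral_mono mult_left_mono ennreal_leI) (auto intro: order_trans)
    also have "\<dots> = ennreal (K k * (LBINT x. g x))"
      by (subst nn_integral_multc)
         (auto simp: nn_integral_eq_integral g ennreal_mult Kn mult.commute integral_nonneg_AE)
    finally show ?thesis .
  qed
  have "(\<integral>\<^sup>+x. g x \<partial>\<mu>) \<le> ennreal (\<kappa> * (LBINT x. g x))"
    by (rule LIMSEQ_le[OF smoothing_tendsto[OF g(1-3) s(1)]])
       (use bound in \<open>auto intro!: tendsto_ennrealI tendsto_mult_right K\<close>)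
  then show ?thesis
    by (subst (asm) nn_integral_eq_integral) (auto simp: ig g kn integral_nonneg_AE)
qed

end

section \<open>Characteristic functions determine laws\<close>

lemma prob_measure_eqI_bounded_continuous:
  fixes \<mu> \<nu> :: "'a::euclidean_space measure"
  assumes \<mu>: "prob_space \<mu>" "sets \<mu> = sets borel" and \<nu>: "prob_space \<nu>" "sets \<nu> = sets borel"
    and eq: "\<And>g::'a \<Rightarrow> real. continuous_on UNIV g \<Longrightarrow> (\<And>x. 0 \<le> g x) \<Longrightarrow> (\<And>x. g x \<le> 1) \<Longrightarrow>
       (\<integral>\<^sup>+x. ennreal (g x) \<partial>\<mu>) = (\<integral>\<^sup>+x. ennreal (g x) \<partial>\<nu>)"
  shows "\<mu> = \<nu>"
proof (rule measure_eqI_generator_eq[where \<Omega> = UNIV and E = "Collect closed" and A = "\<lambda>_. UNIV"])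
  interpret \<mu>: prob_space \<mu> by fact
  interpret \<nu>: prob_space \<nu> by fact
  note [measurable_cong] = \<mu>(2) \<nu>(2) and [measurable] = borel_closed
  show "Int_stable (Collect (closed :: 'a set \<Rightarrow> bool))" by (auto simp: Int_stable_def)
  show "sets \<mu> = sigma_sets UNIV (Collect closed)" "sets \<nu> = sigma_sets UNIV (Collect closed)"
    using \<mu>(2) \<nu>(2) by (simp_all add: borel_eq_closed)
  show "emeasure \<mu> UNIV \<noteq> \<infinity>" for i :: nat
    by (simp add: \<mu>.emeasure_eq_measure)
  fix C :: "'a set" assume "C \<in> Collect closed"
  then have C: "closed C" by simp
  show "emeasure \<mu> C = emeasure \<nu> C"
  proof (cases "C = {}")
    case False
    \<comment> \<open>Lipschitz functions that decrease to the indicator of C; they vanish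
      eventually off C because a point outside a closed set has positive distance to it.\<close>
    define g where "g k x = max 0 (1 - real k * infdist x C)" for k x
    have cg: "continuous_on UNIV (g k)" for k
      unfolding g_def by (intro continuous_intros)
    have [measurable]: "g k \<in> borel_measurable borel" for k
      by (intro borel_measurable_continuous_onI cg)
    have g01: "0 \<le> g k x" "g k x \<le> 1" for k x by (auto simp: g_def infdist_nonneg)
    have lim: "(\<lambda>k. ennreal (g k x)) \<longlonglongrightarrow> indicator C x" for x
    proof (cases "x \<in> C")
      case True then show ?thesis by (simp add: g_def)
    next
      case x: False
      then have p: "0 < infdist x C" using C False by (simp add: infdist_pos_not_in_closed)
      have "eventually (\<lambda>k. g k x = 0) sequentially"
        using eventually_ge_at_top[of "nat \<lceil>1 / infdist x C\<rceil>"]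
      proof eventually_elim
        case (elim k)
        then have "1 / infdist x C \<le> real k" by linarith
        then show ?case using p by (simp add: g_def field_simps)
      qed
      then show ?thesis using x by (auto intro!: tendsto_eventually elim!: eventually_mono)
    qed
    have l1: "(\<lambda>k. \<integral>\<^sup>+x. g k x \<partial>\<mu>) \<longlonglongrightarrow> (\<integral>\<^sup>+x. indicator C x \<partial>\<mu>)"
      using C by (intro nn_integral_dominated_convergence[where w = "\<lambda>_. 1"]) (auto simp: g01 lim \<mu>.emeasure_space_1)
    have l2: "(\<lambda>k. \<integral>\<^sup>+x. g k x \<partial>\<nu>) \<longlonglongrightarrow> (\<integral>\<^sup>+x. indicator C x \<partial>\<nu>)"
      using C by (intro nn_integral_dominated_convergence[where w = "\<lambda>_. 1"]) (auto simp: g01 lim \<nu>.emeasure_space_1)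
    have "(\<integral>\<^sup>+x. indicator C x \<partial>\<mu>) = (\<integral>\<^sup>+x. indicator C x \<partial>\<nu>)"
      using LIMSEQ_unique[OF l1] l2 eq[OF cg g01] by simp
    then show ?thesis using C \<mu>(2) \<nu>(2) by simp
  qed simp
qed auto

text \<open>By inversion both laws have the same smoothed densities, and bounded continuous
  functions recover each law as the limit of its smoothings.\<close>

lemma cf_unique:
  fixes \<mu> \<nu> :: "'a::euclidean_space measure"
  assumes \<mu>: "prob_space \<mu>" "sets \<mu> = sets borel" and \<nu>: "prob_space \<nu>" "sets \<nu> = sets borel"
    and eq: "\<And>l. cf \<mu> l = cf \<nu> l"
  shows "\<mu> = \<nu>"
proof (rule prob_measure_eqI_bounded_continuous[OF \<mu> \<nu>])
  fix g :: "'a \<Rightarrow> real" assume g: "continuous_on UNIV g" "\<And>x. 0 \<le> g x" "\<And>x. g x \<le> 1"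
  have [measurable]: "g \<in> borel_measurable borel"
    using g(1) by (rule borel_measurable_continuous_onI)
  define \<sigma> where "\<sigma> k = 1 / real (Suc k)" for k
  have s: "\<sigma> \<longlonglongrightarrow> 0" "\<And>k. 0 < \<sigma> k"
    unfolding \<sigma>_def using LIMSEQ_inverse_real_of_nat by (auto simp: inverse_eq_divide)
  have "complex_of_real (smooth_density \<mu> (\<sigma> k) z) = complex_of_real (smooth_density \<nu> (\<sigma> k) z)" for k z
    unfolding smooth_density_fourier[OF \<mu>] smooth_density_fourier[OF \<nu>] eq ..
  then have "smooth_density \<mu> (\<sigma> k) z = smooth_density \<nu> (\<sigma> k) z" for k z
    using of_real_eq_iff by blast
  then have "(\<integral>\<^sup>+x. (\<integral>\<^sup>+n. ennreal (g (x + \<sigma> k *\<^sub>R n)) * gauss n \<partial>lborel) \<partial>\<mu>)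
     = (\<integral>\<^sup>+x. (\<integral>\<^sup>+n. ennreal (g (x + \<sigma> k *\<^sub>R n)) * gauss n \<partial>lborel) \<partial>\<nu>)" for k
    by (subst nn_integral_smoothing[OF \<mu> _ s(2)], simp, subst nn_integral_smoothing[OF \<nu> _ s(2)]) simp_all
  then show "(\<integral>\<^sup>+x. g x \<partial>\<mu>) = (\<integral>\<^sup>+x. g x \<partial>\<nu>)"
    using LIMSEQ_unique[OF smoothing_tendsto[OF \<mu> g s(1)]] smoothing_tendsto[OF \<nu> g s(1)] by simp
qed

section \<open>Affine substitution, rescaled kernels and approximate identities\<close>

lemma
  fixes h :: "'a::euclidean_space \<Rightarrow> 'b::{banach,second_countable_topology}"
  assumes [measurable]: "h \<in> borel_measurable borel" and c: "c \<noteq> 0"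
  shows lborel_integral_affine: "(LBINT x. h x) = \<bar>c\<bar> ^ DIM('a) *\<^sub>R (LBINT x. h (t + c *\<^sub>R x))"
    and lborel_integrable_affine: "integrable lborel h \<longleftrightarrow> integrable lborel (\<lambda>x. h (t + c *\<^sub>R x))"
proof -
  show "(LBINT x. h x) = \<bar>c\<bar> ^ DIM('a) *\<^sub>R (LBINT x. h (t + c *\<^sub>R x))"
    using c by (subst lborel_affine[of c t]) (simp_all add: integral_density integral_distr)
  have "integrable lborel h \<longleftrightarrow>
      integrable (density (distr lborel borel (\<lambda>x. t + c *\<^sub>R x)) (\<lambda>_. ennreal (\<bar>c\<bar> ^ DIM('a)))) h"
    using lborel_affine[OF c, of t] by simp
  also have "\<dots> \<longleftrightarrow> integrable lborel (\<lambda>x. \<bar>c\<bar> ^ DIM('a) *\<^sub>R h (t + c *\<^sub>R x))"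
    by (subst integrable_density) (auto simp: integrable_distr_eq)
  also have "\<dots> \<longleftrightarrow> integrable lborel (\<lambda>x. h (t + c *\<^sub>R x))"
  proof
    assume "integrable lborel (\<lambda>x. \<bar>c\<bar> ^ DIM('a) *\<^sub>R h (t + c *\<^sub>R x))"
    then have "integrable lborel (\<lambda>x. inverse (\<bar>c\<bar> ^ DIM('a)) *\<^sub>R (\<bar>c\<bar> ^ DIM('a) *\<^sub>R h (t + c *\<^sub>R x)))"
      by (rule integrable_scaleR_right)
    moreover have "inverse (\<bar>c\<bar> ^ DIM('a)) *\<^sub>R (\<bar>c\<bar> ^ DIM('a) *\<^sub>R h (t + c *\<^sub>R x)) = h (t + c *\<^sub>R x)" for x
      unfolding scaleR_scaleR using c by simp
    ultimately show "integrable lborel (\<lambda>x. h (t + c *\<^sub>R x))" by simp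
  qed (rule integrable_scaleR_right)
  finally show "integrable lborel h \<longleftrightarrow> integrable lborel (\<lambda>x. h (t + c *\<^sub>R x))" .
qed

lemma borel_measurable_rescale [measurable]:
  "g \<in> borel_measurable borel \<Longrightarrow> rescale g \<epsilon> \<in> borel_measurable borel"
  unfolding rescale_def[abs_def] by simp

lemma
  fixes g :: "'a::euclidean_space \<Rightarrow> real"
  assumes g: "integrable lborel g" and e: "0 < \<epsilon>"
  shows integrable_rescale: "integrable lborel (rescale g \<epsilon>)"
    and integral_rescale: "(LBINT x. rescale g \<epsilon> x) = (LBINT x. g x)"
proof -
  have [measurable]: "g \<in> borel_measurable borel"
    using borel_measurable_integrable[OF g] by simp
  have eq: "rescale g \<epsilon> (\<epsilon> *\<^sub>R x) = g x / \<epsilon> ^ DIM('a)" for x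
    using e by (simp add: rescale_def)
  show "integrable lborel (rescale g \<epsilon>)"
    using g e by (subst lborel_integrable_affine[of _ \<epsilon> 0]) (auto simp: eq)
  show "(LBINT x. rescale g \<epsilon> x) = (LBINT x. g x)"
    using e by (subst lborel_integral_affine[of _ \<epsilon> 0]) (auto simp: eq)
qed

text \<open>Far from the origin the decay of \<open>g\<close> makes the rescaled kernel uniformly small, so only the
  behaviour of \<open>p\<close> near the origin matters.\<close>

lemma approximate_identity:
  fixes g p :: "'a::euclidean_space \<Rightarrow> real"
  assumes g: "integrable lborel g" "\<And>x. 0 \<le> g x" "(LBINT x. g x) = 1"
      "\<And>x. norm x ^ (DIM('a) + 1) * g x \<le> B"
    and p: "continuous_on UNIV p" "\<And>x. 0 \<le> p x" "integrable lborel p"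
    and s: "\<sigma> \<longlonglongrightarrow> 0" "\<And>k. 0 < \<sigma> k"
  shows "(\<lambda>k. LBINT x. rescale g (\<sigma> k) x * p x) \<longlonglongrightarrow> p 0"
proof -
  have [measurable]: "g \<in> borel_measurable borel" "p \<in> borel_measurable borel"
    using borel_measurable_integrable[OF g(1)] borel_measurable_integrable[OF p(3)] by simp_all
  have "isCont p 0" using p(1) by (simp add: continuous_on_eq_continuous_at)
  then obtain r where r: "0 < r" "\<And>x. norm x < r \<Longrightarrow> \<bar>p x - p 0\<bar> < 1"
    unfolding continuous_at_eps_delta by (metis dist_norm diff_zero real_norm_def zero_less_one dist_real_def)
  define N where "N x = p x * indicator (ball 0 r) x" for x
  define F where "F x = p x * indicator (- ball 0 r) x" for x
  have [measurable]: "N \<in> borel_measurable borel" "F \<in> borel_measurable borel"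
    unfolding N_def[abs_def] F_def[abs_def]
    by (intro borel_measurable_times borel_measurable_indicator; simp)+
  have Nb: "0 \<le> N x" "N x \<le> p 0 + 1" for x
    using r(2)[of x] p(2)[of x] p(2)[of 0] by (auto simp: N_def indicator_def)
  have rn: "0 \<le> rescale g (\<sigma> k) x" for k x
    using s(2)[of k] by (auto simp: rescale_def g intro!: divide_nonneg_nonneg)
  have iN: "integrable lborel (\<lambda>x. rescale g (\<sigma> k) x * N x)" for k
    by (rule Bochner_Integration.integrable_bound[where f = "\<lambda>x. (p 0 + 1) * rescale g (\<sigma> k) x"])
       (auto simp: integrable_rescale g s abs_mult rn Nb p mult.commute intro!: mult_right_mono AE_I2)
  have "(\<lambda>k. LBINT x. g x * N (\<sigma> k *\<^sub>R x)) \<longlonglongrightarrow> (LBINT x. g x * p 0)"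
  proof (rule integral_dominated_convergence[where w = "\<lambda>x. (p 0 + 1) * g x"])
    show "AE x in lborel. (\<lambda>k. g x * N (\<sigma> k *\<^sub>R x)) \<longlonglongrightarrow> g x * p 0"
    proof (rule AE_I2)
      fix x :: 'a
      have l: "(\<lambda>k. \<sigma> k *\<^sub>R x) \<longlonglongrightarrow> 0"
        using tendsto_scaleR[OF s(1) tendsto_const[of x]] by simp
      then have "(\<lambda>k. p (\<sigma> k *\<^sub>R x)) \<longlonglongrightarrow> p 0"
        using continuous_on_tendsto_compose[OF p(1)] by simp
      moreover have "eventually (\<lambda>k. N (\<sigma> k *\<^sub>R x) = p (\<sigma> k *\<^sub>R x)) sequentially"
        using order_tendstoD(2)[OF tendsto_norm_zero[OF l] r(1)] by eventually_elim (simp add: N_def)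
      ultimately have "(\<lambda>k. N (\<sigma> k *\<^sub>R x)) \<longlonglongrightarrow> p 0"
        by (simp add: tendsto_cong)
      then show "(\<lambda>k. g x * N (\<sigma> k *\<^sub>R x)) \<longlonglongrightarrow> g x * p 0"
        by (intro tendsto_intros)
    qed
  next
    show "AE x in lborel. norm (g x * N (\<sigma> k *\<^sub>R x)) \<le> (p 0 + 1) * g x" for k
      using mult_left_mono[OF Nb(2) g(2)] by (intro AE_I2) (simp add: abs_mult g Nb mult.commute[of "p 0 + 1"])
  qed (auto simp: g)
  moreover have "(LBINT x. g x * N (\<sigma> k *\<^sub>R x)) = (LBINT x. rescale g (\<sigma> k) x * N x)" for k
  proof -
    have "(LBINT x. rescale g (\<sigma> k) x * N x) =
        \<bar>\<sigma> k\<bar> ^ DIM('a) *\<^sub>R (LBINT x. rescale g (\<sigma> k) (0 + \<sigma> k *\<^sub>R x) * N (0 + \<sigma> k *\<^sub>R x))"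
      using s(2)[of k] by (intro lborel_integral_affine) auto
    also have "\<dots> = (LBINT x. g x * N (\<sigma> k *\<^sub>R x))"
      using s(2)[of k] by (simp add: rescale_def)
    finally show ?thesis ..
  qed
  ultimately have near: "(\<lambda>k. LBINT x. rescale g (\<sigma> k) x * N x) \<longlonglongrightarrow> p 0"
    by (simp add: g)
  define C where "C = B / r ^ (DIM('a) + 1)"
  have B: "0 \<le> B" using g(4)[of 0] by simp
  have C: "0 \<le> C" using B r by (simp add: C_def)
  have fb: "rescale g (\<sigma> k) x * F x \<le> C * \<sigma> k * p x" for k x
  proof (cases "norm x < r")
    case True then show ?thesis using s(2)[of k] C p(2)[of x] by (simp add: F_def)
  next
    case False
    have s': "0 < \<sigma> k" by (rule s)
    have "rescale g (\<sigma> k) x * r ^ (DIM('a) + 1) \<le> rescale g (\<sigma> k) x * norm x ^ (DIM('a) + 1)"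
      using False r rn by (intro mult_left_mono power_mono) auto
    also have "\<dots> = \<sigma> k * (norm (x /\<^sub>R \<sigma> k) ^ (DIM('a) + 1) * g (x /\<^sub>R \<sigma> k))"
      using s' by (simp add: rescale_def power_mult_distrib power_inverse field_simps)
    also have "\<dots> \<le> \<sigma> k * B" by (rule mult_left_mono[OF g(4) less_imp_le[OF s']])
    finally have "rescale g (\<sigma> k) x \<le> C * \<sigma> k"
      using r by (simp add: C_def field_simps)
    then show ?thesis using False p(2)[of x] by (simp add: F_def mult_right_mono)
  qed
  have iF: "integrable lborel (\<lambda>x. rescale g (\<sigma> k) x * F x)" for k
  proof (rule Bochner_Integration.integrable_bound[where f = "\<lambda>x. (C * \<sigma> k) * p x"])
    show "AE x in lborel. norm (rescale g (\<sigma> k) x * F x) \<le> norm (C * \<sigma> k * p x)"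
    proof (rule AE_I2)
      fix x
      have "0 \<le> rescale g (\<sigma> k) x * F x" using rn p by (auto simp: F_def)
      then show "norm (rescale g (\<sigma> k) x * F x) \<le> norm (C * \<sigma> k * p x)" using fb[of k x] by simp
    qed
  qed (auto simp: p)
  have far: "(\<lambda>k. LBINT x. rescale g (\<sigma> k) x * F x) \<longlonglongrightarrow> 0"
  proof (rule tendsto_sandwich[OF _ _ tendsto_const])
    show "eventually (\<lambda>k. 0 \<le> (LBINT x. rescale g (\<sigma> k) x * F x)) sequentially"
      using rn p by (intro always_eventually allI integral_nonneg_AE AE_I2) (auto simp: F_def)
    show "eventually (\<lambda>k. (LBINT x. rescale g (\<sigma> k) x * F x) \<le> C * \<sigma> k * (LBINT x. p x)) sequentially"
    proof (intro always_eventually allI)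
      fix k
      have "(LBINT x. rescale g (\<sigma> k) x * F x) \<le> (LBINT x. C * \<sigma> k * p x)"
        by (intro integral_mono iF fb) (auto simp: p)
      then show "(LBINT x. rescale g (\<sigma> k) x * F x) \<le> C * \<sigma> k * (LBINT x. p x)" by simp
    qed
    show "(\<lambda>k. C * \<sigma> k * (LBINT x. p x)) \<longlonglongrightarrow> 0"
      using s(1) by (auto intro!: tendsto_eq_intros)
  qed
  have "rescale g (\<sigma> k) x * p x = rescale g (\<sigma> k) x * N x + rescale g (\<sigma> k) x * F x" for k x
    by (auto simp: N_def F_def indicator_def)
  then show ?thesis
    using tendsto_add[OF near far] by (simp add: Bochner_Integration.integral_add[OF iN iF])
qed

section \<open>Density bounds for laws with nonnegative characteristic function\<close>

lemma gauss_decay: "\<exists>B. \<forall>x::'a::euclidean_space. norm x ^ n * gauss x \<le> B"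
proof -
  have lim: "((\<lambda>r::real. r ^ n * exp (- r\<^sup>2 / 2)) \<longlongrightarrow> 0) at_top"
    by real_asymp
  then have "eventually (\<lambda>r::real. r ^ n * exp (- r\<^sup>2 / 2) < 1) at_top"
    by (rule order_tendstoD) simp
  then obtain R :: real where R: "\<And>r. R \<le> r \<Longrightarrow> r ^ n * exp (- r\<^sup>2 / 2) < 1"
    by (auto simp: eventually_at_top_linorder)
  define c where "c = sqrt (2 * pi) ^ DIM('a)"
  have c: "0 < c" by (simp add: c_def)
  have "norm x ^ n * exp (- (norm x)\<^sup>2 / 2) \<le> 1 + \<bar>R\<bar> ^ n" for x :: 'a
  proof (cases "R \<le> norm x")
    case True then show ?thesis using R[OF True] by (simp add: add_increasing2)
  next
    case False
    then have "norm x ^ n * exp (- (norm x)\<^sup>2 / 2) \<le> \<bar>R\<bar> ^ n * 1"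
      by (intro mult_mono power_mono) auto
    then show ?thesis by simp
  qed
  then have "norm x ^ n * gauss x \<le> (1 + \<bar>R\<bar> ^ n) / c" for x :: 'a
    using c by (simp add: gauss_eq c_def[symmetric] divide_right_mono)
  then show ?thesis by blast
qed

text \<open>Comparison with a product of Cauchy kernels: the exponential beats any power of 1 +
  |l|^2, and the d-th power dominates the product of the factors 1 + (l \<bullet> b)^2, whose
  inverse is integrable coordinate by coordinate.\<close>

lemma integrable_exp_minus_norm_powr:
  assumes c: "0 < c" and \<beta>: "0 < \<beta>"
  shows "integrable lborel (\<lambda>l::'a::euclidean_space. exp (- (c * norm l powr \<beta>)))"
proof -
  define d where "d = real DIM('a)"
  have d: "0 < d" by (simp add: d_def)
  have "eventually (\<lambda>r. d * ln (1 + r\<^sup>2) \<le> c * r powr \<beta>) at_top"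
    using c \<beta> d by real_asymp
  then obtain R where R: "\<And>r. R \<le> r \<Longrightarrow> d * ln (1 + r\<^sup>2) \<le> c * r powr \<beta>"
    by (auto simp: eventually_at_top_linorder)
  define D where "D = (1 + R\<^sup>2) powr d"
  have bound: "exp (- (c * norm l powr \<beta>)) \<le> (1 + D) * (\<Prod>b\<in>Basis. inverse (1 + (l \<bullet> b)\<^sup>2))" for l :: 'a
  proof -
    have "exp (- (c * norm l powr \<beta>)) * (1 + (norm l)\<^sup>2) powr d \<le> 1 + D"
    proof (cases "R \<le> norm l")
      case True
      have p: "0 < 1 + (norm l)\<^sup>2" by (simp add: add_pos_nonneg)
      have "exp (- (c * norm l powr \<beta>)) * (1 + (norm l)\<^sup>2) powr d = exp (d * ln (1 + (norm l)\<^sup>2) - c * norm l powr \<beta>)"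
        using p by (simp add: powr_def exp_diff exp_minus field_simps)
      also have "\<dots> \<le> 1" using R[OF True] by simp
      finally show ?thesis by (simp add: D_def add_increasing2)
    next
      case False
      then have "exp (- (c * norm l powr \<beta>)) * (1 + (norm l)\<^sup>2) powr d \<le> 1 * D"
        unfolding D_def using c d
        by (intro mult_mono powr_mono2 add_left_mono power_mono) auto
      then show ?thesis by simp
    qed
    moreover have pw: "(1 + (norm l)\<^sup>2) powr d = (1 + (norm l)\<^sup>2) ^ DIM('a)"
      unfolding d_def by (rule powr_realpow) (simp add: add_pos_nonneg)
    have "(\<Prod>b\<in>Basis. 1 + (l \<bullet> b)\<^sup>2) \<le> (\<Prod>b\<in>(Basis::'a set). 1 + (norm l)\<^sup>2)"
    proof (intro prod_mono conjI)
      fix b :: 'a assume "b \<in> Basis"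
      then have "\<bar>l \<bullet> b\<bar>\<^sup>2 \<le> (norm l)\<^sup>2" by (intro power_mono Basis_le_norm) auto
      then show "1 + (l \<bullet> b)\<^sup>2 \<le> 1 + (norm l)\<^sup>2" by simp
    qed simp
    then have prod_le: "exp (- (c * norm l powr \<beta>)) * (\<Prod>b\<in>Basis. 1 + (l \<bullet> b)\<^sup>2) \<le>
        exp (- (c * norm l powr \<beta>)) * (1 + (norm l)\<^sup>2) ^ DIM('a)"
      by (intro mult_left_mono) auto
    ultimately have "exp (- (c * norm l powr \<beta>)) * (\<Prod>b\<in>Basis. 1 + (l \<bullet> b)\<^sup>2) \<le> 1 + D"
      using order_trans[OF prod_le] by (simp only: pw)
    moreover have "0 < (\<Prod>b\<in>Basis. 1 + (l \<bullet> b)\<^sup>2)" by (intro prod_pos) (simp add: add_pos_nonneg)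
    ultimately have "exp (- (c * norm l powr \<beta>)) \<le> (1 + D) / (\<Prod>b\<in>Basis. 1 + (l \<bullet> b)\<^sup>2)"
      by (simp add: pos_le_divide_eq)
    then show ?thesis by (simp add: prod_inversef[symmetric] divide_inverse)
  qed
  have i1: "integrable lborel (\<lambda>x::real. inverse (1 + x\<^sup>2))"
    using Sinc_Integral.integrable_inverse_1_plus_square by (simp add: set_integrable_def)
  show ?thesis
    by (rule Bochner_Integration.integrable_bound[where f = "\<lambda>l::'a. (1 + D) * (\<Prod>b\<in>Basis. inverse (1 + (l \<bullet> b)\<^sup>2))"])
       (use bound i1 in \<open>auto intro!: lborel_integrable_prod_Basis order_trans[OF bound]\<close>)
qed

text \<open>The constant is (2 pi)^(-d) times the integral of the characteristic function, which is
  what inversion gives for the density at the origin. It serves wherever the value of the constant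
  does not enter the result.\<close>

lemma integral_le_of_integrable_cf:
  fixes \<mu> :: "'a::euclidean_space measure"
  assumes \<mu>: "prob_space \<mu>" "sets \<mu> = sets borel"
    and phi: "\<And>l. cf \<mu> l = complex_of_real (\<phi> l)" "\<And>l. 0 \<le> \<phi> l" "integrable lborel \<phi>"
  shows "\<exists>\<kappa>\<ge>0. \<forall>(g::'a \<Rightarrow> real) B. continuous_on UNIV g \<longrightarrow> (\<forall>x. 0 \<le> g x) \<longrightarrow> (\<forall>x. g x \<le> B) \<longrightarrow> integrable lborel g \<longrightarrow>
     (LINT x|\<mu>. g x) \<le> \<kappa> * (LBINT x. g x)"
proof -
  have [measurable]: "\<phi> \<in> borel_measurable borel"
    using borel_measurable_integrable[OF phi(3)] by simp
  define \<kappa> where "\<kappa> = (LBINT l. \<phi> l) / (2 * pi) ^ DIM('a)"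
  have kn: "0 \<le> \<kappa>" by (auto simp: \<kappa>_def phi intro!: divide_nonneg_pos integral_nonneg_AE)
  define \<sigma> where "\<sigma> k = 1 / real (Suc k)" for k
  have s: "\<sigma> \<longlonglongrightarrow> 0" "\<And>k. 0 < \<sigma> k"
    unfolding \<sigma>_def using LIMSEQ_inverse_real_of_nat by (auto simp: inverse_eq_divide)
  have "smooth_density \<mu> (\<sigma> k) 0 \<le> \<kappa>" for k
  proof -
    define c where "c = sqrt (2 * pi) ^ DIM('a)"
    have c: "0 < c" "c * c = (2 * pi) ^ DIM('a)"
      unfolding c_def by (simp, simp only: power_mult_distrib[symmetric]) simp
    have gb: "gauss l \<le> 1 / c" for l :: 'a by (simp add: gauss_eq c_def divide_right_mono)
    have i2: "integrable lborel (\<lambda>l. \<phi> (- (l /\<^sub>R \<sigma> k)))"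
      using phi(3) s(2)[of k] lborel_integrable_affine[of \<phi> "- inverse (\<sigma> k)" 0] by simp
    have e2: "(LBINT l. \<phi> (- (l /\<^sub>R \<sigma> k))) = \<sigma> k ^ DIM('a) * (LBINT l. \<phi> l)"
      using s(2)[of k] lborel_integral_affine[of \<phi> "- inverse (\<sigma> k)" 0]
      by (simp add: power_inverse field_simps)
    have "complex_of_real (smooth_density \<mu> (\<sigma> k) 0) = complex_of_real ((LBINT l. gauss l * \<phi> (- (l /\<^sub>R \<sigma> k))) / (c * \<sigma> k ^ DIM('a)))"
      unfolding smooth_density_fourier[OF \<mu>] phi(1) c_def power_mult_distrib
      by (simp add: scaleR_conv_of_real flip: of_real_mult)
    then have "smooth_density \<mu> (\<sigma> k) 0 = (LBINT l. gauss l * \<phi> (- (l /\<^sub>R \<sigma> k))) / (c * \<sigma> k ^ DIM('a))"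
      using of_real_eq_iff by blast
    also have "\<dots> \<le> (LBINT l. 1 / c * \<phi> (- (l /\<^sub>R \<sigma> k))) / (c * \<sigma> k ^ DIM('a))"
    proof (intro divide_right_mono integral_mono)
      show "integrable lborel (\<lambda>l. gauss l * \<phi> (- (l /\<^sub>R \<sigma> k)))"
        by (rule Bochner_Integration.integrable_bound[OF integrable_mult_right[OF i2, of "1 / c"]])
          (auto simp: abs_mult phi gauss_pos less_imp_le c intro!: AE_I2 order_trans[OF mult_right_mono[OF gb]])
      show "gauss l * \<phi> (- (l /\<^sub>R \<sigma> k)) \<le> 1 / c * \<phi> (- (l /\<^sub>R \<sigma> k))" for l
        by (intro mult_right_mono gb phi(2))
    qed (use i2 c s(2)[of k] in \<open>auto simp: less_imp_le\<close>)
    also have "\<dots> = \<kappa>"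
      using c s(2)[of k] by (simp only: integral_mult_right_zero e2) (simp add: \<kappa>_def field_simps)
    finally show ?thesis .
  qed
  then have "(LINT x|\<mu>. g x) \<le> \<kappa> * (LBINT x. g x)"
    if "continuous_on UNIV g" "\<And>x. 0 \<le> g x" "\<And>x. g x \<le> B" "integrable lborel g" for g B
    by (intro nn_integral_le_of_smooth_density_limit[OF \<mu> phi(1,2) that s _ tendsto_const]) auto
  with kn show ?thesis by (intro exI[of _ \<kappa>]) auto
qed

text \<open>With a continuous density the smoothed densities at the origin converge to p 0, so the
  bound holds with p 0 itself. The case \<beta> = d depends on this exact constant.\<close>

lemma integral_le_density_at_zero:
  fixes \<mu> :: "'a::euclidean_space measure"
  assumes \<mu>: "prob_space \<mu>" "sets \<mu> = sets borel"
    and phi: "\<And>l. cf \<mu> l = complex_of_real (\<phi> l)" "\<And>l. 0 \<le> \<phi> l"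
    and p: "continuous_on UNIV p" "\<And>x. 0 \<le> p x" "\<mu> = density lborel (\<lambda>x. ennreal (p x))"
    and g: "continuous_on UNIV g" "\<And>x. 0 \<le> g x" "\<And>x. g x \<le> B" "integrable lborel g"
  shows "(LINT x|\<mu>. g x) \<le> p 0 * (LBINT x. g x)"
proof -
  interpret \<mu>: prob_space \<mu> by fact
  have [measurable]: "p \<in> borel_measurable borel"
    using p(1) by (rule borel_measurable_continuous_onI)
  have ip: "integrable lborel p"
  proof (rule integrableI_nonneg)
    have "(\<integral>\<^sup>+x. ennreal (p x) \<partial>lborel) = 1"
      using \<mu>.emeasure_space_1 unfolding p(3) by (simp add: emeasure_density)
    then show "(\<integral>\<^sup>+x. ennreal (p x) \<partial>lborel) < \<infinity>" by simp
  qed (simp_all add: p)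
  define \<sigma> where "\<sigma> k = 1 / real (Suc k)" for k
  have s: "\<sigma> \<longlonglongrightarrow> 0" "\<And>k. 0 < \<sigma> k"
    unfolding \<sigma>_def using LIMSEQ_inverse_real_of_nat by (auto simp: inverse_eq_divide)
  obtain B' where B': "\<And>x::'a. norm x ^ (DIM('a) + 1) * gauss x \<le> B'"
    using gauss_decay by blast
  have "smooth_density \<mu> (\<sigma> k) 0 = (LBINT x. rescale gauss (\<sigma> k) x * p x)" for k
  proof -
    have "(LINT x|\<mu>. gauss ((0 - x) /\<^sub>R \<sigma> k)) = (LBINT x. p x *\<^sub>R gauss ((0 - x) /\<^sub>R \<sigma> k))"
      unfolding p(3) by (intro integral_density) (simp_all add: p(2))
    then show ?thesis
      by (simp add: smooth_density_def rescale_def gauss_minus mult.commute)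
  qed
  then have "(\<lambda>k. smooth_density \<mu> (\<sigma> k) 0) \<longlonglongrightarrow> p 0"
    using approximate_identity[OF integrable_gauss less_imp_le[OF gauss_pos] integral_gauss B' p(1,2) ip s]
    by (simp only:)
  then show ?thesis
    by (rule nn_integral_le_of_smooth_density_limit[OF \<mu> phi g s order_refl])
qed

section \<open>Path segments on dyadic times\<close>

text \<open>The coordinate \<open>(n, k)\<close> of a path is its value at time \<open>min (k / 2^n) 1\<close>.\<close>

abbreviation path_space :: "(nat \<times> nat \<Rightarrow> 'a::euclidean_space) measure" where
  "path_space \<equiv> PiM UNIV (\<lambda>_. borel)"

lemma mem_prod_emb_UNIV: "w \<in> prod_emb UNIV (\<lambda>_. borel) J (Pi\<^sub>E J A) \<longleftrightarrow> (\<forall>i\<in>J. w i \<in> A i)"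
  by (simp add: prod_emb_def PiE_iff)

context symmetric_stable_process
begin

text \<open>Clamping the time at 1 makes the coordinates total without leaving the segment. Division
  by \<open>L powr (1 / \<beta>)\<close> undoes self-similarity, so that the law does not depend on
  the segment.\<close>

definition path :: "real \<Rightarrow> real \<Rightarrow> 'w \<Rightarrow> nat \<times> nat \<Rightarrow> 'a" where
  "path a L \<omega> = (\<lambda>(n, k). (X (a + L * min (real k / 2 ^ n) 1) \<omega> - X a \<omega>) /\<^sub>R L powr (1 / \<beta>))"

definition grid_increment :: "real \<Rightarrow> real \<Rightarrow> nat \<Rightarrow> nat \<Rightarrow> 'w \<Rightarrow> 'a" where
  "grid_increment a L N j \<omega> = X (a + L * real (Suc j) / 2 ^ N) \<omega> - X (a + L * real j / 2 ^ N) \<omega>"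

lemma measurable_path [measurable]:
  assumes "0 \<le> a" "0 \<le> L"
  shows "path a L \<in> M \<rightarrow>\<^sub>M path_space"
proof -
  have [measurable]: "X (a + L * min (real k / 2 ^ n) 1) \<in> M \<rightarrow>\<^sub>M borel" for n k :: nat
    using assms by (intro random_variable_X) (auto intro!: add_nonneg_nonneg mult_nonneg_nonneg simp: min_def)
  have [measurable]: "X a \<in> M \<rightarrow>\<^sub>M borel" using assms by (intro random_variable_X)
  show ?thesis
    unfolding path_def[abs_def] by (rule measurable_PiM_single') (auto simp: split_beta' simp del: min_def)
qed

text \<open>Refinement to a common level turns any finite set of coordinates into partial sums of
  the same 2^N increments, to which independence and stationarity apply.\<close>

lemma path_eq_sum:
  assumes "n \<le> N"
  shows "path a L \<omega> (n, k) = (\<Sum>j<min (k * 2 ^ (N - n)) (2 ^ N). grid_increment a L N j \<omega> /\<^sub>R L powr (1 / \<beta>))"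
proof -
  define m where "m = min (k * 2 ^ (N - n)) (2 ^ N)"
  have N: "(2::real) ^ N = 2 ^ (N - n) * 2 ^ n" using assms by (simp flip: power_add)
  have "real m = min (real k * 2 ^ (N - n)) (2 ^ N)" by (simp add: m_def of_nat_min)
  also have "\<dots> / 2 ^ N = min (real k / 2 ^ n) 1"
    by (subst min_divide_distrib_right) (simp_all add: N)
  finally have m: "min (real k / 2 ^ n) 1 = real m / 2 ^ N" ..
  have "(\<Sum>j<m. grid_increment a L N j \<omega>) = X (a + L * (real m / 2 ^ N)) \<omega> - X a \<omega>"
    unfolding grid_increment_def using sum_lessThan_telescope[of "\<lambda>j. X (a + L * real j / 2 ^ N) \<omega>" m] by simp
  then show ?thesis
    unfolding path_def m_def[symmetric] by (simp add: m scaleR_sum_right[symmetric])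
qed

lemma cf_X: "0 \<le> t \<Longrightarrow> cf (distr M borel (X t)) l = complex_of_real (exp (- t * \<psi> l))"
  using characteristic_exponent[of t l] random_variable_X[of t] by (subst integral_distr) auto

text \<open>Self-similarity enters here: homogeneity of the exponent converts a scaling of space by
  \<open>c powr (1 / \<beta>)\<close> into a division of time by c, inside the characteristic
  function.\<close>

lemma distr_scaled_increment:
  assumes "0 \<le> s" "0 \<le> h" "0 < c"
  shows "distr M borel (\<lambda>\<omega>. (X (s + h) \<omega> - X s \<omega>) /\<^sub>R c powr (1 / \<beta>)) = distr M borel (X (h / c))"
proof (rule cf_unique)
  have [measurable]: "X (s + h) \<in> borel_measurable M" "X s \<in> borel_measurable M" "X h \<in> borel_measurable M" "X (h / c) \<in> borel_measurable M"
    using assms by (auto intro!: random_variable_X)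
  show "prob_space (distr M borel (\<lambda>\<omega>. (X (s + h) \<omega> - X s \<omega>) /\<^sub>R c powr (1 / \<beta>)))" "prob_space (distr M borel (X (h / c)))"
    by (auto intro!: prob_space_distr)
  fix l
  have c: "inverse (c powr (1 / \<beta>)) powr \<beta> = inverse c"
    using assms order_pos by (simp add: powr_powr flip: powr_minus) (simp add: inverse_eq_divide)
  have "cf (distr M borel (\<lambda>\<omega>. (X (s + h) \<omega> - X s \<omega>) /\<^sub>R c powr (1 / \<beta>))) l
      = cf (distr M borel (\<lambda>\<omega>. X (s + h) \<omega> - X s \<omega>)) (l /\<^sub>R c powr (1 / \<beta>))"
    by (simp add: integral_distr)
  also have "\<dots> = complex_of_real (exp (- h * \<psi> (l /\<^sub>R c powr (1 / \<beta>))))"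
    unfolding stationary_increments[OF assms(1,2)] by (rule cf_X[OF assms(2)])
  also have "\<psi> (l /\<^sub>R c powr (1 / \<beta>)) = inverse c * \<psi> l"
    by (subst exponent_homogeneous) (auto simp: c)
  also have "complex_of_real (exp (- h * (inverse c * \<psi> l))) = cf (distr M borel (X (h / c))) l"
    using assms by (subst cf_X) (auto simp: field_simps)
  finally show "cf (distr M borel (\<lambda>\<omega>. (X (s + h) \<omega> - X s \<omega>) /\<^sub>R c powr (1 / \<beta>))) l = cf (distr M borel (X (h / c))) l" .
qed simp_all

lemma indep_grid_increments:
  assumes "0 \<le> a" "0 \<le> L"
  shows "indep_vars (\<lambda>_. borel) (grid_increment a L N) {..<m}"
  unfolding grid_increment_def
  by (rule independent_increments) (use assms in \<open>auto intro!: divide_right_mono mult_left_mono\<close>)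

text \<open>Cylinders determine a law on the countable product. A cylinder involves finitely many
  coordinates, hence one dyadic level, where it is an event about independent increments distributed
  as X at time 2^(-N).\<close>

lemma distr_path:
  assumes "0 \<le> a" "0 < L"
  shows "distr M path_space (path a L) = distr M path_space (path 0 1)"
proof (rule measure_eqI_PiM_infinite)
  have [measurable]: "path a L \<in> M \<rightarrow>\<^sub>M path_space" "path 0 1 \<in> M \<rightarrow>\<^sub>M path_space"
    using assms by (auto intro!: measurable_path)
  show "finite_measure (distr M path_space (path a L))"
    by (intro prob_space.finite_measure prob_space_distr) simp
  fix A and J :: "(nat \<times> nat) set" assume J: "finite J" and A: "\<And>i. i \<in> J \<Longrightarrow> A i \<in> sets (borel :: 'a measure)"
  define N where "N = Max (insert 0 (fst ` J))"
  have N: "n \<le> N" if "(n, k) \<in> J" for n k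
    unfolding N_def using J that by (intro Max_ge) force+
  define S where "S = prod_emb UNIV (\<lambda>_. borel :: 'a measure) J (Pi\<^sub>E J A)"
  have S: "S \<in> sets path_space"
    unfolding S_def using J A by (intro sets_PiM_I) auto
  define B where "B = {d \<in> space (PiM {..<2^N} (\<lambda>_. borel :: 'a measure)).
     \<forall>i\<in>J. (\<Sum>j<min (snd i * 2 ^ (N - fst i)) (2 ^ N). d j) \<in> A i}"
  have B: "B \<in> sets (PiM {..<2^N} (\<lambda>_. borel))"
    unfolding B_def
  proof (rule sets.sets_Collect_finite_All[OF _ J])
    fix i assume i: "i \<in> J"
    have [measurable]: "A i \<in> sets borel" by (rule A[OF i])
    have [measurable]: "(\<lambda>d. \<Sum>j<min (snd i * 2 ^ (N - fst i)) (2 ^ N). d j) \<in> PiM {..<2^N} (\<lambda>_. borel :: 'a measure) \<rightarrow>\<^sub>M borel"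
      by (intro borel_measurable_sum measurable_component_singleton) auto
    show "{d \<in> space (PiM {..<2^N} (\<lambda>_. borel :: 'a measure)). (\<Sum>j<min (snd i * 2 ^ (N - fst i)) (2 ^ N). d j) \<in> A i} \<in> sets (PiM {..<2^N} (\<lambda>_. borel))"
      by measurable
  qed
  \<comment> \<open>The right-hand side contains neither b nor K; applied to the two segments it
    shows that their laws agree.\<close>
  have key: "emeasure (distr M path_space (path b K)) S = emeasure (PiM {..<2^N} (\<lambda>_. distr M borel (X (1 / 2 ^ N)))) B"
    if b: "0 \<le> b" "0 < K" for b K
  proof -
    let ?D = "\<lambda>j \<omega>. grid_increment b K N j \<omega> /\<^sub>R K powr (1 / \<beta>)"
    have [measurable]: "path b K \<in> M \<rightarrow>\<^sub>M path_space"
      using b by (auto intro!: measurable_path)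
    have ind: "indep_vars (\<lambda>_. borel) ?D {..<2^N}"
      using b by (intro indep_vars_compose2[OF indep_grid_increments]) auto
    have Dm: "?D j \<in> borel_measurable M" for j
      unfolding grid_increment_def using b
      by (intro borel_measurable_scaleR borel_measurable_diff random_variable_X) auto
    have d: "distr M borel (?D j) = distr M borel (X (1 / 2 ^ N))" for j
    proof -
      have "b + K * real (Suc j) / 2 ^ N = (b + K * real j / 2 ^ N) + K / 2 ^ N" by (simp add: field_simps)
      then show ?thesis
        unfolding grid_increment_def using b distr_scaled_increment[of "b + K * real j / 2 ^ N" "K / 2 ^ N" K]
        by (simp only:) simp
    qed
    have e1: "emeasure (distr M path_space (path b K)) S = emeasure M (path b K -` S \<inter> space M)"
      using S by (simp add: emeasure_distr)
    have e2: "path b K -` S \<inter> space M = (\<lambda>\<omega>. \<lambda>j\<in>{..<2^N}. ?D j \<omega>) -` B \<inter> space M"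
    proof -
      have "path b K \<omega> \<in> S \<longleftrightarrow> (\<lambda>j\<in>{..<2^N}. ?D j \<omega>) \<in> B" for \<omega>
      proof -
        have "path b K \<omega> i = (\<Sum>j<min (snd i * 2 ^ (N - fst i)) (2 ^ N). (\<lambda>j\<in>{..<2^N}. ?D j \<omega>) j)" if "i \<in> J" for i
        proof -
          have "path b K \<omega> (fst i, snd i) = (\<Sum>j<min (snd i * 2 ^ (N - fst i)) (2 ^ N). ?D j \<omega>)"
            by (rule path_eq_sum[OF N[of _ "snd i"]]) (use that in simp)
          also have "\<dots> = (\<Sum>j<min (snd i * 2 ^ (N - fst i)) (2 ^ N). (\<lambda>j\<in>{..<2^N}. ?D j \<omega>) j)"
            by (intro sum.cong refl) simp
          finally show ?thesis by simp
        qed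
        then have "(\<forall>i\<in>J. path b K \<omega> i \<in> A i) \<longleftrightarrow>
            (\<forall>i\<in>J. (\<Sum>j<min (snd i * 2 ^ (N - fst i)) (2 ^ N). (\<lambda>j\<in>{..<2^N}. ?D j \<omega>) j) \<in> A i)"
          by (intro ball_cong refl) (simp only:)
        then show ?thesis
          unfolding S_def B_def mem_prod_emb_UNIV mem_Collect_eq space_PiM space_borel by (simp only: restrict_PiE_iff) simp
      qed
      then show ?thesis by (simp only: vimage_def)
    qed
    have mD: "(\<lambda>\<omega>. \<lambda>j\<in>{..<2^N}. ?D j \<omega>) \<in> M \<rightarrow>\<^sub>M PiM {..<2^N} (\<lambda>_. borel)"
      by (rule measurable_restrict) (rule Dm)
    have e3: "emeasure (distr M (PiM {..<2^N} (\<lambda>_. borel)) (\<lambda>\<omega>. \<lambda>j\<in>{..<2^N}. ?D j \<omega>)) B =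
        emeasure M ((\<lambda>\<omega>. \<lambda>j\<in>{..<2^N}. ?D j \<omega>) -` B \<inter> space M)"
      by (rule emeasure_distr[OF mD B])
    have "distr M (PiM {..<2^N} (\<lambda>_. borel)) (\<lambda>\<omega>. \<lambda>j\<in>{..<2^N}. ?D j \<omega>) = PiM {..<2^N} (\<lambda>j. distr M borel (?D j))"
      by (rule indep_vars_iff_distr_eq_PiM[THEN iffD1, OF _ Dm ind]) (simp add: lessThan_empty_iff)
    then show ?thesis unfolding e1 e2 e3[symmetric] d by (rule arg_cong)
  qed
  show "emeasure (distr M path_space (path a L)) (prod_emb UNIV (\<lambda>_. borel) J (Pi\<^sub>E J A)) =
     emeasure (distr M path_space (path 0 1)) (prod_emb UNIV (\<lambda>_. borel) J (Pi\<^sub>E J A))"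
    using key[OF assms] key[of 0 1] by (simp add: S_def)
qed simp_all

text \<open>It suffices to check the product formula on generating cylinders. Together these use
  finitely many dyadic levels, so each segment is cut into 2^N pieces and the events depend on
  disjoint blocks of one finite family of increments.\<close>

lemma indep_paths:
  fixes T :: "nat \<Rightarrow> real"
  assumes T: "0 \<le> T 0" "\<And>i. T i \<le> T (Suc i)"
  shows "indep_vars (\<lambda>_. path_space) (\<lambda>i. path (T i) (T (Suc i) - T i)) {..<m}"
proof (cases "m = 0")
  case False
  have T0: "0 \<le> T i" for i by (induction i) (use T order_trans in auto)
  have [measurable]: "path (T i) (T (Suc i) - T i) \<in> M \<rightarrow>\<^sub>M path_space" for i
    using T T0 by (auto intro!: measurable_path)
  let ?P = "\<lambda>i. path (T i) (T (Suc i) - T i)"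
  have "\<forall>S\<in>(\<Pi> i\<in>{..<m}. prod_algebra UNIV (\<lambda>_. borel :: 'a measure)).
      prob (\<Inter>i\<in>{..<m}. ?P i -` S i \<inter> space M) = (\<Prod>i\<in>{..<m}. prob (?P i -` S i \<inter> space M))"
  proof
    fix S :: "nat \<Rightarrow> (nat \<times> nat \<Rightarrow> 'a) set" assume "S \<in> (\<Pi> i\<in>{..<m}. prod_algebra UNIV (\<lambda>_. borel :: 'a measure))"
    then have "\<forall>i\<in>{..<m}. \<exists>J E. S i = prod_emb UNIV (\<lambda>_. borel :: 'a measure) J (\<Pi>\<^sub>E j\<in>J. E j) \<and> finite J \<and> (\<forall>j\<in>J. E j \<in> sets borel)"
    proof (intro ballI)
      fix i assume "i \<in> {..<m}" "S \<in> (\<Pi> i\<in>{..<m}. prod_algebra UNIV (\<lambda>_. borel :: 'a measure))"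
      then have "S i \<in> prod_algebra UNIV (\<lambda>_. borel :: 'a measure)" by auto
      then show "\<exists>J E. S i = prod_emb UNIV (\<lambda>_. borel :: 'a measure) J (\<Pi>\<^sub>E j\<in>J. E j) \<and> finite J \<and> (\<forall>j\<in>J. E j \<in> sets borel)"
        by (rule prod_algebraE) blast
    qed
    then obtain J E where S: "\<And>i. i < m \<Longrightarrow> S i = prod_emb UNIV (\<lambda>_. borel :: 'a measure) (J i) (\<Pi>\<^sub>E j\<in>J i. E i j)"
      and J: "\<And>i. i < m \<Longrightarrow> finite (J i)" and E: "\<And>i j. i < m \<Longrightarrow> j \<in> J i \<Longrightarrow> E i j \<in> sets borel"
      unfolding bchoice_iff by (auto simp: lessThan_iff Ball_def)
    define N where "N = Max (insert 0 (fst ` (\<Union>i<m. J i)))"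
    have N: "n \<le> N" if "(n, k) \<in> J i" "i < m" for n k i
      unfolding N_def using J that by (intro Max_ge) (auto simp: image_iff intro!: bexI)
    \<comment> \<open>\<tau> enumerates the grid points of all segments: \<open>j div 2^N\<close> is
      the segment, \<open>j mod 2^N\<close> the position in it. The endpoint of a segment is coded
      as the start of the next one.\<close>
    define \<tau> where "\<tau> j = T (j div 2^N) + (T (Suc (j div 2^N)) - T (j div 2^N)) * real (j mod 2^N) / 2^N" for j
    have \<tau>: "\<tau> (i * 2^N + k) = T i + (T (Suc i) - T i) * real k / 2^N" if "k < 2^N" for i k
      using that by (simp add: \<tau>_def div_mult_self3 mult.commute)
    have \<tau>2: "\<tau> (i * 2^N + k) = T i + (T (Suc i) - T i) * real k / 2^N" if "k \<le> 2^N" for i k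
    proof (cases "k = 2^N")
      case True
      then have "i * 2^N + k = Suc i * 2^N + 0" by simp
      then have "\<tau> (i * 2^N + k) = \<tau> (Suc i * 2^N + 0)" by (rule arg_cong)
      also have "\<dots> = T (Suc i)" by (subst \<tau>) simp_all
      finally show ?thesis using True by simp
    qed (use that \<tau> in auto)
    define D where "D j \<omega> = X (\<tau> (Suc j)) \<omega> - X (\<tau> j) \<omega>" for j \<omega>
    have Dg: "D (i * 2^N + k) = grid_increment (T i) (T (Suc i) - T i) N k" if "k < 2^N" for i k
      using \<tau>2[of k i] \<tau>2[of "Suc k" i] that by (auto simp: D_def grid_increment_def fun_eq_iff)
    have mono: "\<tau> j \<le> \<tau> (Suc j)" for j
    proof -
      have j: "(j div 2^N) * 2^N + j mod 2^N = j" "j mod 2^N < 2^N" by (rule div_mult_mod_eq) simp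
      have "\<tau> (j div 2^N * 2^N + j mod 2^N) \<le> \<tau> (j div 2^N * 2^N + Suc (j mod 2^N))"
        using j(2) T(2)[of "j div 2^N"]
        unfolding \<tau>2[OF less_imp_le[OF j(2)]] \<tau>2[OF Suc_leI[OF j(2)]]
        by (auto intro!: divide_right_mono mult_left_mono)
      then show ?thesis unfolding add_Suc_right j(1) .
    qed
    have ind: "indep_vars (\<lambda>_. borel) D {..<m * 2^N}"
      unfolding D_def using T(1) mono by (intro independent_increments) (auto simp: \<tau>_def)
    define K where "K i = {i * 2^N..<Suc i * 2^N}" for i :: nat
    have indK: "indep_vars (\<lambda>i. PiM (K i) (\<lambda>_. borel)) (\<lambda>i \<omega>. restrict (\<lambda>j. D j \<omega>) (K i)) {..<m}"
    proof (rule indep_vars_restrict[OF ind])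
      fix i assume "i \<in> {..<m}"
      then have "Suc i * 2^N \<le> m * 2^N" by (intro mult_right_mono) auto
      then show "K i \<subseteq> {..<m * 2^N}" by (auto simp: K_def)
    next
      have "j div 2^N = i" if "j \<in> K i" for i j
        using that by (intro div_nat_eqI) (auto simp: K_def mult.commute)
      then show "disjoint_family_on K {..<m}" unfolding disjoint_family_on_def by blast
    qed
    let ?c = "\<lambda>i. (T (Suc i) - T i) powr (1 / \<beta>)"
    define B where "B i = {d \<in> space (PiM (K i) (\<lambda>_. borel :: 'a measure)).
        \<forall>q\<in>J i. (\<Sum>k<min (snd q * 2 ^ (N - fst q)) (2 ^ N). d (i * 2^N + k) /\<^sub>R ?c i) \<in> E i q}" for i
    have B: "B i \<in> sets (PiM (K i) (\<lambda>_. borel))" if i: "i < m" for i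
      unfolding B_def
    proof (rule sets.sets_Collect_finite_All[OF _ J[OF i]])
      fix q assume q: "q \<in> J i"
      have "(\<lambda>d. \<Sum>k<min (snd q * 2 ^ (N - fst q)) (2 ^ N). d (i * 2^N + k) /\<^sub>R ?c i) \<in> PiM (K i) (\<lambda>_. borel :: 'a measure) \<rightarrow>\<^sub>M borel"
        by (intro borel_measurable_sum borel_measurable_scaleR measurable_component_singleton) (auto simp: K_def)
      from measurable_sets[OF this E[OF i q]]
      show "{d \<in> space (PiM (K i) (\<lambda>_. borel :: 'a measure)). (\<Sum>k<min (snd q * 2 ^ (N - fst q)) (2 ^ N). d (i * 2^N + k) /\<^sub>R ?c i) \<in> E i q} \<in> sets (PiM (K i) (\<lambda>_. borel))"
        by (simp only: vimage_def Int_def mem_Collect_eq conj_commute)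
    qed
    have vim: "?P i -` S i \<inter> space M = (\<lambda>\<omega>. restrict (\<lambda>j. D j \<omega>) (K i)) -` B i \<inter> space M" if i: "i < m" for i
    proof -
      have "?P i \<omega> \<in> S i \<longleftrightarrow> restrict (\<lambda>j. D j \<omega>) (K i) \<in> B i" for \<omega>
      proof -
        have "?P i \<omega> q = (\<Sum>k<min (snd q * 2 ^ (N - fst q)) (2 ^ N). restrict (\<lambda>j. D j \<omega>) (K i) (i * 2^N + k) /\<^sub>R ?c i)"
          if q: "q \<in> J i" for q
        proof -
          have "restrict (\<lambda>j. D j \<omega>) (K i) (i * 2^N + k) = grid_increment (T i) (T (Suc i) - T i) N k \<omega>" if "k < 2^N" for k
            using that by (simp add: K_def Dg[OF that, symmetric])
          then show ?thesis
            using path_eq_sum[OF N[of "fst q" "snd q" i], of "T i" "T (Suc i) - T i" \<omega> "snd q"] q i by simp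
        qed
        then have "(\<forall>q\<in>J i. ?P i \<omega> q \<in> E i q) \<longleftrightarrow>
            (\<forall>q\<in>J i. (\<Sum>k<min (snd q * 2 ^ (N - fst q)) (2 ^ N). restrict (\<lambda>j. D j \<omega>) (K i) (i * 2^N + k) /\<^sub>R ?c i) \<in> E i q)"
          by (intro ball_cong refl) (simp only:)
        then show ?thesis
          unfolding S[OF i] B_def mem_prod_emb_UNIV mem_Collect_eq space_PiM space_borel by (simp only: restrict_PiE_iff) simp
      qed
      then show ?thesis by auto
    qed
    have "prob (\<Inter>i\<in>{..<m}. (\<lambda>\<omega>. restrict (\<lambda>j. D j \<omega>) (K i)) -` B i \<inter> space M) =
      (\<Prod>i\<in>{..<m}. prob ((\<lambda>\<omega>. restrict (\<lambda>j. D j \<omega>) (K i)) -` B i \<inter> space M))"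
      using False B by (intro indep_varsD[OF indK]) auto
    then show "prob (\<Inter>i\<in>{..<m}. ?P i -` S i \<inter> space M) = (\<Prod>i\<in>{..<m}. prob (?P i -` S i \<inter> space M))"
      by (simp add: vim)
  qed
  moreover have "{..<m} \<noteq> {}" using False by (simp add: lessThan_empty_iff)
  ultimately show ?thesis
    by (subst indep_vars_finite[where E = "\<lambda>_. prod_algebra UNIV (\<lambda>_. borel :: 'a measure)"])
       (simp_all add: sets_PiM space_PiM Int_stable_prod_algebra space_in_prod_algebra[of UNIV "\<lambda>_. borel :: 'a measure", simplified]
         prod_algebra_sets_into_space[of UNIV "\<lambda>_. borel :: 'a measure", simplified])
qed (simp add: indep_vars_def indep_sets_def)

end

section \<open>The occupation functional\<close>

text \<open>The dyadic points \<open>\<lceil>s * 2 ^ n\<rceil> / 2 ^ n\<close> approach s from the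
  right, so on a right-continuous path the limit is the value at s. Since \<open>lim\<close> is
  total, evaluation is jointly measurable on the whole path space.\<close>

definition path_eval :: "(nat \<times> nat \<Rightarrow> 'a::euclidean_space) \<Rightarrow> real \<Rightarrow> 'a" where
  "path_eval w s = lim (\<lambda>n. w (n, nat \<lceil>s * 2 ^ n\<rceil>))"

lemma measurable_path_eval: "(\<lambda>z. path_eval (fst z) (snd z)) \<in> path_space \<Otimes>\<^sub>M borel \<rightarrow>\<^sub>M borel"
proof -
  have "(\<lambda>z. (fst z) (n, nat \<lceil>snd z * 2 ^ n :: real\<rceil>)) \<in> (path_space :: (nat \<times> nat \<Rightarrow> 'a) measure) \<Otimes>\<^sub>M borel \<rightarrow>\<^sub>M borel" for n
  proof -
    have 1: "(\<lambda>z. (fst z) (n, k)) \<in> (path_space :: (nat \<times> nat \<Rightarrow> 'a) measure) \<Otimes>\<^sub>M borel \<rightarrow>\<^sub>M borel" for k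
      by (rule measurable_compose[OF measurable_fst measurable_component_singleton]) simp
    have 2: "(\<lambda>z. nat \<lceil>snd z * 2 ^ n :: real\<rceil>) \<in> (path_space :: (nat \<times> nat \<Rightarrow> 'a) measure) \<Otimes>\<^sub>M borel \<rightarrow>\<^sub>M count_space UNIV"
      by measurable
    show ?thesis by (rule measurable_compose_countable[OF 1 2])
  qed
  then show ?thesis
    unfolding path_eval_def by (intro borel_measurable_lim_metric)
qed

lemma measurable_path_eval' [measurable (raw)]:
  assumes "f \<in> N \<rightarrow>\<^sub>M path_space" "g \<in> N \<rightarrow>\<^sub>M borel"
  shows "(\<lambda>x. path_eval (f x) (g x)) \<in> N \<rightarrow>\<^sub>M borel"
  using measurable_compose[OF measurable_Pair[OF assms] measurable_path_eval] by simp

lemma cadlag_tendsto_from_right: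
  assumes "cadlag g" "0 \<le> t" "u \<longlonglongrightarrow> t" "\<And>n. t \<le> u n"
  shows "(\<lambda>n. g (u n)) \<longlonglongrightarrow> g t"
proof -
  have "{t..} - {t} = {t<..}" by auto
  then have "at t within {t..} = at_right t" by (simp add: at_within_def)
  then have "continuous (at t within {t..}) g"
    using assms(1,2) by (simp add: cadlag_def continuous_within)
  then show ?thesis
    using assms(3,4) by (auto simp: continuous_within_sequentially o_def)
qed

text \<open>Time pairs have the later time first. Half-open edges let triangles and rectangles split
  into exactly disjoint pieces, so occupation integrals add up pathwise.\<close>

definition tri :: "real \<Rightarrow> real \<Rightarrow> (real \<times> real) set" where
  "tri a b = {z. a \<le> snd z \<and> snd z \<le> fst z \<and> fst z < b}"

definition rect :: "real \<Rightarrow> real \<Rightarrow> (real \<times> real) set" where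
  "rect b c = {z. b \<le> fst z \<and> fst z < c \<and> 0 \<le> snd z \<and> snd z < b}"

lemma sets_tri [measurable]: "tri a b \<in> sets borel"
proof -
  have "{z \<in> space (borel \<Otimes>\<^sub>M borel :: (real \<times> real) measure). a \<le> snd z \<and> snd z \<le> fst z \<and> fst z < b} \<in> sets (borel \<Otimes>\<^sub>M borel)"
    by measurable
  then show ?thesis unfolding borel_prod by (simp add: tri_def)
qed

lemma sets_rect [measurable]: "rect b c \<in> sets borel"
proof -
  have "{z \<in> space (borel \<Otimes>\<^sub>M borel :: (real \<times> real) measure). b \<le> fst z \<and> fst z < c \<and> 0 \<le> snd z \<and> snd z < b} \<in> sets (borel \<Otimes>\<^sub>M borel)"
    by measurable
  then show ?thesis unfolding borel_prod by (simp add: rect_def)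
qed

lemma measurable_real_pair_fst: "g \<in> N \<rightarrow>\<^sub>M borel \<Longrightarrow> (\<lambda>x. fst (g x :: real \<times> real)) \<in> N \<rightarrow>\<^sub>M borel"
  and measurable_real_pair_snd: "g \<in> N \<rightarrow>\<^sub>M borel \<Longrightarrow> (\<lambda>x. snd (g x :: real \<times> real)) \<in> N \<rightarrow>\<^sub>M borel"
  unfolding borel_prod[symmetric]
  by (rule measurable_compose[OF _ measurable_fst], assumption) (rule measurable_compose[OF _ measurable_snd], assumption)

lemma rescale_mult: "0 < c \<Longrightarrow> rescale f \<epsilon> (c *\<^sub>R x) = rescale f (\<epsilon> / c) (x::'a::euclidean_space) / c ^ DIM('a)"
  by (simp add: rescale_def power_divide field_simps)

context
  fixes f :: "'a::euclidean_space \<Rightarrow> real"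
  assumes f: "mollifier_kernel f"
begin

lemma kernel_pos: "0 < f x"
  using f by (simp add: mollifier_kernel_def)

lemma kernel_integral: "(LBINT x. f x) = 1"
  using f by (simp add: mollifier_kernel_def)

text \<open>A non-integrable function has Bochner integral 0, so the value 1 forces
  integrability.\<close>

lemma kernel_integrable: "integrable lborel f"
  using kernel_integral not_integrable_integral_eq[of lborel f] by auto

lemma kernel_continuous: "continuous_on UNIV f"
proof -
  have "f differentiable (at x)" for x
    using f unfolding mollifier_kernel_def schwartz_def by (auto dest: spec[of _ "[]"])
  then show ?thesis
    by (simp add: continuous_on_eq_continuous_at differentiable_imp_continuous_within)
qed

lemma kernel_measurable: "f \<in> borel_measurable borel"
  by (intro borel_measurable_continuous_onI kernel_continuous)

lemma kernel_decay: "\<exists>B. \<forall>x. norm x ^ n * f x \<le> B"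
proof -
  have "bounded (range (\<lambda>x. norm x ^ n * f x))"
    using f unfolding mollifier_kernel_def schwartz_def by (auto dest: spec[of _ "[]"])
  then obtain B where "\<And>x. norm (norm x ^ n * f x) \<le> B" by (auto simp: bounded_iff)
  then show ?thesis by (metis abs_le_D1 real_norm_def)
qed

lemma rescale_kernel_nonneg: "0 < \<epsilon> \<Longrightarrow> 0 \<le> rescale f \<epsilon> x"
  by (simp add: rescale_def less_imp_le[OF kernel_pos])

lemma rescale_kernel_bounded: "\<exists>B. \<forall>\<epsilon>>0. \<forall>x. rescale f \<epsilon> x \<le> B / \<epsilon> ^ DIM('a)"
proof -
  obtain B where B: "\<And>x. f x \<le> B" using kernel_decay[of 0] by auto
  show ?thesis by (intro exI[of _ B]) (simp add: rescale_def divide_right_mono B)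
qed

end

section \<open>The standing setting; occupation integrals at positive kernel width\<close>

locale silt = symmetric_stable_process M X \<beta> \<psi>
  for M :: "'w measure" and X :: "real \<Rightarrow> 'w \<Rightarrow> 'a::euclidean_space" and \<beta> \<psi> +
  fixes f :: "'a \<Rightarrow> real" and \<gamma> :: "real \<Rightarrow> 'w \<Rightarrow> real"
  assumes order_range: "2 * real DIM('a) / 3 < \<beta>" "\<beta> \<le> real DIM('a)"
    and kernel: "mollifier_kernel f"
    and renormalized: "renormalized_silt M X f \<gamma>"
begin

text \<open>The exponent in p_u(0) = u^(-\<alpha>) p_1(0); occupation over a segment of length L
  therefore scales as L^(2 - \<alpha>).\<close>

definition \<alpha> :: real where "\<alpha> = real DIM('a) / \<beta>"

lemma \<alpha>_bounds: "1 \<le> \<alpha>" "\<alpha> < 3 / 2"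
  using order_range order_pos by (auto simp: \<alpha>_def field_simps)

lemmas [measurable] = kernel_measurable[OF kernel]

lemma powr_DIM: "0 < c \<Longrightarrow> (c powr (1 / \<beta>)) ^ DIM('a) = c powr \<alpha>"
  by (simp add: \<alpha>_def powr_powr flip: powr_realpow)

lemma path_tendsto:
  assumes "\<omega> \<in> space M" "0 \<le> a" "0 \<le> L" "0 \<le> s" "s \<le> 1"
  shows "(\<lambda>n. path a L \<omega> (n, nat \<lceil>s * 2 ^ n\<rceil>)) \<longlonglongrightarrow> (X (a + L * s) \<omega> - X a \<omega>) /\<^sub>R L powr (1 / \<beta>)"
proof -
  define u where "u n = real (nat \<lceil>s * 2 ^ n\<rceil>) / 2 ^ n" for n :: nat
  have u: "s \<le> u n" "u n \<le> s + 1 / 2 ^ n" "u n \<le> 1" for n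
  proof -
    have "real_of_int \<lceil>s * 2 ^ n\<rceil> \<le> s * 2 ^ n + 1" "s * 2 ^ n \<le> real_of_int \<lceil>s * 2 ^ n\<rceil>" by linarith+
    then show "s \<le> u n" "u n \<le> s + 1 / 2 ^ n" using assms(4) by (simp_all add: u_def field_simps)
    have "s * 2 ^ n \<le> 2 ^ n" using assms(5) by simp
    then have "\<lceil>s * 2 ^ n\<rceil> \<le> 2 ^ n" by (simp add: ceiling_le_iff)
    then have "nat \<lceil>s * 2 ^ n\<rceil> \<le> 2 ^ n" by (simp add: nat_le_iff)
    then have "real (nat \<lceil>s * 2 ^ n\<rceil>) \<le> 2 ^ n" by (metis of_nat_le_iff of_nat_numeral of_nat_power)
    then show "u n \<le> 1" by (simp add: u_def)
  qed
  have "(\<lambda>n. s + 1 / 2 ^ n) \<longlonglongrightarrow> s" by real_asymp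
  then have lim: "u \<longlonglongrightarrow> s"
    by (rule real_tendsto_sandwich[OF _ _ tendsto_const, rotated 2]) (auto simp: u)
  have "(\<lambda>n. X (a + L * u n) \<omega>) \<longlonglongrightarrow> X (a + L * s) \<omega>"
    by (rule cadlag_tendsto_from_right[OF cadlag_paths[OF assms(1)]])
       (use assms u lim in \<open>auto intro!: tendsto_intros mult_left_mono\<close>)
  then have "(\<lambda>n. (X (a + L * u n) \<omega> - X a \<omega>) /\<^sub>R L powr (1 / \<beta>)) \<longlonglongrightarrow> (X (a + L * s) \<omega> - X a \<omega>) /\<^sub>R L powr (1 / \<beta>)"
    by (intro tendsto_intros)
  moreover have "path a L \<omega> (n, nat \<lceil>s * 2 ^ n\<rceil>) = (X (a + L * u n) \<omega> - X a \<omega>) /\<^sub>R L powr (1 / \<beta>)" for n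
    using u(3)[of n] by (simp add: path_def u_def[symmetric])
  ultimately show ?thesis by simp
qed

lemma path_eval_path:
  assumes "\<omega> \<in> space M" "0 \<le> a" "0 \<le> L" "0 \<le> s" "s \<le> 1"
  shows "path_eval (path a L \<omega>) s = (X (a + L * s) \<omega> - X a \<omega>) /\<^sub>R L powr (1 / \<beta>)"
  unfolding path_eval_def by (rule limI[OF path_tendsto[OF assms]])

definition occ :: "(real \<times> real) set \<Rightarrow> real \<Rightarrow> 'w \<Rightarrow> real" where
  "occ R \<epsilon> \<omega> = (LBINT z. indicator R z * rescale f \<epsilon> (X (fst z) \<omega> - X (snd z) \<omega>))"

definition path_occ :: "real \<Rightarrow> (nat \<times> nat \<Rightarrow> 'a) \<Rightarrow> real" where
  "path_occ \<epsilon> w = (LBINT z. indicator (tri 0 1) z * rescale f \<epsilon> (path_eval w (fst z) - path_eval w (snd z)))"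

lemma measurable_path_occ [measurable]: "path_occ \<epsilon> \<in> path_space \<rightarrow>\<^sub>M borel"
proof -
  have [measurable]: "rescale f \<epsilon> \<in> borel_measurable borel" by measurable
  have z: "snd \<in> path_space \<Otimes>\<^sub>M lborel \<rightarrow>\<^sub>M (borel :: (real \<times> real) measure)"
    using measurable_snd[of path_space "lborel :: (real \<times> real) measure"] by simp
  have [measurable]: "(\<lambda>x. path_eval (fst x) (fst (snd x))) \<in> path_space \<Otimes>\<^sub>M (lborel :: (real \<times> real) measure) \<rightarrow>\<^sub>M borel"
    "(\<lambda>x. path_eval (fst x) (snd (snd x))) \<in> path_space \<Otimes>\<^sub>M (lborel :: (real \<times> real) measure) \<rightarrow>\<^sub>M borel"
    by (intro measurable_path_eval' measurable_fst measurable_real_pair_fst[OF z] measurable_real_pair_snd[OF z])+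
  have "(\<lambda>(w, z). indicator (tri 0 1) z * rescale f \<epsilon> (path_eval w (fst z) - path_eval w (snd z))) \<in>
      borel_measurable (path_space \<Otimes>\<^sub>M lborel)"
    unfolding split_beta' by measurable
  then show ?thesis
    unfolding path_occ_def[abs_def] by (intro lborel.borel_measurable_lebesgue_integral)
qed

definition bounded_region :: "(real \<times> real) set \<Rightarrow> bool" where
  "bounded_region R \<longleftrightarrow> R \<in> sets borel \<and> (\<exists>T>0. R \<subseteq> {0..T} \<times> {0..T})"

lemma bounded_region_tri: "0 \<le> a \<Longrightarrow> bounded_region (tri a b)"
  unfolding bounded_region_def by (intro conjI sets_tri exI[of _ "\<bar>b\<bar> + 1"]) (auto simp: tri_def)

lemma bounded_region_rect: "0 \<le> b \<Longrightarrow> bounded_region (rect b c)"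
  unfolding bounded_region_def by (intro conjI sets_rect exI[of _ "\<bar>c\<bar> + 1"]) (auto simp: rect_def)

lemma bounded_region_Un: "bounded_region R \<Longrightarrow> bounded_region R' \<Longrightarrow> bounded_region (R \<union> R')"
proof -
  assume "bounded_region R" "bounded_region R'"
  then obtain T T' where "T > 0" "R \<subseteq> {0..T} \<times> {0..T}" "T' > 0" "R' \<subseteq> {0..T'} \<times> {0..T'}" "R \<in> sets borel" "R' \<in> sets borel"
    by (auto simp: bounded_region_def)
  moreover from this have "R \<union> R' \<subseteq> {0..max T T'} \<times> {0..max T T'}" by fastforce
  ultimately show ?thesis unfolding bounded_region_def by (intro conjI exI[of _ "max T T'"]) auto
qed

lemma bounded_region_integrable:
  assumes "bounded_region R" shows "integrable lborel (indicator R :: real \<times> real \<Rightarrow> real)"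
proof -
  obtain T where T: "R \<subseteq> {0..T} \<times> {0..T}" "R \<in> sets borel" using assms by (auto simp: bounded_region_def)
  have "{0..T} \<times> {0..T} = cbox (0, 0) (T, T)" by (auto simp: cbox_Pair_eq)
  then have "emeasure lborel R \<le> emeasure lborel (cbox (0, 0) (T, T))"
    using T by (intro emeasure_mono) auto
  also have "\<dots> < \<infinity>" by (rule emeasure_lborel_cbox_finite)
  finally show ?thesis using T(2) by (intro integrable_real_indicator) auto
qed

text \<open>Only the single variables X t are given as measurable. Right continuity yields joint
  measurability in time and outcome: on [0, T] the path is recovered from its dyadic values by
  \<open>path_eval\<close>, up to X 0, which cancels in differences.\<close>

lemma measurable_occ_integrand:
  assumes R: "bounded_region R"
  shows "(\<lambda>(\<omega>, z). indicator R z * rescale f \<epsilon> (X (fst z) \<omega> - X (snd z) \<omega>)) \<in> borel_measurable (M \<Otimes>\<^sub>M lborel)"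
proof -
  obtain T where T: "0 < T" "R \<subseteq> {0..T} \<times> {0..T}" and [measurable]: "R \<in> sets borel"
    using R by (auto simp: bounded_region_def)
  have [measurable]: "path 0 T \<in> M \<rightarrow>\<^sub>M path_space" using T by (intro measurable_path) auto
  have [measurable]: "rescale f \<epsilon> \<in> borel_measurable borel" by measurable
  let ?c = "T powr (1 / \<beta>)"
  define E where "E \<omega> s = path_eval (path 0 T \<omega>) (s / T)" for \<omega> s
  have z: "snd \<in> M \<Otimes>\<^sub>M lborel \<rightarrow>\<^sub>M (borel :: (real \<times> real) measure)"
    using measurable_snd[of M "lborel :: (real \<times> real) measure"] by simp
  note [measurable] = measurable_real_pair_fst[OF z] measurable_real_pair_snd[OF z]
  have [measurable]: "(\<lambda>x. E (fst x) (fst (snd x))) \<in> M \<Otimes>\<^sub>M (lborel :: (real \<times> real) measure) \<rightarrow>\<^sub>M borel"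
    "(\<lambda>x. E (fst x) (snd (snd x))) \<in> M \<Otimes>\<^sub>M (lborel :: (real \<times> real) measure) \<rightarrow>\<^sub>M borel"
    unfolding E_def
    by (rule measurable_path_eval', rule measurable_compose[OF measurable_fst], measurable)+
  have "(\<lambda>x. indicator R (snd x) * rescale f \<epsilon> (?c *\<^sub>R (E (fst x) (fst (snd x)) - E (fst x) (snd (snd x)))))
      \<in> borel_measurable (M \<Otimes>\<^sub>M lborel)"
    by measurable
  moreover have "indicator R (snd x) * rescale f \<epsilon> (?c *\<^sub>R (E (fst x) (fst (snd x)) - E (fst x) (snd (snd x)))) =
        (case x of (\<omega>, z) \<Rightarrow> indicator R z * rescale f \<epsilon> (X (fst z) \<omega> - X (snd z) \<omega>))"
    if x: "x \<in> space (M \<Otimes>\<^sub>M lborel)" for x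
  proof (cases "snd x \<in> R")
    case True
    have w: "fst x \<in> space M" using x by (simp add: space_pair_measure mem_Times_iff)
    have s: "0 \<le> fst (snd x)" "fst (snd x) \<le> T" "0 \<le> snd (snd x)" "snd (snd x) \<le> T"
      using subsetD[OF T(2) True] by (auto simp: mem_Times_iff)
    have "?c *\<^sub>R E (fst x) s = X s (fst x) - X 0 (fst x)" if "0 \<le> s" "s \<le> T" for s
      unfolding E_def using that T(1) by (subst path_eval_path[OF w]) auto
    then have "?c *\<^sub>R (E (fst x) (fst (snd x)) - E (fst x) (snd (snd x))) = X (fst (snd x)) (fst x) - X (snd (snd x)) (fst x)"
      using s by (simp add: scaleR_diff_right)
    then show ?thesis using True by (simp add: split_beta)
  qed (simp add: split_beta)
  ultimately show ?thesis
    by (subst (asm) measurable_cong) auto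
qed

lemma integrable_occ_integrand:
  assumes R: "bounded_region R" and \<epsilon>: "0 < \<epsilon>"
  shows "integrable (M \<Otimes>\<^sub>M lborel) (\<lambda>(\<omega>, z). indicator R z * rescale f \<epsilon> (X (fst z) \<omega> - X (snd z) \<omega>))"
    and "\<omega> \<in> space M \<Longrightarrow> integrable lborel (\<lambda>z. indicator R z * rescale f \<epsilon> (X (fst z) \<omega> - X (snd z) \<omega>))"
proof -
  interpret pair_sigma_finite M "lborel :: (real \<times> real) measure" ..
  obtain B where B: "\<And>x. rescale f \<epsilon> x \<le> B"
    using rescale_kernel_bounded[OF kernel] \<epsilon> by blast
  have iR: "integrable lborel (\<lambda>z. B * indicator R z :: real)"
    using bounded_region_integrable[OF R] by simp
  have [measurable]: "R \<in> sets borel" using R by (simp add: bounded_region_def)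
  have nb: "norm (indicator R z * rescale f \<epsilon> x) \<le> norm (B * indicator R z :: real)" for z x
    using B[of x] rescale_kernel_nonneg[OF kernel \<epsilon>, of x] by (auto simp: indicator_def)
  have prod: "integrable (M \<Otimes>\<^sub>M lborel) (\<lambda>(\<omega>, z). B * indicator R z :: real)"
    by (rule Fubini_integrable) (use iR in \<open>auto simp: split_beta' abs_mult\<close>)
  show "integrable (M \<Otimes>\<^sub>M lborel) (\<lambda>(\<omega>, z). indicator R z * rescale f \<epsilon> (X (fst z) \<omega> - X (snd z) \<omega>))"
    by (rule Bochner_Integration.integrable_bound[OF prod measurable_occ_integrand[OF R]])
       (rule AE_I2, simp only: split_beta' nb)
  show "integrable lborel (\<lambda>z. indicator R z * rescale f \<epsilon> (X (fst z) \<omega> - X (snd z) \<omega>))" if "\<omega> \<in> space M"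
  proof (rule Bochner_Integration.integrable_bound[OF iR])
    show "(\<lambda>z. indicator R z * rescale f \<epsilon> (X (fst z) \<omega> - X (snd z) \<omega>)) \<in> borel_measurable lborel"
      using measurable_compose[OF measurable_Pair1'[OF that] measurable_occ_integrand[OF R], of \<epsilon>] by simp
  qed (rule AE_I2, rule nb)
qed

lemma
  assumes R: "bounded_region R" and \<epsilon>: "0 < \<epsilon>"
  shows integrable_occ: "integrable M (occ R \<epsilon>)"
    and expectation_occ: "expectation (occ R \<epsilon>) =
      (LBINT z. indicator R z * expectation (\<lambda>\<omega>. rescale f \<epsilon> (X (fst z) \<omega> - X (snd z) \<omega>)))"
    and integrable_expectation_occ: "integrable lborel (\<lambda>z. indicator R z * expectation (\<lambda>\<omega>. rescale f \<epsilon> (X (fst z) \<omega> - X (snd z) \<omega>)))"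
proof -
  interpret pair_sigma_finite M "lborel :: (real \<times> real) measure" ..
  show "integrable M (occ R \<epsilon>)"
    unfolding occ_def[abs_def] using integrable_fst'[OF integrable_occ_integrand(1)[OF R \<epsilon>]] by simp
  show "expectation (occ R \<epsilon>) =
      (LBINT z. indicator R z * expectation (\<lambda>\<omega>. rescale f \<epsilon> (X (fst z) \<omega> - X (snd z) \<omega>)))"
    unfolding occ_def[abs_def] using Fubini_integral[OF integrable_occ_integrand(1)[OF R \<epsilon>]] by simp
  show "integrable lborel (\<lambda>z. indicator R z * expectation (\<lambda>\<omega>. rescale f \<epsilon> (X (fst z) \<omega> - X (snd z) \<omega>)))"
    using integrable_snd[OF integrable_occ_integrand(1)[OF R \<epsilon>]] by simp
qed

lemma borel_measurable_occ [measurable]: "bounded_region R \<Longrightarrow> occ R \<epsilon> \<in> borel_measurable M"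
  unfolding occ_def[abs_def] by (intro lborel.borel_measurable_lebesgue_integral measurable_occ_integrand)

lemma occ_nonneg: "0 < \<epsilon> \<Longrightarrow> 0 \<le> occ R \<epsilon> \<omega>"
  unfolding occ_def by (intro integral_nonneg_AE AE_I2 mult_nonneg_nonneg rescale_kernel_nonneg[OF kernel]) auto

lemma occ_Un:
  assumes "bounded_region R" "bounded_region R'" "R \<inter> R' = {}" "0 < \<epsilon>" "\<omega> \<in> space M"
  shows "occ (R \<union> R') \<epsilon> \<omega> = occ R \<epsilon> \<omega> + occ R' \<epsilon> \<omega>"
proof -
  have "indicator (R \<union> R') z * rescale f \<epsilon> x = indicator R z * rescale f \<epsilon> x + indicator R' z * rescale f \<epsilon> x" for z x
    using assms(3) by (auto simp: indicator_def)
  then show ?thesis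
    unfolding occ_def using assms by (simp add: integrable_occ_integrand)
qed

lemma occ_tri_split:
  assumes "0 \<le> b" "b \<le> c" "0 < \<epsilon>" "\<omega> \<in> space M"
  shows "occ (tri 0 c) \<epsilon> \<omega> = occ (tri 0 b) \<epsilon> \<omega> + occ (tri b c) \<epsilon> \<omega> + occ (rect b c) \<epsilon> \<omega>"
proof -
  have "tri 0 c = (tri 0 b \<union> tri b c) \<union> rect b c"
    using assms by (auto simp: tri_def rect_def)
  moreover have "tri 0 b \<inter> tri b c = {}" "(tri 0 b \<union> tri b c) \<inter> rect b c = {}"
    by (auto simp: tri_def rect_def)
  ultimately show ?thesis
    using assms by (simp add: occ_Un bounded_region_Un bounded_region_tri bounded_region_rect)
qed

text \<open>The substitution z = (a, a) + L z' gives L^2 from the area and L^(-\<alpha>) from the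
  kernel, whose width changes from \<epsilon> to \<epsilon> / L^(1/\<beta>).\<close>

lemma occ_tri_path:
  assumes "0 \<le> a" "0 < L" "0 < \<epsilon>" "\<omega> \<in> space M"
  shows "occ (tri a (a + L)) \<epsilon> \<omega> = L powr (2 - \<alpha>) * path_occ (\<epsilon> / L powr (1 / \<beta>)) (path a L \<omega>)"
proof -
  let ?g = "\<lambda>z. indicator (tri a (a + L)) z * rescale f \<epsilon> (X (fst z) \<omega> - X (snd z) \<omega>)"
  have g: "?g \<in> borel_measurable borel"
    using integrable_occ_integrand(2)[OF bounded_region_tri[OF assms(1)] assms(3,4), of "a + L"]
      borel_measurable_integrable by simp
  have pt: "?g ((a, a) + L *\<^sub>R z) = L powr (- \<alpha>) *
      (indicator (tri 0 1) z * rescale f (\<epsilon> / L powr (1 / \<beta>)) (path_eval (path a L \<omega>) (fst z) - path_eval (path a L \<omega>) (snd z)))" for z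
  proof (cases "z \<in> tri 0 1")
    case True
    then have z: "0 \<le> fst z" "fst z \<le> 1" "0 \<le> snd z" "snd z \<le> 1" by (auto simp: tri_def)
    have "(a, a) + L *\<^sub>R z \<in> tri a (a + L)" using True assms by (auto simp: tri_def mult_left_mono)
    moreover have "X (a + L * fst z) \<omega> - X (a + L * snd z) \<omega> =
        L powr (1 / \<beta>) *\<^sub>R (path_eval (path a L \<omega>) (fst z) - path_eval (path a L \<omega>) (snd z))"
      using assms z by (simp add: path_eval_path scaleR_diff_right[symmetric])
    ultimately show ?thesis
      using True assms powr_DIM[OF assms(2)] by (simp add: rescale_mult powr_minus_divide)
  next
    case False
    then have "(a, a) + L *\<^sub>R z \<notin> tri a (a + L)"
      using assms by (auto simp: tri_def mult_le_cancel_left zero_le_mult_iff)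
    then show ?thesis using False by simp
  qed
  have "occ (tri a (a + L)) \<epsilon> \<omega> = L ^ 2 * (LBINT z. ?g ((a, a) + L *\<^sub>R z))"
    unfolding occ_def using assms by (subst lborel_integral_affine[OF g, of L "(a, a)"]) (simp_all add: power2_eq_square)
  also have "\<dots> = L ^ 2 * (L powr (- \<alpha>) * path_occ (\<epsilon> / L powr (1 / \<beta>)) (path a L \<omega>))"
    unfolding pt path_occ_def by simp
  also have "L ^ 2 = L powr 2" using assms by (simp add: powr_realpow)
  finally show ?thesis
    by (simp add: powr_diff powr_minus divide_inverse flip: mult.assoc)
qed

lemma approx_silt_eq_occ:
  assumes "0 \<le> t" "0 < \<epsilon>" "\<omega> \<in> space M"
  shows "approx_silt X f \<epsilon> t \<omega> = occ (tri 0 t) \<epsilon> \<omega>"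
proof -
  let ?g = "\<lambda>s r. rescale f \<epsilon> (X s \<omega> - X r \<omega>)"
  have i: "integrable (lborel \<Otimes>\<^sub>M lborel) (\<lambda>(s, r). indicator (tri 0 t) (s, r) * ?g s r)"
    using integrable_occ_integrand(2)[OF bounded_region_tri[of 0 t] assms(2,3)]
    by (simp add: lborel_prod split_beta')
  have "occ (tri 0 t) \<epsilon> \<omega> = (LBINT s. LBINT r. indicator (tri 0 t) (s, r) * ?g s r)"
    unfolding occ_def lborel_prod[symmetric] using lborel_pair.integral_fst'[OF i] by (simp add: split_beta')
  also have "\<dots> = (LBINT s. indicator {0..t} s *\<^sub>R (LBINT r. indicator {0..s} r *\<^sub>R ?g s r))"
  proof (rule integral_cong_AE)
    \<comment> \<open>\<open>tri 0 t\<close> omits the edge s = t, which the closed interval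
      contains; the edge is a null set.\<close>
    have "AE s in lborel. s \<noteq> t" by (rule AE_lborel_singleton)
    then show "AE s in lborel. (LBINT r. indicator (tri 0 t) (s, r) * ?g s r) = indicator {0..t} s *\<^sub>R (LBINT r. indicator {0..s} r *\<^sub>R ?g s r)"
    proof eventually_elim
      case (elim s)
      have "indicator (tri 0 t) (s, r) * ?g s r = indicator {0..t} s *\<^sub>R (indicator {0..s} r *\<^sub>R ?g s r)" for r
        using elim by (auto simp: tri_def indicator_def)
      then show ?case by (simp only: integral_scaleR_right)
    qed
    have m: "(\<lambda>(s, r). indicator (tri 0 t) (s, r) * ?g s r) \<in> borel_measurable (lborel \<Otimes>\<^sub>M lborel)"
      using i by (rule borel_measurable_integrable)
    then show "(\<lambda>s. LBINT r. indicator (tri 0 t) (s, r) * ?g s r) \<in> borel_measurable lborel"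
      by (intro lborel.borel_measurable_lebesgue_integral)
    \<comment> \<open>A larger triangle contains the edge s = t, so measurability of the closed
      version can be read off from it.\<close>
    have "(\<lambda>(s, r). indicator (tri 0 (t + 1)) (s, r) * ?g s r) \<in> borel_measurable (lborel \<Otimes>\<^sub>M lborel)"
      using integrable_occ_integrand(2)[OF bounded_region_tri[of 0 "t + 1"] assms(2,3), THEN borel_measurable_integrable]
      by (simp add: lborel_prod split_beta')
    then have "(\<lambda>s. LBINT r. indicator (tri 0 (t + 1)) (s, r) * ?g s r) \<in> borel_measurable lborel"
      by (intro lborel.borel_measurable_lebesgue_integral)
    then have "(\<lambda>s. indicator {0..t} s *\<^sub>R (LBINT r. indicator (tri 0 (t + 1)) (s, r) * ?g s r)) \<in> borel_measurable lborel"
      by measurable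
    also have "(\<lambda>s. indicator {0..t} s *\<^sub>R (LBINT r. indicator (tri 0 (t + 1)) (s, r) * ?g s r)) =
        (\<lambda>s. indicator {0..t} s *\<^sub>R (LBINT r. indicator {0..s} r *\<^sub>R ?g s r))"
      by (intro ext) (auto simp: indicator_def tri_def intro!: Bochner_Integration.integral_cong)
    finally show "(\<lambda>s. indicator {0..t} s *\<^sub>R (LBINT r. indicator {0..s} r *\<^sub>R ?g s r)) \<in> borel_measurable lborel" .
  qed
  finally show ?thesis
    by (simp add: approx_silt_def set_lebesgue_integral_def)
qed

end

section \<open>Renormalized self-intersections of path segments\<close>

text \<open>Convergence in mean depends only on laws, so it transfers from the segment [0, 1] to all
  others. The nonnegative integral avoids carrying integrability along.\<close>

definition L1_lim :: "'b measure \<Rightarrow> (real \<Rightarrow> 'b \<Rightarrow> real) \<Rightarrow> ('b \<Rightarrow> real) \<Rightarrow> bool" where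
  "L1_lim N F G \<longleftrightarrow> (\<forall>\<epsilon>>0. F \<epsilon> \<in> borel_measurable N) \<and> G \<in> borel_measurable N \<and>
     ((\<lambda>\<epsilon>. \<integral>\<^sup>+\<omega>. ennreal \<bar>F \<epsilon> \<omega> - G \<omega>\<bar> \<partial>N) \<longlongrightarrow> 0) (at_right 0)"

lemma eventually_pos_at_right: "eventually (\<lambda>\<epsilon>::real. 0 < \<epsilon>) (at_right 0)"
  by (simp add: eventually_at_right_less)

lemma L1_lim_cong:
  assumes "L1_lim N F G" "\<And>\<epsilon> \<omega>. 0 < \<epsilon> \<Longrightarrow> \<omega> \<in> space N \<Longrightarrow> F \<epsilon> \<omega> = F' \<epsilon> \<omega>"
  shows "L1_lim N F' G"
proof -
  have "F \<epsilon> \<in> borel_measurable N \<longleftrightarrow> F' \<epsilon> \<in> borel_measurable N" if "0 < \<epsilon>" for \<epsilon>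
    using assms(2)[OF that] by (rule measurable_cong)
  moreover have "((\<lambda>\<epsilon>. \<integral>\<^sup>+\<omega>. ennreal \<bar>F \<epsilon> \<omega> - G \<omega>\<bar> \<partial>N) \<longlongrightarrow> 0) (at_right 0) \<longleftrightarrow>
      ((\<lambda>\<epsilon>. \<integral>\<^sup>+\<omega>. ennreal \<bar>F' \<epsilon> \<omega> - G \<omega>\<bar> \<partial>N) \<longlongrightarrow> 0) (at_right 0)"
    using eventually_pos_at_right
    by (intro tendsto_cong) (auto elim!: eventually_mono intro!: nn_integral_cong simp: assms(2))
  ultimately show ?thesis using assms(1) by (simp add: L1_lim_def)
qed

lemma L1_lim_add:
  assumes "L1_lim N F G" "L1_lim N F' G'"
  shows "L1_lim N (\<lambda>\<epsilon> \<omega>. F \<epsilon> \<omega> + F' \<epsilon> \<omega>) (\<lambda>\<omega>. G \<omega> + G' \<omega>)"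
proof -
  note m = assms[unfolded L1_lim_def]
  have "((\<lambda>\<epsilon>. (\<integral>\<^sup>+\<omega>. ennreal \<bar>F \<epsilon> \<omega> - G \<omega>\<bar> \<partial>N) + (\<integral>\<^sup>+\<omega>. ennreal \<bar>F' \<epsilon> \<omega> - G' \<omega>\<bar> \<partial>N)) \<longlongrightarrow> 0 + 0) (at_right 0)"
    using m by (intro tendsto_add) auto
  then have sum0: "((\<lambda>\<epsilon>. (\<integral>\<^sup>+\<omega>. ennreal \<bar>F \<epsilon> \<omega> - G \<omega>\<bar> \<partial>N) + (\<integral>\<^sup>+\<omega>. ennreal \<bar>F' \<epsilon> \<omega> - G' \<omega>\<bar> \<partial>N)) \<longlongrightarrow> 0) (at_right 0)"
    by simp
  have "((\<lambda>\<epsilon>. \<integral>\<^sup>+\<omega>. ennreal \<bar>F \<epsilon> \<omega> + F' \<epsilon> \<omega> - (G \<omega> + G' \<omega>)\<bar> \<partial>N) \<longlongrightarrow> 0) (at_right 0)"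
  proof (rule tendsto_sandwich[OF _ _ tendsto_const sum0])
    show "eventually (\<lambda>\<epsilon>. (\<integral>\<^sup>+\<omega>. ennreal \<bar>F \<epsilon> \<omega> + F' \<epsilon> \<omega> - (G \<omega> + G' \<omega>)\<bar> \<partial>N) \<le>
       (\<integral>\<^sup>+\<omega>. ennreal \<bar>F \<epsilon> \<omega> - G \<omega>\<bar> \<partial>N) + (\<integral>\<^sup>+\<omega>. ennreal \<bar>F' \<epsilon> \<omega> - G' \<omega>\<bar> \<partial>N)) (at_right 0)"
      using eventually_pos_at_right
    proof eventually_elim
      case (elim \<epsilon>)
      have "(\<integral>\<^sup>+\<omega>. ennreal \<bar>F \<epsilon> \<omega> + F' \<epsilon> \<omega> - (G \<omega> + G' \<omega>)\<bar> \<partial>N) \<le> (\<integral>\<^sup>+\<omega>. ennreal \<bar>F \<epsilon> \<omega> - G \<omega>\<bar> + ennreal \<bar>F' \<epsilon> \<omega> - G' \<omega>\<bar> \<partial>N)"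
        by (intro nn_integral_mono) (simp flip: ennreal_plus add: ennreal_leI)
      also have "\<dots> = (\<integral>\<^sup>+\<omega>. ennreal \<bar>F \<epsilon> \<omega> - G \<omega>\<bar> \<partial>N) + (\<integral>\<^sup>+\<omega>. ennreal \<bar>F' \<epsilon> \<omega> - G' \<omega>\<bar> \<partial>N)"
        using m elim by (intro nn_integral_add) auto
      finally show ?case .
    qed
  qed auto
  then show ?thesis using m by (auto simp: L1_lim_def intro!: borel_measurable_add)
qed

lemma L1_lim_cmult:
  assumes "L1_lim N F G"
  shows "L1_lim N (\<lambda>\<epsilon> \<omega>. c * F \<epsilon> \<omega>) (\<lambda>\<omega>. c * G \<omega>)"
proof -
  note m = assms[unfolded L1_lim_def]
  have "((\<lambda>\<epsilon>. ennreal \<bar>c\<bar> * (\<integral>\<^sup>+\<omega>. ennreal \<bar>F \<epsilon> \<omega> - G \<omega>\<bar> \<partial>N)) \<longlongrightarrow> ennreal \<bar>c\<bar> * 0) (at_right 0)"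
    using m by (intro ennreal_tendsto_cmult) auto
  also have "?this \<longleftrightarrow> ((\<lambda>\<epsilon>. \<integral>\<^sup>+\<omega>. ennreal \<bar>c * F \<epsilon> \<omega> - c * G \<omega>\<bar> \<partial>N) \<longlongrightarrow> ennreal \<bar>c\<bar> * 0) (at_right 0)"
  proof (intro tendsto_cong, use eventually_pos_at_right in eventually_elim)
    case (elim \<epsilon>)
    then show ?case
      using m by (subst nn_integral_cmult[symmetric])
        (auto simp: ennreal_mult[symmetric] abs_mult[symmetric] right_diff_distrib)
  qed
  finally show ?thesis using m by (auto simp: L1_lim_def intro!: borel_measurable_times)
qed

lemma L1_lim_diff:
  assumes "L1_lim N F G" "L1_lim N F' G'"
  shows "L1_lim N (\<lambda>\<epsilon> \<omega>. F \<epsilon> \<omega> - F' \<epsilon> \<omega>) (\<lambda>\<omega>. G \<omega> - G' \<omega>)"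
  using L1_lim_add[OF assms(1) L1_lim_cmult[OF assms(2), of "-1"]] by simp

lemma L1_lim_const: "G \<in> borel_measurable N \<Longrightarrow> L1_lim N (\<lambda>_. G) G"
  by (simp add: L1_lim_def)

text \<open>Where F is nonnegative, the negative part of G is at most |F - G|, whose integral tends
  to 0. This is how pathwise inequalities at positive \<epsilon> reach \<gamma>, also on an event H
  only.\<close>

lemma L1_lim_nonneg_on:
  assumes "L1_lim N F G" and H: "H \<in> sets N"
    and ev: "eventually (\<lambda>\<epsilon>. \<forall>\<omega>\<in>H. 0 \<le> F \<epsilon> \<omega>) (at_right 0)"
  shows "AE \<omega> in N. \<omega> \<in> H \<longrightarrow> 0 \<le> G \<omega>"
proof -
  note m = assms(1)[unfolded L1_lim_def]
  have [measurable]: "G \<in> borel_measurable N" "H \<in> sets N" using m H by auto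
  have "(\<integral>\<^sup>+\<omega>. ennreal (- G \<omega>) * indicator H \<omega> \<partial>N) \<le> 0"
  proof (rule tendsto_lowerbound)
    show "((\<lambda>\<epsilon>. \<integral>\<^sup>+\<omega>. ennreal \<bar>F \<epsilon> \<omega> - G \<omega>\<bar> \<partial>N) \<longlongrightarrow> 0) (at_right 0)" using m by simp
    show "eventually (\<lambda>\<epsilon>. (\<integral>\<^sup>+\<omega>. ennreal (- G \<omega>) * indicator H \<omega> \<partial>N) \<le> (\<integral>\<^sup>+\<omega>. ennreal \<bar>F \<epsilon> \<omega> - G \<omega>\<bar> \<partial>N)) (at_right 0)"
      using ev
    proof eventually_elim
      case (elim \<epsilon>)
      have "- G \<omega> \<le> \<bar>F \<epsilon> \<omega> - G \<omega>\<bar>" if "\<omega> \<in> H" for \<omega>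
        using elim that by fastforce
      then show ?case by (intro nn_integral_mono) (auto intro!: ennreal_leI simp: indicator_def)
    qed
  qed simp
  then have "AE \<omega> in N. ennreal (- G \<omega>) * indicator H \<omega> = 0"
    by (subst (asm) le_zero_eq, subst (asm) nn_integral_0_iff_AE) auto
  then show ?thesis
    by eventually_elim (auto simp: indicator_def ennreal_eq_0_iff)
qed

lemma L1_lim_unique:
  assumes "L1_lim N F G" "L1_lim N F G'"
  shows "AE \<omega> in N. G \<omega> = G' \<omega>"
proof -
  have "AE \<omega> in N. \<omega> \<in> space N \<longrightarrow> 0 \<le> G \<omega> - G' \<omega>" "AE \<omega> in N. \<omega> \<in> space N \<longrightarrow> 0 \<le> G' \<omega> - G \<omega>"
    by (rule L1_lim_nonneg_on[OF L1_lim_diff[OF assms]] L1_lim_nonneg_on[OF L1_lim_diff[OF assms(2,1)]]; simp)+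
  then show ?thesis using AE_space by eventually_elim simp
qed

section \<open>The limit functional on path space and its moments\<close>

context silt
begin

definition path_law :: "(nat \<times> nat \<Rightarrow> 'a) measure" where
  "path_law = distr M path_space (path 0 1)"

definition centred_occ :: "real \<Rightarrow> (nat \<times> nat \<Rightarrow> 'a) \<Rightarrow> real" where
  "centred_occ \<epsilon> w = path_occ \<epsilon> w - (LINT v|path_law. path_occ \<epsilon> v)"

text \<open>A fixed sequence of kernel widths and the total \<open>lim\<close> give a measurable
  functional. On the path over [0, 1] it is a version of \<open>\<gamma> 1\<close>; on any other
  normalized segment it takes the role of \<gamma> for that segment.\<close>

definition path_gamma :: "(nat \<times> nat \<Rightarrow> 'a) \<Rightarrow> real" where
  "path_gamma w = lim (\<lambda>n. centred_occ (1 / real (Suc n)) w)"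

definition Gam :: "real \<Rightarrow> real \<Rightarrow> 'w \<Rightarrow> real" where
  "Gam a L \<omega> = L powr (2 - \<alpha>) * path_gamma (path a L \<omega>)"

lemma sets_path_law [measurable_cong, simp]: "sets path_law = sets path_space"
  by (simp add: path_law_def)

lemma path_01_measurable [measurable]: "path 0 1 \<in> M \<rightarrow>\<^sub>M path_space"
  by (rule measurable_path) auto

lemma prob_path_law: "prob_space path_law"
  unfolding path_law_def by (rule prob_space_distr) measurable

sublocale path_law: prob_space path_law by (rule prob_path_law)

lemma distr_path_law: "0 \<le> a \<Longrightarrow> 0 < L \<Longrightarrow> distr M path_space (path a L) = path_law"
  unfolding path_law_def by (rule distr_path)

lemma measurable_centred_occ [measurable]: "centred_occ \<epsilon> \<in> path_space \<rightarrow>\<^sub>M borel"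
  unfolding centred_occ_def[abs_def] by measurable

lemma measurable_path_gamma [measurable]: "path_gamma \<in> path_space \<rightarrow>\<^sub>M borel"
  unfolding path_gamma_def[abs_def] by measurable

lemma measurable_Gam [measurable]: "0 \<le> a \<Longrightarrow> 0 \<le> L \<Longrightarrow> Gam a L \<in> borel_measurable M"
  unfolding Gam_def[abs_def]
  by (intro borel_measurable_times borel_measurable_const measurable_compose[OF measurable_path measurable_path_gamma])

lemma nn_integral_path_law:
  assumes "0 \<le> a" "0 < L" "h \<in> borel_measurable path_space"
  shows "(\<integral>\<^sup>+\<omega>. h (path a L \<omega>) \<partial>M) = (\<integral>\<^sup>+w. h w \<partial>path_law)"
  unfolding distr_path_law[OF assms(1,2), symmetric]
  using assms by (subst nn_integral_distr) (auto intro: measurable_path)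

lemma integral_path_law:
  fixes h :: "(nat \<times> nat \<Rightarrow> 'a) \<Rightarrow> real"
  assumes "0 \<le> a" "0 < L" "h \<in> borel_measurable path_space"
  shows "expectation (\<lambda>\<omega>. h (path a L \<omega>)) = path_law.expectation h"
    and "integrable M (\<lambda>\<omega>. h (path a L \<omega>)) \<longleftrightarrow> integrable path_law h"
  unfolding distr_path_law[OF assms(1,2), symmetric]
  using assms by (subst integral_distr integrable_distr_eq; auto intro: measurable_path)+

lemma expectation_occ_tri:
  assumes "0 \<le> a" "0 < L" "0 < \<epsilon>"
  shows "expectation (occ (tri a (a + L)) \<epsilon>) = L powr (2 - \<alpha>) * path_law.expectation (path_occ (\<epsilon> / L powr (1 / \<beta>)))"
proof -
  have "expectation (occ (tri a (a + L)) \<epsilon>) = expectation (\<lambda>\<omega>. L powr (2 - \<alpha>) * path_occ (\<epsilon> / L powr (1 / \<beta>)) (path a L \<omega>))"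
    using assms by (intro Bochner_Integration.integral_cong refl occ_tri_path)
  then show ?thesis by (simp add: integral_path_law(1)[OF assms(1,2)])
qed

lemma centred_occ_path:
  assumes "0 \<le> a" "0 < L" "0 < \<epsilon>" "\<omega> \<in> space M"
  shows "occ (tri a (a + L)) \<epsilon> \<omega> - expectation (occ (tri a (a + L)) \<epsilon>) =
     L powr (2 - \<alpha>) * centred_occ (\<epsilon> / L powr (1 / \<beta>)) (path a L \<omega>)"
  using assms by (simp add: expectation_occ_tri occ_tri_path centred_occ_def right_diff_distrib)

lemma renorm_approx_silt_eq:
  assumes "0 \<le> t" "0 < \<epsilon>" "\<omega> \<in> space M"
  shows "renorm_approx_silt M X f \<epsilon> t \<omega> = occ (tri 0 t) \<epsilon> \<omega> - expectation (occ (tri 0 t) \<epsilon>)"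
  unfolding renorm_approx_silt_def using assms
  by (simp add: approx_silt_eq_occ cong: Bochner_Integration.integral_cong)

lemma gamma_measurable [measurable]: "0 \<le> t \<Longrightarrow> \<gamma> t \<in> borel_measurable M"
  using renormalized by (simp add: renormalized_silt_def)

lemma gamma_one: "AE \<omega> in M. \<gamma> 1 \<omega> = path_gamma (path 0 1 \<omega>)"
proof -
  have "AE \<omega> in M. ((\<lambda>\<epsilon>. renorm_approx_silt M X f \<epsilon> 1 \<omega>) \<longlongrightarrow> \<gamma> 1 \<omega>) (at_right 0)"
    using renormalized by (simp add: renormalized_silt_def)
  then show ?thesis
    using AE_space
  proof eventually_elim
    case (elim \<omega>)
    have "filterlim (\<lambda>n. 1 / real (Suc n)) (at_right 0) sequentially"
      by real_asymp
    from filterlim_compose[OF elim(1) this]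
    have "(\<lambda>n. centred_occ (1 / real (Suc n)) (path 0 1 \<omega>)) \<longlonglongrightarrow> \<gamma> 1 \<omega>"
      using elim(2) centred_occ_path[of 0 1] by (simp add: renorm_approx_silt_eq)
    then show ?case unfolding path_gamma_def by (simp add: limI)
  qed
qed

lemma path_gamma_Lp:
  assumes p: "1 \<le> p"
  shows "((\<lambda>\<epsilon>. \<integral>\<^sup>+w. ennreal (\<bar>centred_occ \<epsilon> w - path_gamma w\<bar> powr p) \<partial>path_law) \<longlongrightarrow> 0) (at_right 0)"
proof -
  have "((\<lambda>\<epsilon>. \<integral>\<^sup>+\<omega>. ennreal (\<bar>renorm_approx_silt M X f \<epsilon> 1 \<omega> - \<gamma> 1 \<omega>\<bar> powr p) \<partial>M) \<longlongrightarrow> 0) (at_right 0)"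
    using renormalized p by (simp add: renormalized_silt_def)
  also have "?this \<longleftrightarrow> ?thesis"
  proof (intro tendsto_cong, use eventually_pos_at_right in eventually_elim)
    case (elim \<epsilon>)
    have "(\<integral>\<^sup>+\<omega>. ennreal (\<bar>renorm_approx_silt M X f \<epsilon> 1 \<omega> - \<gamma> 1 \<omega>\<bar> powr p) \<partial>M) =
       (\<integral>\<^sup>+\<omega>. ennreal (\<bar>centred_occ \<epsilon> (path 0 1 \<omega>) - path_gamma (path 0 1 \<omega>)\<bar> powr p) \<partial>M)"
    proof (rule nn_integral_cong_AE)
      show "AE \<omega> in M. ennreal (\<bar>renorm_approx_silt M X f \<epsilon> 1 \<omega> - \<gamma> 1 \<omega>\<bar> powr p) =
         ennreal (\<bar>centred_occ \<epsilon> (path 0 1 \<omega>) - path_gamma (path 0 1 \<omega>)\<bar> powr p)"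
        using gamma_one AE_space
        by eventually_elim (use elim centred_occ_path[of 0 1 \<epsilon>] in \<open>simp add: renorm_approx_silt_eq\<close>)
    qed
    also have "\<dots> = (\<integral>\<^sup>+w. ennreal (\<bar>centred_occ \<epsilon> w - path_gamma w\<bar> powr p) \<partial>path_law)"
      by (rule nn_integral_path_law) auto
    finally show ?case .
  qed
  finally show ?thesis .
qed

text \<open>Convergence to \<open>path_gamma\<close> comes from the path on [0, 1]. A normalized
  segment has the same law, hence convergence in mean carries over, along the widths \<epsilon> /
  L^(1/\<beta>).\<close>

lemma L1_lim_Gam:
  assumes "0 \<le> a" "0 < L"
  shows "L1_lim M (\<lambda>\<epsilon> \<omega>. occ (tri a (a + L)) \<epsilon> \<omega> - expectation (occ (tri a (a + L)) \<epsilon>)) (Gam a L)"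
proof -
  let ?c = "L powr (1 / \<beta>)"
  have [measurable]: "path a L \<in> M \<rightarrow>\<^sub>M path_space" using assms by (intro measurable_path) auto
  have "filterlim (\<lambda>\<epsilon>. \<epsilon> / ?c) (at_right 0) (at_right 0)"
  proof -
    have c: "0 < ?c" using assms by simp
    then show ?thesis by real_asymp
  qed
  from filterlim_compose[OF path_gamma_Lp[of 1] this]
  have "((\<lambda>\<epsilon>. \<integral>\<^sup>+w. ennreal \<bar>centred_occ (\<epsilon> / ?c) w - path_gamma w\<bar> \<partial>path_law) \<longlongrightarrow> 0) (at_right 0)"
    by simp
  also have "(\<lambda>\<epsilon>. \<integral>\<^sup>+w. ennreal \<bar>centred_occ (\<epsilon> / ?c) w - path_gamma w\<bar> \<partial>path_law) =
      (\<lambda>\<epsilon>. \<integral>\<^sup>+\<omega>. ennreal \<bar>centred_occ (\<epsilon> / ?c) (path a L \<omega>) - path_gamma (path a L \<omega>)\<bar> \<partial>M)"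
    by (intro ext nn_integral_path_law[symmetric] assms) measurable
  finally have "L1_lim M (\<lambda>\<epsilon> \<omega>. centred_occ (\<epsilon> / ?c) (path a L \<omega>)) (\<lambda>\<omega>. path_gamma (path a L \<omega>))"
    unfolding L1_lim_def by (intro conjI allI impI) measurable
  from L1_lim_cmult[OF this, of "L powr (2 - \<alpha>)"]
  show ?thesis
    unfolding Gam_def[symmetric]
    by (rule L1_lim_cong) (use assms in \<open>simp add: centred_occ_path\<close>)
qed

lemma L1_lim_gamma:
  assumes "0 \<le> t"
  shows "L1_lim M (\<lambda>\<epsilon> \<omega>. occ (tri 0 t) \<epsilon> \<omega> - expectation (occ (tri 0 t) \<epsilon>)) (\<gamma> t)"
proof -
  have "((\<lambda>\<epsilon>. \<integral>\<^sup>+\<omega>. ennreal \<bar>renorm_approx_silt M X f \<epsilon> t \<omega> - \<gamma> t \<omega>\<bar> \<partial>M) \<longlongrightarrow> 0) (at_right 0)"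
  proof -
    have "\<forall>p::real. 1 \<le> p \<longrightarrow> ((\<lambda>\<epsilon>. \<integral>\<^sup>+\<omega>. ennreal (\<bar>renorm_approx_silt M X f \<epsilon> t \<omega> - \<gamma> t \<omega>\<bar> powr p) \<partial>M) \<longlongrightarrow> 0) (at_right 0)"
      using renormalized assms unfolding renormalized_silt_def by blast
    from this[rule_format, of 1] show ?thesis by simp
  qed
  moreover have "renorm_approx_silt M X f \<epsilon> t \<in> borel_measurable M" if "0 < \<epsilon>" for \<epsilon>
  proof -
    have "(\<lambda>\<omega>. occ (tri 0 t) \<epsilon> \<omega> - expectation (occ (tri 0 t) \<epsilon>)) \<in> borel_measurable M"
      using bounded_region_tri[of 0 t] by measurable
    then show ?thesis
      using renorm_approx_silt_eq[OF assms that] by (subst measurable_cong) auto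
  qed
  ultimately have "L1_lim M (\<lambda>\<epsilon>. renorm_approx_silt M X f \<epsilon> t) (\<gamma> t)"
    using assms by (simp add: L1_lim_def)
  then show ?thesis
    by (rule L1_lim_cong) (simp add: renorm_approx_silt_eq assms)
qed

text \<open>Limits in mean are unique. Consequently \<gamma> t has the law of t^(2 - \<alpha>) times
  \<gamma> 1.\<close>

lemma gamma_eq_Gam: "0 < t \<Longrightarrow> AE \<omega> in M. \<gamma> t \<omega> = Gam 0 t \<omega>"
  using L1_lim_unique[OF L1_lim_gamma[of t] , of "Gam 0 t"] L1_lim_Gam[of 0 t] by simp

lemma path_occ_bounded:
  assumes "0 < \<epsilon>" shows "\<exists>C. \<forall>w. \<bar>path_occ \<epsilon> w\<bar> \<le> C"
proof -
  obtain B where B: "\<And>x. rescale f \<epsilon> x \<le> B"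
    using rescale_kernel_bounded[OF kernel] assms by blast
  have "0 \<le> B" using B rescale_kernel_nonneg[OF kernel assms] order_trans by blast
  then have "\<bar>path_occ \<epsilon> w\<bar> \<le> (LBINT z. B * indicator (tri 0 1) z)" for w
  proof -
    have "\<bar>path_occ \<epsilon> w\<bar> \<le> (LBINT z. norm (indicator (tri 0 1) z * rescale f \<epsilon> (path_eval w (fst z) - path_eval w (snd z))))"
      unfolding path_occ_def real_norm_def[symmetric] by (rule integral_norm_bound)
    also have "\<dots> \<le> (LBINT z. B * indicator (tri 0 1) z)"
    proof (rule integral_mono_AE')
      show "integrable lborel (\<lambda>z. B * indicator (tri 0 1) z :: real)"
        using bounded_region_integrable[OF bounded_region_tri[of 0 1]] by simp
    qed (use \<open>0 \<le> B\<close> in \<open>auto simp: indicator_def B rescale_kernel_nonneg[OF kernel assms]\<close>)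
    finally show ?thesis .
  qed
  then show ?thesis by blast
qed

lemma centred_occ_integrable:
  assumes "0 < \<epsilon>"
  shows "integrable path_law (\<lambda>w. (centred_occ \<epsilon> w)\<^sup>2)" "integrable path_law (centred_occ \<epsilon>)"
    "path_law.expectation (centred_occ \<epsilon>) = 0"
proof -
  obtain C where C: "\<And>w. \<bar>path_occ \<epsilon> w\<bar> \<le> C" using path_occ_bounded[OF assms] by blast
  have i: "integrable path_law (path_occ \<epsilon>)"
    by (rule path_law.integrable_const_bound[of _ C]) (auto simp: C)
  then show "integrable path_law (centred_occ \<epsilon>)" "path_law.expectation (centred_occ \<epsilon>) = 0"
    unfolding centred_occ_def[abs_def] by (auto simp: path_law.prob_space)
  have b: "\<bar>centred_occ \<epsilon> w\<bar> \<le> C + \<bar>path_law.expectation (path_occ \<epsilon>)\<bar>" for w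
    unfolding centred_occ_def using C[of w] by linarith
  show "integrable path_law (\<lambda>w. (centred_occ \<epsilon> w)\<^sup>2)"
    using power_mono[OF b abs_ge_zero, where n = 2]
    by (intro path_law.integrable_const_bound[of _ "(C + \<bar>path_law.expectation (path_occ \<epsilon>)\<bar>)\<^sup>2"]) auto
qed

text \<open>At one fixed kernel width the centred occupation is bounded and lies at finite L^2
  distance from the limit.\<close>

lemma path_gamma_square_integrable: "integrable path_law (\<lambda>w. (path_gamma w)\<^sup>2)"
proof -
  have "eventually (\<lambda>\<epsilon>. (\<integral>\<^sup>+w. ennreal (\<bar>centred_occ \<epsilon> w - path_gamma w\<bar> powr 2) \<partial>path_law) < 1) (at_right 0)"
    using path_gamma_Lp[of 2] by (intro order_tendstoD) auto
  then have "eventually (\<lambda>\<epsilon>. 0 < \<epsilon> \<and> (\<integral>\<^sup>+w. ennreal (\<bar>centred_occ \<epsilon> w - path_gamma w\<bar> powr 2) \<partial>path_law) < 1) (at_right 0)"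
    using eventually_pos_at_right by eventually_elim simp
  then obtain \<epsilon> where e: "0 < \<epsilon>" "(\<integral>\<^sup>+w. ennreal (\<bar>centred_occ \<epsilon> w - path_gamma w\<bar> powr 2) \<partial>path_law) < 1"
    using eventually_happens'[of "at_right (0::real)"] by auto
  have "integrable path_law (\<lambda>w. (centred_occ \<epsilon> w - path_gamma w)\<^sup>2)"
    using e(2) by (intro integrableI_nonneg) (auto simp: powr_numeral intro: less_trans)
  then have i: "integrable path_law (\<lambda>w. 2 * (centred_occ \<epsilon> w - path_gamma w)\<^sup>2 + 2 * (centred_occ \<epsilon> w)\<^sup>2)"
    using centred_occ_integrable[OF e(1)] by auto
  have "y\<^sup>2 \<le> 2 * (x - y)\<^sup>2 + 2 * x\<^sup>2" for x y :: real
    using zero_le_power2[of "2 * x - y"] by (simp add: power2_eq_square algebra_simps)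
  then show ?thesis
    by (intro Bochner_Integration.integrable_bound[OF i]) auto
qed

lemma path_gamma_integrable: "integrable path_law path_gamma"
  using path_law.square_integrable_imp_integrable[OF _ path_gamma_square_integrable] by simp

lemma path_gamma_expectation: "path_law.expectation path_gamma = 0"
proof -
  have "ennreal \<bar>path_law.expectation path_gamma\<bar> \<le> 0"
  proof (rule tendsto_lowerbound)
    show "((\<lambda>\<epsilon>. \<integral>\<^sup>+w. ennreal (\<bar>centred_occ \<epsilon> w - path_gamma w\<bar> powr 1) \<partial>path_law) \<longlongrightarrow> 0) (at_right 0)"
      by (rule path_gamma_Lp) simp
    show "eventually (\<lambda>\<epsilon>. ennreal \<bar>path_law.expectation path_gamma\<bar> \<le>
       (\<integral>\<^sup>+w. ennreal (\<bar>centred_occ \<epsilon> w - path_gamma w\<bar> powr 1) \<partial>path_law)) (at_right 0)"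
      using eventually_pos_at_right
    proof eventually_elim
      case (elim \<epsilon>)
      note i = centred_occ_integrable[OF elim]
      have "\<bar>path_law.expectation path_gamma\<bar> = \<bar>path_law.expectation (\<lambda>w. centred_occ \<epsilon> w - path_gamma w)\<bar>"
        using i path_gamma_integrable by simp
      also have "\<dots> \<le> path_law.expectation (\<lambda>w. \<bar>centred_occ \<epsilon> w - path_gamma w\<bar>)"
        by (rule integral_abs_bound)
      finally have "ennreal \<bar>path_law.expectation path_gamma\<bar> \<le> ennreal (path_law.expectation (\<lambda>w. \<bar>centred_occ \<epsilon> w - path_gamma w\<bar>))"
        by (rule ennreal_leI)
      also have "\<dots> = (\<integral>\<^sup>+w. ennreal \<bar>centred_occ \<epsilon> w - path_gamma w\<bar> \<partial>path_law)"
        using i path_gamma_integrable by (intro nn_integral_eq_integral[symmetric]) auto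
      finally show ?case by simp
    qed
  qed simp
  then show ?thesis by (simp add: ennreal_eq_0_iff)
qed

text \<open>The upper tail of -\<gamma> 1, placed on path space because all normalized segments
  share it.\<close>

definition tail :: "real \<Rightarrow> real" where
  "tail y = path_law.prob {w \<in> space path_law. y \<le> - path_gamma w}"

lemma prob_Gam:
  assumes "0 \<le> a" "0 < L"
  shows "prob {\<omega> \<in> space M. L powr (2 - \<alpha>) * y \<le> - Gam a L \<omega>} = tail y"
proof -
  have [measurable]: "path a L \<in> M \<rightarrow>\<^sub>M path_space" using assms by (intro measurable_path) auto
  have pos: "0 < L powr (2 - \<alpha>)" using assms by simp
  have iff: "L powr (2 - \<alpha>) * y \<le> - Gam a L \<omega> \<longleftrightarrow> y \<le> - path_gamma (path a L \<omega>)" for \<omega>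
    unfolding Gam_def using mult_le_cancel_left_pos[OF pos, of y "- path_gamma (path a L \<omega>)"] by simp
  have "space path_law = UNIV" by (simp add: path_law_def space_PiM)
  then have "{\<omega> \<in> space M. L powr (2 - \<alpha>) * y \<le> - Gam a L \<omega>} = path a L -` {w \<in> space path_law. y \<le> - path_gamma w} \<inter> space M"
    unfolding iff by blast
  moreover have "{w \<in> space path_law. y \<le> - path_gamma w} \<in> sets path_space"
    unfolding sets_path_law[symmetric] by measurable
  ultimately show ?thesis
    unfolding tail_def distr_path_law[OF assms, symmetric] by (simp add: measure_distr)
qed

lemma
  assumes "0 \<le> a" "0 < L"
  shows Gam_integrable: "integrable M (Gam a L)"
    and Gam_expectation: "expectation (Gam a L) = 0"
    and Gam_square_integrable: "integrable M (\<lambda>\<omega>. (Gam a L \<omega>)\<^sup>2)"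
    and Gam_abs_expectation: "expectation (\<lambda>\<omega>. \<bar>Gam a L \<omega>\<bar>) = L powr (2 - \<alpha>) * path_law.expectation (\<lambda>w. \<bar>path_gamma w\<bar>)"
proof -
  show "integrable M (Gam a L)"
    unfolding Gam_def[abs_def]
    by (intro integrable_mult_right integral_path_law(2)[OF assms, THEN iffD2] path_gamma_integrable measurable_path_gamma)
  show "expectation (Gam a L) = 0"
    unfolding Gam_def[abs_def] integral_mult_right_zero integral_path_law(1)[OF assms measurable_path_gamma]
    by (simp add: path_gamma_expectation)
  have "(\<lambda>w. (path_gamma w)\<^sup>2) \<in> borel_measurable path_space" "(\<lambda>w. \<bar>path_gamma w\<bar>) \<in> borel_measurable path_space"
    by measurable
  note m = this
  show "integrable M (\<lambda>\<omega>. (Gam a L \<omega>)\<^sup>2)"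
    unfolding Gam_def power_mult_distrib
    by (intro integrable_mult_right integral_path_law(2)[OF assms m(1), THEN iffD2] path_gamma_square_integrable)
  show "expectation (\<lambda>\<omega>. \<bar>Gam a L \<omega>\<bar>) = L powr (2 - \<alpha>) * path_law.expectation (\<lambda>w. \<bar>path_gamma w\<bar>)"
    unfolding Gam_def abs_mult integral_mult_right_zero integral_path_law(1)[OF assms m(2)] by simp
qed

text \<open>At fixed \<epsilon> the triangle over [0, c] consists of two triangles and the rectangle
  of their interaction. The rectangle is nonnegative before centring, so after centring it is at
  least -e, and this survives the limit in mean.\<close>

lemma gamma_superadditive:
  assumes "0 < b" "b < c" and e: "\<And>\<epsilon>. 0 < \<epsilon> \<Longrightarrow> expectation (occ (rect b c) \<epsilon>) \<le> e"
  shows "AE \<omega> in M. \<gamma> b \<omega> + Gam b (c - b) \<omega> - e \<le> \<gamma> c \<omega>"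
proof -
  let ?C = "\<lambda>R \<epsilon> \<omega>. occ R \<epsilon> \<omega> - expectation (occ R \<epsilon>)"
  have lim: "L1_lim M (\<lambda>\<epsilon> \<omega>. (?C (tri 0 c) \<epsilon> \<omega> - ?C (tri 0 b) \<epsilon> \<omega>) - ?C (tri b (b + (c - b))) \<epsilon> \<omega> + e)
     (\<lambda>\<omega>. (\<gamma> c \<omega> - \<gamma> b \<omega>) - Gam b (c - b) \<omega> + e)"
    using assms by (intro L1_lim_add L1_lim_diff L1_lim_gamma L1_lim_Gam L1_lim_const) auto
  have "AE \<omega> in M. \<omega> \<in> space M \<longrightarrow> 0 \<le> (\<gamma> c \<omega> - \<gamma> b \<omega>) - Gam b (c - b) \<omega> + e"
  proof (rule L1_lim_nonneg_on[OF lim])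
    show "eventually (\<lambda>\<epsilon>. \<forall>\<omega>\<in>space M. 0 \<le> (?C (tri 0 c) \<epsilon> \<omega> - ?C (tri 0 b) \<epsilon> \<omega>) - ?C (tri b (b + (c - b))) \<epsilon> \<omega> + e) (at_right 0)"
      using eventually_pos_at_right
    proof eventually_elim
      case (elim \<epsilon>)
      have eq: "occ (tri 0 c) \<epsilon> \<omega> = occ (tri 0 b) \<epsilon> \<omega> + occ (tri b c) \<epsilon> \<omega> + occ (rect b c) \<epsilon> \<omega>" if "\<omega> \<in> space M" for \<omega>
        using assms elim that by (intro occ_tri_split) auto
      have "expectation (occ (tri 0 c) \<epsilon>) = expectation (\<lambda>\<omega>. occ (tri 0 b) \<epsilon> \<omega> + occ (tri b c) \<epsilon> \<omega> + occ (rect b c) \<epsilon> \<omega>)"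
        by (intro Bochner_Integration.integral_cong refl eq)
      also have "\<dots> = expectation (occ (tri 0 b) \<epsilon>) + expectation (occ (tri b c) \<epsilon>) + expectation (occ (rect b c) \<epsilon>)"
        using assms elim by (simp add: integrable_occ bounded_region_tri bounded_region_rect)
      finally have es: "expectation (occ (tri 0 c) \<epsilon>) =
        expectation (occ (tri 0 b) \<epsilon>) + expectation (occ (tri b c) \<epsilon>) + expectation (occ (rect b c) \<epsilon>)" .
      show ?case
      proof
        fix \<omega> assume "\<omega> \<in> space M"
        from eq[OF this] e[OF elim] occ_nonneg[OF elim, of "rect b c" \<omega>] es
        show "0 \<le> (?C (tri 0 c) \<epsilon> \<omega> - ?C (tri 0 b) \<epsilon> \<omega>) - ?C (tri b (b + (c - b))) \<epsilon> \<omega> + e"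
          by simp
      qed
    qed
  qed simp
  then show ?thesis using AE_space by eventually_elim simp
qed

end

section \<open>Expected occupation\<close>

lemma nn_integral_lborel_pair_mult:
  fixes g k :: "real \<Rightarrow> ennreal"
  assumes [measurable]: "g \<in> borel_measurable borel" "k \<in> borel_measurable borel"
  shows "(\<integral>\<^sup>+z. g (fst z) * k (snd z) \<partial>lborel) = (\<integral>\<^sup>+s. g s \<partial>lborel) * (\<integral>\<^sup>+r. k r \<partial>lborel)"
proof -
  have "(\<integral>\<^sup>+z. g (fst z) * k (snd z) \<partial>lborel) = (\<integral>\<^sup>+s. (\<integral>\<^sup>+r. g s * k r \<partial>lborel) \<partial>lborel)"
    unfolding lborel_prod[symmetric] by (subst lborel.nn_integral_fst[symmetric]) auto
  then show ?thesis by (simp add: nn_integral_cmult nn_integral_multc)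
qed

text \<open>The value at 0 is infinite so that products of such factors remain upper bounds when a
  time lies on the edge of its range.\<close>

definition sing :: "real \<Rightarrow> real \<Rightarrow> ennreal" where
  "sing a u = (if u = 0 then \<infinity> else ennreal (u powr (- a)))"

lemma borel_measurable_sing [measurable]: "sing a \<in> borel_measurable borel"
  unfolding sing_def[abs_def] by measurable

lemma nn_integral_sing:
  assumes "a < 1" "0 \<le> h"
  shows "(\<integral>\<^sup>+u. sing a u * indicator {0..h} u \<partial>lborel) = ennreal (h powr (1 - a) / (1 - a))"
proof -
  have "(\<integral>\<^sup>+u. sing a u * indicator {0..h} u \<partial>lborel) = (\<integral>\<^sup>+u. ennreal (u powr (- a)) * indicator {0..h} u \<partial>lborel)"
    by (rule nn_integral_cong_AE, use AE_lborel_singleton[of 0] in eventually_elim) (simp add: sing_def)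
  also have "\<dots> = ennreal (h powr (- a + 1) / (- a + 1))"
    using assms by (intro nn_integral_has_integral_lebesgue' has_integral_powr_from_0) auto
  finally show ?thesis by simp
qed

lemma nn_integral_sing_shift:
  assumes "a < 1" "b \<le> c"
  shows "(\<integral>\<^sup>+s. sing a (s - b) * indicator {b..c} s \<partial>lborel) = ennreal ((c - b) powr (1 - a) / (1 - a))"
    and "(\<integral>\<^sup>+s. sing a (c - s) * indicator {b..c} s \<partial>lborel) = ennreal ((c - b) powr (1 - a) / (1 - a))"
proof -
  have 1: "sing a (b + 1 * u - b) * indicator {b..c} (b + 1 * u) = sing a u * indicator {0..c - b} u" for u
    by (auto simp: indicator_def)
  show "(\<integral>\<^sup>+s. sing a (s - b) * indicator {b..c} s \<partial>lborel) = ennreal ((c - b) powr (1 - a) / (1 - a))"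
    by (subst nn_integral_real_affine[of _ 1 b]) (use assms in \<open>simp_all only: 1 nn_integral_sing, simp_all\<close>)
  have 2: "sing a (c - (c + (-1) * u)) * indicator {b..c} (c + (-1) * u) = sing a u * indicator {0..c - b} u" for u
    by (auto simp: indicator_def)
  show "(\<integral>\<^sup>+s. sing a (c - s) * indicator {b..c} s \<partial>lborel) = ennreal ((c - b) powr (1 - a) / (1 - a))"
    by (subst nn_integral_real_affine[of _ "-1" c]) (use assms in \<open>simp_all only: 2 nn_integral_sing, simp_all\<close>)
qed

text \<open>Halving the exponent decouples the two times: the singularity of order \<alpha> \<ge> 1
  in s - r is bounded by a product of one-dimensional singularities of order \<alpha> / 2 < 1, each
  of which is integrable.\<close>

lemma powr_diff_le_sing:
  assumes "0 \<le> a" "0 \<le> u" "0 \<le> v" "0 < u + v"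
  shows "ennreal ((u + v) powr (- a)) \<le> sing (a / 2) u * sing (a / 2) v"
proof (cases "u = 0 \<or> v = 0")
  case True
  have "sing (a / 2) u * sing (a / 2) v = \<infinity>"
    using True assms(4) by (auto simp: sing_def ennreal_mult_eq_top_iff)
  then show ?thesis by simp
next
  case False
  have "u powr (a / 2) * v powr (a / 2) \<le> (u + v) powr (a / 2) * (u + v) powr (a / 2)"
    using assms by (intro mult_mono powr_mono2) auto
  also have "\<dots> = (u + v) powr a" by (simp flip: powr_add)
  finally have "(u + v) powr (- a) \<le> u powr (- (a / 2)) * v powr (- (a / 2))"
    using False assms unfolding powr_minus inverse_mult_distrib[symmetric] by (intro le_imp_inverse_le) auto
  then show ?thesis using False by (simp add: sing_def ennreal_leI flip: ennreal_mult)
qed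

context silt
begin

lemma measurable_X [measurable]: "0 \<le> t \<Longrightarrow> X t \<in> borel_measurable M"
  by (rule random_variable_X)

lemma expectation_rescale_increment:
  assumes "0 \<le> r" "r < s"
  shows "expectation (\<lambda>\<omega>. rescale f \<epsilon> (X s \<omega> - X r \<omega>)) =
    (s - r) powr (- \<alpha>) * expectation (\<lambda>\<omega>. rescale f (\<epsilon> / (s - r) powr (1 / \<beta>)) (X 1 \<omega>))"
proof -
  let ?u = "(s - r) powr (1 / \<beta>)"
  have u: "0 < ?u" using assms by simp
  have [measurable]: "X s \<in> borel_measurable M" "X r \<in> borel_measurable M" "X 1 \<in> borel_measurable M"
    using assms by auto
  have d: "distr M borel (\<lambda>\<omega>. (X s \<omega> - X r \<omega>) /\<^sub>R ?u) = distr M borel (X 1)"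
    using distr_scaled_increment[of r "s - r" "s - r"] assms by simp
  have "rescale f \<epsilon> (X s \<omega> - X r \<omega>) = (s - r) powr (- \<alpha>) * rescale f (\<epsilon> / ?u) ((X s \<omega> - X r \<omega>) /\<^sub>R ?u)" for \<omega>
    using rescale_mult[OF u, of f \<epsilon> "(X s \<omega> - X r \<omega>) /\<^sub>R ?u"] powr_DIM[of "s - r"] assms u
    by (simp add: powr_minus divide_inverse)
  then have "expectation (\<lambda>\<omega>. rescale f \<epsilon> (X s \<omega> - X r \<omega>)) =
      (s - r) powr (- \<alpha>) * (LINT y|distr M borel (\<lambda>\<omega>. (X s \<omega> - X r \<omega>) /\<^sub>R ?u). rescale f (\<epsilon> / ?u) y)"
    by (simp add: integral_distr)
  also have "\<dots> = (s - r) powr (- \<alpha>) * (LINT y|distr M borel (X 1). rescale f (\<epsilon> / ?u) y)"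
    unfolding d ..
  finally show ?thesis by (simp add: integral_distr)
qed

text \<open>\<kappa> stands in for a bound of the density of X 1 near the origin, phrased by kernels
  so that it applies at every \<epsilon>.\<close>

definition density_bound :: "real \<Rightarrow> bool" where
  "density_bound \<kappa> \<longleftrightarrow> 0 \<le> \<kappa> \<and> (\<forall>\<epsilon>>0. expectation (\<lambda>\<omega>. rescale f \<epsilon> (X 1 \<omega>)) \<le> \<kappa>)"

lemma rescale_kernel_continuous: "0 < \<epsilon> \<Longrightarrow> continuous_on UNIV (rescale f \<epsilon>)"
  unfolding rescale_def[abs_def]
  by (intro continuous_intros continuous_on_compose2[OF kernel_continuous[OF kernel]]) auto

lemma rescale_kernel_integral: "0 < \<epsilon> \<Longrightarrow> (LBINT x. rescale f \<epsilon> x) = 1"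
  and rescale_kernel_integrable: "0 < \<epsilon> \<Longrightarrow> integrable lborel (rescale f \<epsilon>)"
  using integral_rescale[OF kernel_integrable[OF kernel]] integrable_rescale[OF kernel_integrable[OF kernel]]
  by (auto simp: kernel_integral[OF kernel])

lemma X1_law: "prob_space (distr M borel (X 1))" "sets (distr M borel (X 1)) = sets borel"
  by (auto intro!: prob_space_distr)

lemma X1_cf: "cf (distr M borel (X 1)) l = complex_of_real (exp (- \<psi> l))"
  using cf_X[of 1 l] by simp

text \<open>Nondegeneracy, the lower bound on \<psi>, makes exp(-\<psi>) integrable.\<close>

lemma ex_density_bound: "\<exists>\<kappa>. density_bound \<kappa>"
proof -
  obtain c where c: "0 < c" "\<And>l. c * norm l powr \<beta> \<le> \<psi> l" using exponent_bounds by blast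
  have "integrable lborel (\<lambda>l. exp (- \<psi> l))"
  proof (rule Bochner_Integration.integrable_bound[OF integrable_exp_minus_norm_powr[OF c(1) order_pos]])
    have "continuous_on UNIV (\<lambda>l. exp (- \<psi> l))" by (intro continuous_intros exponent_continuous)
    then show "(\<lambda>l. exp (- \<psi> l)) \<in> borel_measurable lborel" by (simp add: borel_measurable_continuous_onI)
  qed (auto simp: c)
  from integral_le_of_integrable_cf[OF X1_law X1_cf less_imp_le[OF exp_gt_zero] this]
  obtain \<kappa> where "0 \<le> \<kappa>" and k0: "\<forall>(g::'a \<Rightarrow> real) B. continuous_on UNIV g \<longrightarrow> (\<forall>x. 0 \<le> g x) \<longrightarrow> (\<forall>x. g x \<le> B) \<longrightarrow> integrable lborel g \<longrightarrow>
     (LINT x|distr M borel (X 1). g x) \<le> \<kappa> * (LBINT x. g x)"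
    by (elim exE conjE)
  note k = \<open>0 \<le> \<kappa>\<close> k0[rule_format]
  have "expectation (\<lambda>\<omega>. rescale f \<epsilon> (X 1 \<omega>)) \<le> \<kappa>" if e: "0 < \<epsilon>" for \<epsilon>
  proof -
    obtain B where B: "\<And>x. rescale f \<epsilon> x \<le> B"
      using rescale_kernel_bounded[OF kernel] e by blast
    have "(LINT x|distr M borel (X 1). rescale f \<epsilon> x) \<le> \<kappa> * (LBINT x. rescale f \<epsilon> x)"
      using e B by (intro k(2)[of _ B]) (auto simp: rescale_kernel_continuous rescale_kernel_nonneg[OF kernel] rescale_kernel_integrable)
    then show ?thesis using e by (simp add: integral_distr rescale_kernel_integral)
  qed
  then show ?thesis using k(1) by (auto simp: density_bound_def)
qed

lemma continuous_density_X1: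
  assumes "continuous_density M (X 1) p"
  shows "continuous_on UNIV p" "\<And>x. 0 \<le> p x" "distr M borel (X 1) = density lborel (\<lambda>x. ennreal (p x))"
    "integrable lborel p"
proof -
  show p: "continuous_on UNIV p" "\<And>x. 0 \<le> p x" and d: "distr M borel (X 1) = density lborel (\<lambda>x. ennreal (p x))"
    using assms distributed_distr_eq_density[of M lborel "X 1"]
    by (auto simp: continuous_density_def cong: distr_cong)
  have [measurable]: "p \<in> borel_measurable borel" using p(1) by (rule borel_measurable_continuous_onI)
  interpret D: prob_space "distr M borel (X 1)" by (rule X1_law)
  have "(\<integral>\<^sup>+x. ennreal (p x) \<partial>lborel) = 1"
    using D.emeasure_space_1 unfolding d by (simp add: emeasure_density)
  then show "integrable lborel p"
    by (intro integrableI_nonneg) (auto simp: p)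
qed

lemma density_bound_density:
  assumes p: "continuous_density M (X 1) p"
  shows "density_bound (p 0)"
  unfolding density_bound_def
proof (intro conjI allI impI)
  note pp = continuous_density_X1[OF p]
  show "0 \<le> p 0" by (rule pp)
  fix \<epsilon> :: real assume e: "0 < \<epsilon>"
  obtain B where B: "\<And>x. rescale f \<epsilon> x \<le> B"
    using rescale_kernel_bounded[OF kernel] e by blast
  have "(LINT x|distr M borel (X 1). rescale f \<epsilon> x) \<le> p 0 * (LBINT x. rescale f \<epsilon> x)"
    using e B by (intro integral_le_density_at_zero[OF X1_law X1_cf _ pp(1-3), where B = B])
      (auto simp: rescale_kernel_continuous rescale_kernel_nonneg[OF kernel] rescale_kernel_integrable)
  then show "expectation (\<lambda>\<omega>. rescale f \<epsilon> (X 1 \<omega>)) \<le> p 0"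
    using e by (simp add: integral_distr rescale_kernel_integral)
qed

text \<open>The bound p 0 is attained as the kernel shrinks, which yields the lower bounds on mean
  occupation in the critical case.\<close>

lemma density_limit:
  assumes p: "continuous_density M (X 1) p"
  shows "((\<lambda>\<epsilon>. expectation (\<lambda>\<omega>. rescale f \<epsilon> (X 1 \<omega>))) \<longlongrightarrow> p 0) (at_right 0)"
  unfolding tendsto_at_iff_sequentially
proof (intro allI impI)
  note pp = continuous_density_X1[OF p]
  have [measurable]: "p \<in> borel_measurable borel" using pp(1) by (rule borel_measurable_continuous_onI)
  fix \<sigma> :: "nat \<Rightarrow> real" assume s: "\<forall>i. \<sigma> i \<in> {0<..} - {0}" "\<sigma> \<longlonglongrightarrow> 0"
  obtain B where B: "\<And>x. norm x ^ (DIM('a) + 1) * f x \<le> B" using kernel_decay[OF kernel] by blast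
  have "(\<lambda>k. LBINT x. rescale f (\<sigma> k) x * p x) \<longlonglongrightarrow> p 0"
    using s by (intro approximate_identity[OF kernel_integrable[OF kernel] less_imp_le[OF kernel_pos[OF kernel]] kernel_integral[OF kernel] B pp(1,2,4)]) auto
  moreover have "(LBINT x. rescale f (\<sigma> k) x * p x) = expectation (\<lambda>\<omega>. rescale f (\<sigma> k) (X 1 \<omega>))" for k
  proof -
    have "expectation (\<lambda>\<omega>. rescale f (\<sigma> k) (X 1 \<omega>)) = (LINT x|distr M borel (X 1). rescale f (\<sigma> k) x)"
      by (simp add: integral_distr)
    also have "\<dots> = (LBINT x. p x *\<^sub>R rescale f (\<sigma> k) x)"
      unfolding pp(3) by (intro integral_density) (auto simp: pp(2))
    finally show ?thesis by (simp add: mult.commute)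
  qed
  ultimately show "((\<lambda>\<epsilon>. expectation (\<lambda>\<omega>. rescale f \<epsilon> (X 1 \<omega>))) \<circ> \<sigma>) \<longlonglongrightarrow> p 0"
    by (simp add: o_def)
qed

lemma density_bound_pos:
  assumes "density_bound \<kappa>" shows "0 < \<kappa>"
proof -
  obtain B where B: "\<And>x. rescale f 1 x \<le> B"
    using rescale_kernel_bounded[OF kernel] zero_less_one by blast
  have i: "integrable M (\<lambda>\<omega>. rescale f 1 (X 1 \<omega>))"
    using B by (intro integrable_const_bound[of _ B]) (auto simp: rescale_kernel_nonneg[OF kernel])
  have "expectation (\<lambda>\<omega>. rescale f 1 (X 1 \<omega>)) \<noteq> 0"
  proof
    assume "expectation (\<lambda>\<omega>. rescale f 1 (X 1 \<omega>)) = 0"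
    then have "AE \<omega> in M. rescale f 1 (X 1 \<omega>) = 0"
      by (subst (asm) integral_nonneg_eq_0_iff_AE) (auto simp: i rescale_kernel_nonneg[OF kernel])
    then have "AE \<omega> in M. False"
      by eventually_elim (use kernel_pos[OF kernel] in \<open>simp add: rescale_def less_imp_neq[symmetric]\<close>)
    then show False by simp
  qed
  moreover have "0 \<le> expectation (\<lambda>\<omega>. rescale f 1 (X 1 \<omega>))"
    by (intro integral_nonneg_AE) (auto simp: rescale_kernel_nonneg[OF kernel])
  ultimately show ?thesis
    using assms by (auto simp: density_bound_def dest: spec[of _ 1])
qed

section \<open>Mean interaction of adjacent time segments\<close>

lemma expectation_occ_le:
  assumes \<kappa>: "density_bound \<kappa>" and R: "bounded_region R" "R \<subseteq> {z. 0 \<le> snd z \<and> snd z < fst z}" and \<epsilon>: "0 < \<epsilon>"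
    and h: "\<And>z. z \<in> R \<Longrightarrow> ennreal ((fst z - snd z) powr (- \<alpha>)) \<le> h z"
    and e: "h \<in> borel_measurable lborel" "(\<integral>\<^sup>+z. h z \<partial>lborel) \<le> ennreal e" "0 \<le> e"
  shows "expectation (occ R \<epsilon>) \<le> \<kappa> * e"
proof -
  have k: "0 \<le> \<kappa>" using \<kappa> by (simp add: density_bound_def)
  let ?E = "\<lambda>z. expectation (\<lambda>\<omega>. rescale f \<epsilon> (X (fst z) \<omega> - X (snd z) \<omega>))"
  have E0: "0 \<le> ?E z" for z
    by (intro integral_nonneg_AE) (auto simp: rescale_kernel_nonneg[OF kernel \<epsilon>])
  have "ennreal (expectation (occ R \<epsilon>)) = (\<integral>\<^sup>+z. ennreal (indicator R z * ?E z) \<partial>lborel)"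
    unfolding expectation_occ[OF R(1) \<epsilon>]
    by (intro nn_integral_eq_integral[symmetric] integrable_expectation_occ R \<epsilon>) (auto simp: E0)
  also have "\<dots> \<le> (\<integral>\<^sup>+z. ennreal \<kappa> * h z \<partial>lborel)"
  proof (rule nn_integral_mono)
    fix z
    show "ennreal (indicator R z * ?E z) \<le> ennreal \<kappa> * h z"
    proof (cases "z \<in> R")
      case True
      then have z: "0 \<le> snd z" "snd z < fst z" using R by auto
      have "?E z \<le> (fst z - snd z) powr (- \<alpha>) * \<kappa>"
        unfolding expectation_rescale_increment[OF z]
        using \<kappa> \<epsilon> z by (intro mult_left_mono) (auto simp: density_bound_def)
      then have "ennreal (?E z) \<le> ennreal \<kappa> * ennreal ((fst z - snd z) powr (- \<alpha>))"
        using k by (simp add: ennreal_leI mult.commute flip: ennreal_mult)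
      also have "\<dots> \<le> ennreal \<kappa> * h z" by (intro mult_left_mono h True) simp
      finally show ?thesis using True by simp
    qed simp
  qed
  also have "\<dots> \<le> ennreal (\<kappa> * e)"
    using e k by (simp add: nn_integral_cmult ennreal_mult mult_left_mono)
  finally show ?thesis using k e by (simp add: ennreal_le_iff)
qed

text \<open>Cut s - r at the common time, as (s - b) + (b - r), and decouple. For segments of length
  of order t the result is of order t^(2 - \<alpha>), the natural scale of \<gamma>.\<close>

lemma expectation_occ_rect_le:
  assumes "density_bound \<kappa>" "0 < b" "b \<le> c" "0 < \<epsilon>"
  shows "expectation (occ (rect b c) \<epsilon>) \<le> \<kappa> / (1 - \<alpha> / 2)\<^sup>2 * (b * (c - b)) powr (1 - \<alpha> / 2)"
proof -
  have a: "0 \<le> \<alpha>" "\<alpha> / 2 < 1" using \<alpha>_bounds by auto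
  let ?h = "\<lambda>z. (sing (\<alpha> / 2) (fst z - b) * indicator {b..c} (fst z)) * (sing (\<alpha> / 2) (b - snd z) * indicator {0..b} (snd z))"
  have "expectation (occ (rect b c) \<epsilon>) \<le> \<kappa> * ((c - b) powr (1 - \<alpha> / 2) / (1 - \<alpha> / 2) * (b powr (1 - \<alpha> / 2) / (1 - \<alpha> / 2)))"
  proof (rule expectation_occ_le[OF assms(1) bounded_region_rect _ assms(4), where h = ?h])
    show "rect b c \<subseteq> {z. 0 \<le> snd z \<and> snd z < fst z}" by (auto simp: rect_def)
    show "?h \<in> borel_measurable lborel" unfolding lborel_prod[symmetric] by measurable
    show "(\<integral>\<^sup>+z. ?h z \<partial>lborel) \<le> ennreal ((c - b) powr (1 - \<alpha> / 2) / (1 - \<alpha> / 2) * (b powr (1 - \<alpha> / 2) / (1 - \<alpha> / 2)))"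
    proof (subst nn_integral_lborel_pair_mult)
      show "(\<integral>\<^sup>+s. sing (\<alpha> / 2) (s - b) * indicator {b..c} s \<partial>lborel) * (\<integral>\<^sup>+r. sing (\<alpha> / 2) (b - r) * indicator {0..b} r \<partial>lborel) \<le>
          ennreal ((c - b) powr (1 - \<alpha> / 2) / (1 - \<alpha> / 2) * (b powr (1 - \<alpha> / 2) / (1 - \<alpha> / 2)))"
        unfolding nn_integral_sing_shift(1)[OF a(2) assms(3)] nn_integral_sing_shift(2)[OF a(2) less_imp_le[OF assms(2)]]
        using a by (subst ennreal_mult[symmetric]) auto
    qed measurable
    fix z assume z: "z \<in> rect b c"
    then have "ennreal ((fst z - snd z) powr - \<alpha>) \<le> sing (\<alpha> / 2) (fst z - b) * sing (\<alpha> / 2) (b - snd z)"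
      using powr_diff_le_sing[OF a(1), of "fst z - b" "b - snd z"] by (simp add: rect_def)
    then show "ennreal ((fst z - snd z) powr - \<alpha>) \<le> ?h z"
      using z by (simp add: rect_def)
  qed (use assms a in auto)
  also have "\<dots> = \<kappa> / (1 - \<alpha> / 2)\<^sup>2 * (b * (c - b)) powr (1 - \<alpha> / 2)"
    using assms by (simp add: powr_mult power2_eq_square)
  finally show ?thesis .
qed

text \<open>The decoupled bound would grow like the square root of i, so it is used only for the
  last unit of the past, where it gives 2 * 2 = 4. The older past lies more than 1 away and
  contributes the integral of 1 / (i - r) over [0, i - 1], which is ln i.\<close>

lemma expectation_occ_rect_unit_le:
  assumes "density_bound \<kappa>" "\<alpha> = 1" "1 \<le> i" "0 < \<epsilon>"
  shows "expectation (occ (rect i (i + 1)) \<epsilon>) \<le> \<kappa> * (4 + ln i)"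
proof (rule expectation_occ_le[OF assms(1) bounded_region_rect _ assms(4)])
  let ?h1 = "\<lambda>z. (sing (1 / 2) (fst z - i) * indicator {i..i + 1} (fst z)) * (sing (1 / 2) (i - snd z) * indicator {i - 1..i} (snd z))"
  let ?h2 = "\<lambda>z. indicator {i..i + 1} (fst z) * (ennreal (1 / (i - snd z)) * indicator {0..i - 1} (snd z))"
  show "rect i (i + 1) \<subseteq> {z. 0 \<le> snd z \<and> snd z < fst z}" by (auto simp: rect_def)
  have 1: "(\<integral>\<^sup>+z. ?h1 z \<partial>lborel) = ennreal 4"
    using nn_integral_sing_shift(1)[of "1 / 2" i "i + 1"] nn_integral_sing_shift(2)[of "1 / 2" "i - 1" i]
    by (subst nn_integral_lborel_pair_mult) (simp_all flip: ennreal_mult)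
  have "(\<integral>\<^sup>+r. ennreal (1 / (i - r)) * indicator {0..i - 1} r \<partial>lborel) = ennreal (- ln (i - (i - 1)) - (- ln (i - 0)))"
    using assms(3) by (intro nn_integral_FTC_Icc) (auto intro!: derivative_eq_intros simp: divide_simps)
  then have 2: "(\<integral>\<^sup>+z. ?h2 z \<partial>lborel) = ennreal (ln i)"
    by (subst nn_integral_lborel_pair_mult) simp_all
  have m: "?h1 \<in> borel_measurable lborel" "?h2 \<in> borel_measurable lborel"
    unfolding lborel_prod[symmetric] by measurable
  then show "(\<lambda>z. ?h1 z + ?h2 z) \<in> borel_measurable lborel" by (rule borel_measurable_add)
  show "(\<integral>\<^sup>+z. ?h1 z + ?h2 z \<partial>lborel) \<le> ennreal (4 + ln i)"
  proof (subst nn_integral_add[OF m])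
    show "(\<integral>\<^sup>+z. ?h1 z \<partial>lborel) + (\<integral>\<^sup>+z. ?h2 z \<partial>lborel) \<le> ennreal (4 + ln i)"
      unfolding 1 2 using assms(3) by (subst ennreal_plus[symmetric]) auto
  qed
  fix z assume z: "z \<in> rect i (i + 1)"
  show "ennreal ((fst z - snd z) powr - \<alpha>) \<le> ?h1 z + ?h2 z"
  proof (cases "i - 1 \<le> snd z")
    case True
    have "ennreal ((fst z - snd z) powr - \<alpha>) \<le> sing (1 / 2) (fst z - i) * sing (1 / 2) (i - snd z)"
      using powr_diff_le_sing[of 1 "fst z - i" "i - snd z"] z assms(2) by (simp add: rect_def)
    then show ?thesis using True z by (simp add: rect_def add_increasing2)
  next
    case False
    have "(fst z - snd z) powr - \<alpha> \<le> 1 / (i - snd z)"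
      using z False assms(2) by (simp add: rect_def powr_minus_divide divide_left_mono)
    then have "ennreal ((fst z - snd z) powr - \<alpha>) \<le> ?h2 z"
      using z False by (simp add: rect_def ennreal_leI)
    then show ?thesis by (simp add: add_increasing)
  qed
qed (use assms in auto)

end

section \<open>Abstract law of the iterated logarithm\<close>

text \<open>A quantitative second Borel-Cantelli lemma: with probabilities at least 1 / (n + 1) the
  product over the complements telescopes to m / (m + k + 1), which tends to 0.\<close>

lemma (in prob_space) infinitely_often_of_independent:
  assumes A [measurable]: "\<And>n. A n \<in> events"
    and ind: "\<And>J. finite J \<Longrightarrow> J \<noteq> {} \<Longrightarrow> prob (\<Inter>n\<in>J. space M - A n) = (\<Prod>n\<in>J. prob (space M - A n))"
    and lower: "\<And>n::nat. n0 \<le> n \<Longrightarrow> 1 / real (Suc n) \<le> prob (A n)"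
  shows "AE \<omega> in M. \<forall>m. \<exists>n\<ge>m. \<omega> \<in> A n"
proof -
  have null: "prob (\<Inter>n\<in>{m..}. space M - A n) \<le> 0" if m: "n0 \<le> m" "1 \<le> m" for m
  proof (rule tendsto_lowerbound)
    have "(\<Prod>n\<in>{m..m + k}. 1 - 1 / real (Suc n)) = real m / real (m + k + 1)" for k
    proof (induction k)
      case (Suc k)
      have "{m..m + Suc k} = insert (m + Suc k) {m..m + k}" by auto
      then show ?case using Suc by (simp add: field_simps)
    qed (simp add: field_simps)
    moreover have "prob (\<Inter>n\<in>{m..}. space M - A n) \<le> (\<Prod>n\<in>{m..m + k}. 1 - 1 / real (Suc n))" for k
    proof -
      have "prob (\<Inter>n\<in>{m..}. space M - A n) \<le> prob (\<Inter>n\<in>{m..m + k}. space M - A n)"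
        by (intro finite_measure_mono sets.finite_INT) auto
      also have "\<dots> = (\<Prod>n\<in>{m..m + k}. prob (space M - A n))" by (intro ind) auto
      also have "\<dots> \<le> (\<Prod>n\<in>{m..m + k}. 1 - 1 / real (Suc n))"
        using lower m by (intro prod_mono) (auto simp: prob_compl)
      finally show ?thesis .
    qed
    ultimately show "eventually (\<lambda>k. prob (\<Inter>n\<in>{m..}. space M - A n) \<le> real m / real (m + k + 1)) sequentially"
      by simp
    show "(\<lambda>k. real m / real (m + k + 1)) \<longlonglongrightarrow> 0" by real_asymp
  qed simp
  have ae: "AE \<omega> in M. \<exists>n\<ge>m. \<omega> \<in> A n" if m: "n0 \<le> m" "1 \<le> m" for m
  proof -
    have S: "(\<Inter>n\<in>{m..}. space M - A n) \<in> events"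
      by (intro sets.countable_INT') auto
    have "prob (\<Inter>n\<in>{m..}. space M - A n) = 0" using null[OF m] by (simp add: measure_le_0_iff)
    then have "AE \<omega> in M. \<omega> \<notin> (\<Inter>n\<in>{m..}. space M - A n)"
      using prob_eq_0[OF S] by simp
    then show ?thesis using AE_space by eventually_elim auto
  qed
  have "AE \<omega> in M. \<forall>m. \<exists>n\<ge>m + n0 + 1. \<omega> \<in> A n"
    unfolding AE_all_countable by (intro allI ae) auto
  then show ?thesis
  proof eventually_elim
    case (elim \<omega>)
    show ?case
    proof
      fix m
      from elim obtain n where "n \<ge> m + n0 + 1" "\<omega> \<in> A n" by blast
      then show "\<exists>n\<ge>m. \<omega> \<in> A n" by (intro exI[of _ n]) simp
    qed
  qed
qed

lemma (in prob_space) eventually_not_of_summable: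
  assumes "\<And>n::nat. A n \<in> events" "\<And>n. n0 \<le> n \<Longrightarrow> prob (A n) \<le> g n" "summable g"
  shows "AE \<omega> in M. eventually (\<lambda>n. \<omega> \<notin> A n) sequentially"
proof -
  have "summable (\<lambda>n. prob (A n))"
    by (rule summable_comparison_test'[OF assms(3), of n0]) (simp add: assms(2))
  then have "AE \<omega> in M. eventually (\<lambda>n. \<omega> \<in> space M - A n) sequentially"
    using assms(1) by (intro borel_cantelli_AE1) (auto simp: less_top[symmetric])
  then show ?thesis by eventually_elim (auto elim: eventually_mono)
qed

section \<open>Upper bound for -\<gamma> at all large times\<close>

lemma powr_dyadic: "0 \<le> x \<Longrightarrow> (x / 2 ^ k) powr s = x powr s * ((1 / 2) powr s) ^ k"
  for x s :: real
proof -
  assume x: "0 \<le> x"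
  have "(x / 2 ^ k) powr s = (x * (1 / 2) ^ k) powr s"
    by (simp only: power_one_over mult_1_right times_divide_eq_right)
  also have "\<dots> = x powr s * (((1 / 2) ^ k) powr s)"
    using x by (intro powr_mult)
  also have "((1 / 2 :: real) ^ k) powr s = ((1 / 2) powr real k) powr s"
    using powr_realpow[of "1 / 2" k] by simp
  also have "\<dots> = ((1 / 2) powr s) powr real k" by (simp only: powr_powr mult.commute)
  also have "\<dots> = ((1 / 2) powr s) ^ k" by (rule powr_realpow) simp
  finally show ?thesis .
qed

context silt
begin

lemma tail_antimono: "x \<le> y \<Longrightarrow> tail y \<le> tail x"
proof -
  assume "x \<le> y"
  moreover have "{w \<in> space path_law. x \<le> - path_gamma w} \<in> path_law.events" by measurable
  ultimately show ?thesis
    unfolding tail_def by (intro path_law.finite_measure_mono) auto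
qed

lemma gamma_superadditive_powr:
  "\<exists>C\<ge>0. \<forall>b c. 0 < b \<longrightarrow> b < c \<longrightarrow>
     (AE \<omega> in M. \<gamma> b \<omega> + Gam b (c - b) \<omega> - C * (b * (c - b)) powr (1 - \<alpha> / 2) \<le> \<gamma> c \<omega>)"
proof -
  obtain \<kappa> where k: "density_bound \<kappa>" using ex_density_bound by blast
  have "0 \<le> \<kappa> / (1 - \<alpha> / 2)\<^sup>2" using k by (simp add: density_bound_def)
  moreover have "AE \<omega> in M. \<gamma> b \<omega> + Gam b (c - b) \<omega> - \<kappa> / (1 - \<alpha> / 2)\<^sup>2 * (b * (c - b)) powr (1 - \<alpha> / 2) \<le> \<gamma> c \<omega>"
    if "0 < b" "b < c" for b c
    using that k by (intro gamma_superadditive expectation_occ_rect_le) auto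
  ultimately show ?thesis by blast
qed

lemma prob_gamma:
  assumes "0 < t" shows "prob {\<omega> \<in> space M. t powr (2 - \<alpha>) * y \<le> - \<gamma> t \<omega>} = tail y"
proof -
  have [measurable]: "\<gamma> t \<in> borel_measurable M" "Gam 0 t \<in> borel_measurable M"
    using assms by (auto intro: gamma_measurable measurable_Gam)
  have "prob {\<omega> \<in> space M. t powr (2 - \<alpha>) * y \<le> - \<gamma> t \<omega>} = prob {\<omega> \<in> space M. t powr (2 - \<alpha>) * y \<le> - Gam 0 t \<omega>}"
  proof (rule finite_measure_eq_AE)
    show "AE \<omega> in M. \<omega> \<in> {\<omega> \<in> space M. t powr (2 - \<alpha>) * y \<le> - \<gamma> t \<omega>} \<longleftrightarrow> \<omega> \<in> {\<omega> \<in> space M. t powr (2 - \<alpha>) * y \<le> - Gam 0 t \<omega>}"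
      using gamma_eq_Gam[OF assms] by eventually_elim simp
  qed measurable
  then show ?thesis using prob_Gam[of 0 t] assms by simp
qed

text \<open>Dyadic chaining: between two consecutive dyadic times of level \<open>k\<close> only one new segment enters.\<close>

lemma gamma_chain:
  fixes g :: "real \<Rightarrow> real" and G :: "real \<Rightarrow> real \<Rightarrow> real"
  assumes super: "\<And>k j. j < 2 ^ k \<Longrightarrow> g (t + h * real j / 2 ^ k) + G (t + h * real j / 2 ^ k) (h / 2 ^ k) - e k \<le> g (t + h * real (Suc j) / 2 ^ k)"
    and small: "\<And>k j. j < 2 ^ k \<Longrightarrow> - G (t + h * real j / 2 ^ k) (h / 2 ^ k) \<le> \<delta> k"
    and nonneg: "\<And>k. 0 \<le> e k + \<delta> k"
  shows "j \<le> 2 ^ k \<Longrightarrow> - g (t + h * real j / 2 ^ k) \<le> - g t + (\<Sum>m\<le>k. \<delta> m + e m)"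
proof (induction k arbitrary: j)
  case 0
  then consider "j = 0" | "j = 1" by fastforce
  then show ?case
  proof cases
    case 1 then show ?thesis using nonneg[of 0] by simp
  next
    case 2 then show ?thesis using super[of 0 0] small[of 0 0] by simp
  qed
next
  case (Suc k)
  have half: "t + h * real (2 * i) / 2 ^ Suc k = t + h * real i / 2 ^ k" for i by simp
  show ?case
  proof (cases "even j")
    case True
    then obtain i where i: "j = 2 * i" by blast
    then have "i \<le> 2 ^ k" using Suc.prems by simp
    from Suc.IH[OF this] show ?thesis
      unfolding i half sum.atMost_Suc using nonneg[of "Suc k"] by linarith
  next
    case False
    then obtain i where "j = 2 * i + 1" by (rule oddE)
    then have i: "j = Suc (2 * i)" by simp
    from i have "i < 2 ^ k" "2 * i < 2 ^ Suc k" using Suc.prems by simp_all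
    then have ih: "- g (t + h * real i / 2 ^ k) \<le> - g t + (\<Sum>m\<le>k. \<delta> m + e m)" by (intro Suc.IH) simp
    show ?thesis
      using super[OF \<open>2 * i < 2 ^ Suc k\<close>] small[OF \<open>2 * i < 2 ^ Suc k\<close>] ih
      unfolding i half sum.atMost_Suc by linarith
  qed
qed

text \<open>Along t n = (1 + h)^n the bound exp(-\<rho> ln ln t) is of order n^(-\<rho>), summable
  since \<rho> > 1. In between, chaining uses one more segment per dyadic level. Level k has 2^k
  segments, each allowed k + 2 times the threshold, so that both the probabilities and the excesses
  can be summed. The excesses carry a factor h^s and the mean interactions lack the growing factor
  N, so both fit into the gap between K' and K''.\<close>

lemma LIL_upper:
  fixes N :: "real \<Rightarrow> real"
  assumes N_mono: "\<And>x y. L0 \<le> x \<Longrightarrow> x \<le> y \<Longrightarrow> N x \<le> N y"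
    and N_sub: "\<And>c x. 1 \<le> c \<Longrightarrow> L0 \<le> x \<Longrightarrow> N (c * x) \<le> c * N x"
    and N_lim: "filterlim N at_top at_top"
    and K: "0 < K'" and \<rho>: "1 < \<rho>"
    and tail: "eventually (\<lambda>L. tail (K' * N L) \<le> exp (- \<rho> * L)) at_top"
    and K'': "K' < K''"
  shows "AE \<omega> in M. eventually (\<lambda>t. - \<gamma> t \<omega> \<le> K'' * (t powr (2 - \<alpha>) * N (ln (ln t)))) at_top"
proof -
  define s where "s = 2 - \<alpha>"
  have s: "1 / 2 < s" "s \<le> 1" using \<alpha>_bounds by (auto simp: s_def)
  have s2: "1 - \<alpha> / 2 = s / 2" by (simp add: s_def)
  obtain C where C: "0 \<le> C" and super: "\<And>b c. 0 < b \<Longrightarrow> b < c \<Longrightarrow>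
     AE \<omega> in M. \<gamma> b \<omega> + Gam b (c - b) \<omega> - C * (b * (c - b)) powr (s / 2) \<le> \<gamma> c \<omega>"
    using gamma_superadditive_powr unfolding s2 by blast
  define \<eta> where "\<eta> = (K'' - K') / 2"
  have \<eta>: "0 < \<eta>" using K'' by (simp add: \<eta>_def)
  define r where "r = (1 / 2 :: real) powr s"
  define r' where "r' = (1 / 2 :: real) powr (s / 2)"
  have r: "0 < r" "r < 1" "0 < r'" "r' < 1" using s powr_less_mono2[of s "1 / 2" 1] powr_less_mono2[of "s / 2" "1 / 2" 1]
    by (auto simp: r_def r'_def)
  \<comment> \<open>Level k contributes k + 2 times the threshold on segments 2^k times shorter,
    which scales it by r^k.\<close>
  define S where "S = (\<Sum>k. (real k + 2) * r ^ k)"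
  have sumS: "summable (\<lambda>k. (real k + 2) * r ^ k)"
  proof -
    have "summable (\<lambda>k. real k * r ^ k)"
    proof (rule summable_comparison_test_ev)
      \<comment> \<open>One factor \<open>sqrt r ^ k\<close> absorbs k, the other keeps the series
        summable.\<close>
      have q: "0 < sqrt r" "sqrt r < 1" "sqrt r * sqrt r = r" using r by auto
      have "(\<lambda>k. real k * sqrt r ^ k) \<longlonglongrightarrow> 0"
        using powser_times_n_limit_0[of "sqrt r"] q by simp
      then have "eventually (\<lambda>k. real k * sqrt r ^ k < 1) sequentially"
        by (rule order_tendstoD) simp
      then show "eventually (\<lambda>k. norm (real k * r ^ k) \<le> sqrt r ^ k) sequentially"
      proof eventually_elim
        case (elim k)
        have "real k * r ^ k = (real k * sqrt r ^ k) * sqrt r ^ k"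
          using q(3) by (simp only: mult.assoc power_mult_distrib[symmetric])
        also have "\<dots> \<le> 1 * sqrt r ^ k" using elim q by (intro mult_right_mono) auto
        finally show ?case using r by simp
      qed
      show "summable (\<lambda>k. sqrt r ^ k)" using q by (intro summable_geometric) simp
    qed
    moreover have "summable (\<lambda>k. 2 * r ^ k)" using r by (intro summable_mult summable_geometric) auto
    ultimately have "summable (\<lambda>k. real k * r ^ k + 2 * r ^ k)" by (rule summable_add)
    then show ?thesis by (simp only: distrib_right)
  qed
  define S' where "S' = (\<Sum>k. r' ^ k)"
  have sumS': "summable (\<lambda>k. r' ^ k)" using r by (intro summable_geometric) auto
  have S: "0 \<le> S" "0 \<le> S'" unfolding S_def S'_def using r sumS sumS' by (auto intro!: suminf_nonneg)
  \<comment> \<open>h is taken so small that the excesses of all levels together stay below \<eta> N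
    in units of \<open>t n powr s\<close>.\<close>
  have "((\<lambda>h. K' * S * h powr s) \<longlongrightarrow> K' * S * 0 powr s) (at_right 0)"
    using s eventually_mono[OF eventually_pos_at_right less_imp_le]
    by (intro tendsto_mult tendsto_const tendsto_powr' tendsto_ident_at) auto
  then have "eventually (\<lambda>h. K' * S * h powr s < \<eta>) (at_right 0)"
    using \<eta> by (intro order_tendstoD(2)) auto
  moreover have "eventually (\<lambda>h. h < 1) (at_right (0::real))"
    by (rule eventually_at_right_real[of 0 1, THEN eventually_mono]) auto
  ultimately have "eventually (\<lambda>h. 0 < h \<and> h < 1 \<and> K' * S * h powr s < \<eta>) (at_right 0)"
    using eventually_pos_at_right by eventually_elim simp
  then obtain h where h: "0 < h" "h < 1" "K' * S * h powr s < \<eta>"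
    using eventually_happens'[of "at_right (0::real)"] by auto
  define t where "t n = (1 + h) ^ n" for n :: nat
  define l where "l n = ln (ln (t n))" for n
  have tpos: "0 < t n" for n using h by (simp add: t_def)
  have tSuc: "t (Suc n) = t n + h * t n" for n by (simp add: t_def algebra_simps)
  have lnt: "ln (t n) = real n * ln (1 + h)" for n using h by (simp add: t_def ln_realpow)
  have lim_t: "filterlim t at_top sequentially"
    unfolding t_def using h by real_asymp
  have lim_l: "filterlim l at_top sequentially"
    unfolding l_def by (intro filterlim_compose[OF ln_at_top] filterlim_compose[OF ln_at_top lim_t])
  \<comment> \<open>Total mean interaction over all levels in units of \<open>t n powr s\<close>;
    the factor 2 covers the base times, which stay below (1 + h) t n \<le> 2 t n.\<close>
  define C2 where "C2 = C * (2 * h) powr (s / 2) * S'"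
  have "eventually (\<lambda>L. L0 \<le> L \<and> 2 \<le> L \<and> tail (K' * N L) \<le> exp (- \<rho> * L) \<and> max 1 (C2 / \<eta>) \<le> N L) at_top"
    using eventually_ge_at_top[of L0] eventually_ge_at_top[of 2] tail filterlim_at_top[THEN iffD1, OF N_lim, rule_format, of "max 1 (C2 / \<eta>)"]
    by eventually_elim simp
  then obtain L1 where L1: "\<And>L. L1 \<le> L \<Longrightarrow> L0 \<le> L \<and> 2 \<le> L \<and> tail (K' * N L) \<le> exp (- \<rho> * L) \<and> max 1 (C2 / \<eta>) \<le> N L"
    by (auto simp: eventually_at_top_linorder)
  have "eventually (\<lambda>n. L1 \<le> l n \<and> 1 \<le> n) sequentially"
    using filterlim_at_top[THEN iffD1, OF lim_l, rule_format, of L1] eventually_ge_at_top[of 1] by eventually_elim simp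
  then obtain n0 where n0: "\<And>n. n0 \<le> n \<Longrightarrow> L1 \<le> l n \<and> 1 \<le> n"
    by (auto simp: eventually_at_top_linorder)
  define main where "main n = {\<omega> \<in> space M. t n powr s * (K' * N (l n)) \<le> - \<gamma> (t n) \<omega>}" for n
  define b where "b n k j = t n + h * t n * real j / 2 ^ k" for n k j
  define D where "D n k = h * t n / 2 ^ k" for n k
  have bpos: "0 < b n k j" and Dpos: "0 < D n k" for n k j
    using h tpos[of n] by (auto simp: b_def D_def intro!: add_pos_nonneg)
  have bD: "b n k j + D n k = b n k (Suc j)" for n k j by (simp add: b_def D_def field_simps)
  define seg where "seg n k j = {\<omega> \<in> space M. D n k powr s * (K' * (real k + 2) * N (l n)) \<le> - Gam (b n k j) (D n k) \<omega>}" for n k j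
  \<comment> \<open>Scale n fails if -\<gamma> is too large at the geometric time itself or on some
    dyadic segment, of whatever level, that follows it.\<close>
  define bad where "bad n = main n \<union> (\<Union>k. \<Union>j<2^k. seg n k j)" for n
  have main_ev: "main n \<in> events" for n
  proof -
    have [measurable]: "\<gamma> (t n) \<in> borel_measurable M" using tpos[of n] by (intro gamma_measurable) auto
    show ?thesis unfolding main_def by measurable
  qed
  have seg_ev: "seg n k j \<in> events" for n k j
  proof -
    have [measurable]: "Gam (b n k j) (D n k) \<in> borel_measurable M"
      using bpos[of n k j] Dpos[of n k] by (intro measurable_Gam) auto
    show ?thesis unfolding seg_def by measurable
  qed
  have bad_ev: "bad n \<in> events" for n
    unfolding bad_def using main_ev seg_ev by auto
  have bad_prob: "prob (bad n) \<le> exp (- \<rho> * l n) + 2 * exp (- 2 * l n)" if n: "n0 \<le> n" for n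
  proof -
    have L: "L0 \<le> l n" "2 \<le> l n" "tail (K' * N (l n)) \<le> exp (- \<rho> * l n)" "1 \<le> N (l n)"
      using L1[of "l n"] n0[OF n] by auto
    have m: "prob (main n) \<le> exp (- \<rho> * l n)"
      using L(3) prob_gamma[OF tpos, of n "K' * N (l n)"] by (simp add: main_def s_def)
    \<comment> \<open>2^k segments of probability at most exp(-(k + 2) l) give exp(-2 l) (2
      exp(-l))^k, a geometric series whose ratio is at most 1/2 once l \<ge> 2.\<close>
    have q: "2 * exp (- l n) \<le> 1 / 2"
    proof -
      have "4 \<le> exp (2::real)" using exp_ge_add_one_self[of 1] mult_mono[of 2 "exp 1" 2 "exp (1::real)"] by (simp flip: exp_add)
      also have "exp 2 \<le> exp (l n)" using L(2) by simp
      finally show ?thesis by (simp add: exp_minus field_simps)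
    qed
    have sj: "prob (seg n k j) = tail (K' * (real k + 2) * N (l n))" for k j
      unfolding seg_def s_def using bpos[of n k j] Dpos[of n k] by (intro prob_Gam) auto
    have sk: "prob (\<Union>j<2^k. seg n k j) \<le> exp (- 2 * l n) * (2 * exp (- l n)) ^ k" for k
    proof -
      have "prob (\<Union>j<2^k. seg n k j) \<le> (\<Sum>j<2^k. prob (seg n k j))"
        using seg_ev by (intro finite_measure_subadditive_finite) auto
      also have "\<dots> = 2 ^ k * tail (K' * (real k + 2) * N (l n))"
        by (simp add: sj)
      also have "\<dots> \<le> 2 ^ k * exp (- (real k + 2) * l n)"
      proof (rule mult_left_mono)
        \<comment> \<open>\<open>N_sub\<close> trades the factor k + 2 in the threshold for the same
          factor in the argument of N, and thus in the exponent of the probability.\<close>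
        have "K' * N ((real k + 2) * l n) \<le> K' * (real k + 2) * N (l n)"
          using N_sub[of "real k + 2" "l n"] L K by (simp add: mult.assoc)
        then have "tail (K' * (real k + 2) * N (l n)) \<le> tail (K' * N ((real k + 2) * l n))"
          by (rule tail_antimono)
        also have "\<dots> \<le> exp (- \<rho> * ((real k + 2) * l n))"
        proof -
          have "l n \<le> (real k + 2) * l n" using L by (simp add: algebra_simps)
          then show ?thesis using L1[of "(real k + 2) * l n"] n0[OF n] by auto
        qed
        also have "\<dots> \<le> exp (- (real k + 2) * l n)"
        proof -
          have "(real k + 2) * l n \<le> \<rho> * ((real k + 2) * l n)"
            using \<rho> L mult_right_mono[of 1 \<rho> "(real k + 2) * l n"] by simp
          then show ?thesis by (simp only: exp_le_cancel_iff mult_minus_left neg_le_iff_le)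
        qed
        finally show "tail (K' * (real k + 2) * N (l n)) \<le> exp (- (real k + 2) * l n)" .
      qed simp
      also have "\<dots> = exp (- 2 * l n) * (2 * exp (- l n)) ^ k"
        by (simp add: power_mult_distrib exp_of_nat_mult[symmetric] exp_add[symmetric] algebra_simps)
      finally show ?thesis .
    qed
    have gs: "summable (\<lambda>k. exp (- 2 * l n) * (2 * exp (- l n)) ^ k)"
      using q by (intro summable_mult summable_geometric) (auto simp: abs_mult)
    have "prob (\<Union>k. \<Union>j<2^k. seg n k j) \<le> (\<Sum>k. prob (\<Union>j<2^k. seg n k j))"
      using seg_ev by (intro finite_measure_subadditive_countably summable_comparison_test'[OF gs, of 0]) (use sk in auto)
    also have "\<dots> \<le> (\<Sum>k. exp (- 2 * l n) * (2 * exp (- l n)) ^ k)"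
      by (intro suminf_le sk gs summable_comparison_test'[OF gs, of 0]) (use sk in auto)
    also have "\<dots> = exp (- 2 * l n) * (1 / (1 - 2 * exp (- l n)))"
      using q gs by (subst suminf_mult) (auto simp: suminf_geometric intro!: summable_geometric)
    also have "\<dots> \<le> exp (- 2 * l n) * 2"
      using q by (intro mult_left_mono) (auto simp: field_simps)
    finally have "prob (\<Union>k. \<Union>j<2^k. seg n k j) \<le> 2 * exp (- 2 * l n)" by simp
    moreover have "prob (bad n) \<le> prob (main n) + prob (\<Union>k. \<Union>j<2^k. seg n k j)"
      unfolding bad_def using main_ev seg_ev by (intro measure_Un_le) auto
    ultimately show ?thesis using m by simp
  qed
  \<comment> \<open>Since l n = ln (ln (t n)), the exponential is (n ln (1 + h))^(-q).\<close>
  have exp_l: "exp (- q * l n) = ln (1 + h) powr (- q) * real n powr (- q)" if "n0 \<le> n" for q n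
  proof -
    have "1 \<le> n" using n0[OF that] by simp
    then show ?thesis using h by (simp add: l_def lnt powr_def ln_mult flip: exp_add) (simp add: algebra_simps)
  qed
  have "AE \<omega> in M. eventually (\<lambda>n. \<omega> \<notin> bad n) sequentially"
  proof (rule eventually_not_of_summable[OF bad_ev])
    show "prob (bad n) \<le> ln (1 + h) powr (- \<rho>) * real n powr (- \<rho>) + 2 * (ln (1 + h) powr (- 2) * real n powr (- 2))" if "n0 \<le> n" for n
      using bad_prob[OF that] exp_l[OF that, of \<rho>] exp_l[OF that, of 2] by simp
    show "summable (\<lambda>n. ln (1 + h) powr (- \<rho>) * real n powr (- \<rho>) + 2 * (ln (1 + h) powr (- 2) * real n powr (- 2)))"
      using \<rho> by (intro summable_add summable_mult) (simp_all add: summable_real_powr_iff)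
  qed
  \<comment> \<open>Countably many times occur, so one null set serves for all these
    inequalities.\<close>
  moreover have "AE \<omega> in M. \<forall>n k j. \<gamma> (b n k j) \<omega> + Gam (b n k j) (D n k) \<omega> - C * (b n k j * D n k) powr (s / 2) \<le> \<gamma> (b n k (Suc j)) \<omega>"
    unfolding AE_all_countable
  proof (intro allI)
    fix n k j
    have "b n k j < b n k (Suc j)" using bD[of n k j] Dpos[of n k] by simp
    moreover have "b n k (Suc j) - b n k j = D n k" using bD[of n k j] by simp
    ultimately show "AE \<omega> in M. \<gamma> (b n k j) \<omega> + Gam (b n k j) (D n k) \<omega> - C * (b n k j * D n k) powr (s / 2) \<le> \<gamma> (b n k (Suc j)) \<omega>"
      using super[OF bpos, of n k j "b n k (Suc j)"] by simp
  qed
  moreover have "AE \<omega> in M. continuous_on {0..} (\<lambda>t. \<gamma> t \<omega>)"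
    using renormalized by (simp add: renormalized_silt_def)
  ultimately show ?thesis
    using AE_space
  proof eventually_elim
    case (elim \<omega>)
    then obtain n1 where n1: "\<And>n. n1 \<le> n \<Longrightarrow> \<omega> \<notin> bad n" by (auto simp: eventually_at_top_linorder)
    have block: "- \<gamma> \<tau> \<omega> \<le> K'' * (t n powr s * N (l n))"
      if n: "max n0 n1 \<le> n" and \<tau>: "t n \<le> \<tau>" "\<tau> \<le> t (Suc n)" for n \<tau>
    proof -
      have L: "1 \<le> N (l n)" "C2 \<le> \<eta> * N (l n)"
        using L1[of "l n"] n0[of n] n \<eta> by (auto simp: field_simps)
      have nb: "\<omega> \<notin> bad n" using n1 n by simp
      define e where "e k = C * (2 * t n * D n k) powr (s / 2)" for k
      define \<delta> where "\<delta> k = D n k powr s * (K' * (real k + 2) * N (l n))" for k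
      have e0: "0 \<le> e k" and \<delta>0: "0 \<le> \<delta> k" for k
        using C K L(1) by (auto simp: e_def \<delta>_def)
      have e_eq: "e k = t n powr s * (C * (2 * h) powr (s / 2)) * r' ^ k" for k
      proof -
        have "2 * t n * D n k = (t n * t n * (2 * h)) / 2 ^ k" by (simp add: D_def)
        then have "(2 * t n * D n k) powr (s / 2) = (t n * t n * (2 * h)) powr (s / 2) * r' ^ k"
          using h tpos[of n] by (simp only: r'_def) (intro powr_dyadic, simp)
        also have "(t n * t n * (2 * h)) powr (s / 2) = t n powr s * (2 * h) powr (s / 2)"
          using h tpos[of n] by (simp add: powr_mult flip: powr_add)
        finally show ?thesis by (simp add: e_def)
      qed
      have \<delta>_eq: "\<delta> k = t n powr s * (K' * h powr s * N (l n)) * ((real k + 2) * r ^ k)" for k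
      proof -
        have "D n k powr s = (h * t n) powr s * r ^ k"
          using h tpos[of n] unfolding D_def r_def by (intro powr_dyadic) simp
        also have "(h * t n) powr s = h powr s * t n powr s" using h tpos[of n] by (simp add: powr_mult)
        finally show ?thesis by (simp add: \<delta>_def)
      qed
      have sums: "(\<Sum>m\<le>k. \<delta> m + e m) \<le> t n powr s * (2 * \<eta> * N (l n))" for k
      proof -
        have "(\<Sum>m\<le>k. \<delta> m) \<le> t n powr s * (K' * h powr s * N (l n)) * S"
          unfolding \<delta>_eq sum_distrib_left[symmetric] S_def
          using K L(1) r by (intro mult_left_mono sum_le_suminf sumS) auto
        also have "\<dots> = t n powr s * ((K' * S * h powr s) * N (l n))" by simp
        also have "\<dots> \<le> t n powr s * (\<eta> * N (l n))"
          using h(3) L(1) by (intro mult_left_mono mult_right_mono) auto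
        finally have 1: "(\<Sum>m\<le>k. \<delta> m) \<le> t n powr s * (\<eta> * N (l n))" .
        have "(\<Sum>m\<le>k. e m) \<le> t n powr s * (C * (2 * h) powr (s / 2)) * S'"
          unfolding e_eq sum_distrib_left[symmetric] S'_def
          using C r by (intro mult_left_mono sum_le_suminf sumS') auto
        also have "\<dots> = t n powr s * C2" by (simp add: C2_def)
        also have "\<dots> \<le> t n powr s * (\<eta> * N (l n))" using L(2) by (intro mult_left_mono) auto
        finally show ?thesis using 1 by (simp add: sum.distrib algebra_simps)
      qed
      have dyadic: "- \<gamma> (t n + h * t n * real j / 2 ^ k) \<omega> \<le> K'' * (t n powr s * N (l n))" if j: "j \<le> 2 ^ k" for j k
      proof -
        have "- \<gamma> (t n + h * t n * real j / 2 ^ k) \<omega> \<le> - \<gamma> (t n) \<omega> + (\<Sum>m\<le>k. \<delta> m + e m)"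
        proof (rule gamma_chain[where g = "\<lambda>u. \<gamma> u \<omega>" and G = "\<lambda>a L. Gam a L \<omega>", OF _ _ _ j])
          fix k j :: nat assume j: "j < 2 ^ k"
          have "real j \<le> 2 ^ k" using j by (metis less_imp_le of_nat_le_iff of_nat_numeral of_nat_power)
          then have "h * t n * real j / 2 ^ k \<le> 1 * t n * 2 ^ k / 2 ^ k"
            using h tpos[of n] by (intro divide_right_mono mult_mono) auto
          then have "b n k j \<le> 2 * t n" by (simp add: b_def)
          then have "(b n k j * D n k) powr (s / 2) \<le> (2 * t n * D n k) powr (s / 2)"
            using s bpos[of n k j] Dpos[of n k] by (intro powr_mono2 mult_right_mono) auto
          then have "C * (b n k j * D n k) powr (s / 2) \<le> e k" unfolding e_def using C by (rule mult_left_mono)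
          moreover have "\<gamma> (b n k j) \<omega> + Gam (b n k j) (D n k) \<omega> - C * (b n k j * D n k) powr (s / 2) \<le> \<gamma> (b n k (Suc j)) \<omega>"
            using elim(2) by blast
          ultimately show "\<gamma> (t n + h * t n * real j / 2 ^ k) \<omega> + Gam (t n + h * t n * real j / 2 ^ k) (h * t n / 2 ^ k) \<omega> - e k
              \<le> \<gamma> (t n + h * t n * real (Suc j) / 2 ^ k) \<omega>"
            unfolding b_def D_def by linarith
          have "\<omega> \<notin> seg n k j" using nb j by (auto simp: bad_def)
          then have "- Gam (b n k j) (D n k) \<omega> \<le> \<delta> k"
            using elim(4) by (simp add: seg_def \<delta>_def)
          then show "- Gam (t n + h * t n * real j / 2 ^ k) (h * t n / 2 ^ k) \<omega> \<le> \<delta> k"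
            by (simp add: b_def D_def)
        qed (use e0 \<delta>0 in simp)
        moreover have "- \<gamma> (t n) \<omega> \<le> t n powr s * (K' * N (l n))"
          using nb elim(4) by (auto simp: bad_def main_def)
        ultimately have "- \<gamma> (t n + h * t n * real j / 2 ^ k) \<omega> \<le> t n powr s * (K' * N (l n)) + t n powr s * (2 * \<eta> * N (l n))"
          using sums[of k] by simp
        also have "\<dots> = (K' + 2 * \<eta>) * (t n powr s * N (l n))" by (simp only: algebra_simps)
        also have "K' + 2 * \<eta> = K''" by (simp add: \<eta>_def field_simps)
        finally show ?thesis .
      qed
      \<comment> \<open>An arbitrary time is approached by dyadic ones from below; the bound does
        not depend on the level, so it passes to the limit by continuity of \<gamma>.\<close>
      define u where "u = (\<tau> - t n) / (h * t n)"
      have u: "0 \<le> u" "u \<le> 1" "\<tau> = t n + h * t n * u"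
        using \<tau> h tpos[of n] by (auto simp: u_def tSuc divide_le_eq_1)
      define j where "j k = nat \<lfloor>u * 2 ^ k\<rfloor>" for k :: nat
      have j: "j k \<le> 2 ^ k" "u - 1 / 2 ^ k \<le> real (j k) / 2 ^ k" "real (j k) / 2 ^ k \<le> u" for k
      proof -
        have f: "real (j k) = real_of_int \<lfloor>u * 2 ^ k\<rfloor>" using u by (simp add: j_def)
        then show "real (j k) / 2 ^ k \<le> u" by (simp add: divide_le_eq)
        also note u(2)
        finally have "real (j k) \<le> 2 ^ k" by (simp add: divide_le_eq)
        then show "j k \<le> 2 ^ k" by (metis of_nat_le_iff of_nat_numeral of_nat_power)
        have "u * 2 ^ k - 1 \<le> real (j k)" unfolding f by linarith
        then have "(u * 2 ^ k - 1) / 2 ^ k \<le> real (j k) / 2 ^ k" by (intro divide_right_mono) auto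
        then show "u - 1 / 2 ^ k \<le> real (j k) / 2 ^ k" by (simp add: diff_divide_distrib)
      qed
      have "(\<lambda>k. u - 1 / 2 ^ k) \<longlonglongrightarrow> u" by real_asymp
      then have "(\<lambda>k. real (j k) / 2 ^ k) \<longlonglongrightarrow> u"
        by (rule real_tendsto_sandwich[OF _ _ _ tendsto_const, rotated 2]) (auto simp: j)
      then have "(\<lambda>k. t n + h * t n * (real (j k) / 2 ^ k)) \<longlonglongrightarrow> \<tau>"
        unfolding u(3) by (intro tendsto_intros)
      then have "(\<lambda>k. \<gamma> (t n + h * t n * (real (j k) / 2 ^ k)) \<omega>) \<longlonglongrightarrow> \<gamma> \<tau> \<omega>"
        using h tpos[of n] \<tau> by (intro continuous_on_tendsto_compose[OF elim(3)]) (auto intro!: always_eventually add_nonneg_nonneg)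
      then have "(\<lambda>k. - \<gamma> (t n + h * t n * (real (j k) / 2 ^ k)) \<omega>) \<longlonglongrightarrow> - \<gamma> \<tau> \<omega>"
        by (rule tendsto_minus)
      then show ?thesis
        by (rule LIMSEQ_le_const2) (use dyadic j(1) in auto)
    qed
    define n2 where "n2 = max n0 n1"
    show ?case
      unfolding eventually_at_top_linorder
    proof (intro exI[of _ "t n2"] allI impI)
      fix \<tau> assume \<tau>: "t n2 \<le> \<tau>"
      have "\<exists>n. \<tau> < t n" using filterlim_at_top_dense[THEN iffD1, OF lim_t, rule_format, of \<tau>]
        by (auto simp: eventually_at_top_linorder)
      define m where "m = (LEAST n. \<tau> < t n)"
      have m: "\<tau> < t m" unfolding m_def using \<open>\<exists>n. \<tau> < t n\<close> by (rule LeastI_ex)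
      have tm: "t i \<le> t k" if "i \<le> k" for i k unfolding t_def using h that by (intro power_increasing) auto
      have "n2 < m" using m \<tau> tm[of m n2] by (meson not_le order_le_less_trans order_less_irrefl)
      then obtain n where n: "m = Suc n" "n2 \<le> n" by (cases m) auto
      have "t n \<le> \<tau>" using not_less_Least[of n "\<lambda>n. \<tau> < t n"] n(1) m_def by simp
      have "- \<gamma> \<tau> \<omega> \<le> K'' * (t n powr s * N (l n))"
        using block[of n \<tau>] n m \<open>t n \<le> \<tau>\<close> by (simp add: n2_def)
      also have "\<dots> \<le> K'' * (\<tau> powr s * N (ln (ln \<tau>)))"
      proof (intro mult_left_mono mult_mono)
        have n1: "1 \<le> n" "L0 \<le> l n" "1 \<le> N (l n)" using n0[of n] L1[of "l n"] n by (auto simp: n2_def)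
        then have "0 < ln (t n)" using h by (simp add: lnt)
        then have "l n \<le> ln (ln \<tau>)" unfolding l_def using \<open>t n \<le> \<tau>\<close> tpos[of n] by (intro ln_mono) auto
        then show "N (l n) \<le> N (ln (ln \<tau>))" using n1 by (intro N_mono)
        show "t n powr s \<le> \<tau> powr s" using \<open>t n \<le> \<tau>\<close> tpos[of n] s by (intro powr_mono2) auto
        show "0 \<le> N (l n)" using n1 by simp
      qed (use K K'' in auto)
      finally show "- \<gamma> \<tau> \<omega> \<le> K'' * (\<tau> powr (2 - \<alpha>) * N (ln (ln \<tau>)))" by (simp add: s_def)
    qed
  qed
qed

section \<open>Lower bound for -\<gamma> along a sparse sequence of times\<close>

lemma indep_segments_prob:
  fixes T :: "nat \<Rightarrow> real"
  assumes T: "0 \<le> T 0" "\<And>i. T i \<le> T (Suc i)" and B: "\<And>i. B i \<in> sets path_space"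
    and J: "finite J" "J \<noteq> {}"
  shows "prob (\<Inter>i\<in>J. path (T i) (T (Suc i) - T i) -` B i \<inter> space M) =
    (\<Prod>i\<in>J. prob (path (T i) (T (Suc i) - T i) -` B i \<inter> space M))"
proof -
  obtain m where "J \<subseteq> {..<m}" using J(1) by (metis finite_nat_iff_bounded)
  then show ?thesis
    using B J by (intro indep_varsD[OF indep_paths[OF T, of m]]) auto
qed

text \<open>The blocks from t n to t (n + 1) are independent, and each is exceptional with
  probability at least exp(-\<rho> ln ln t (n + 1)). With t n = exp(n^q) and q > 1 a block fills
  almost all of [0, t (n + 1)], while \<rho> q \<le> 1 keeps the probabilities above 1 / (n + 1).
  The past and its interaction with the block are negligible by Markov's inequality.\<close>

lemma LIL_lower:
  fixes N :: "real \<Rightarrow> real"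
  assumes N_lim: "filterlim N at_top at_top"
    and K: "0 < K''" "K'' < K'" and \<rho>: "\<rho> < 1"
    and tail: "eventually (\<lambda>L. exp (- \<rho> * L) \<le> tail (K' * N L)) at_top"
  shows "AE \<omega> in M. \<forall>T. \<exists>t\<ge>T. K'' * (t powr (2 - \<alpha>) * N (ln (ln t))) \<le> - \<gamma> t \<omega>"
proof -
  define s where "s = 2 - \<alpha>"
  have s: "1 / 2 < s" "s \<le> 1" using \<alpha>_bounds by (auto simp: s_def)
  have s2: "1 - \<alpha> / 2 = s / 2" by (simp add: s_def)
  obtain C where C: "0 \<le> C" and super: "\<And>b c. 0 < b \<Longrightarrow> b < c \<Longrightarrow>
     AE \<omega> in M. \<gamma> b \<omega> + Gam b (c - b) \<omega> - C * (b * (c - b)) powr (s / 2) \<le> \<gamma> c \<omega>"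
    using gamma_superadditive_powr unfolding s2 by blast
  \<comment> \<open>The maximum with 1/2 keeps q meaningful when \<rho> is not positive.\<close>
  define q where "q = 1 / max \<rho> (1 / 2)"
  have q: "1 < q" "\<rho> * q \<le> 1"
    using \<rho> by (auto simp: q_def divide_le_eq max_def)
  define t where "t n = exp (real n powr q)" for n :: nat
  have tpos: "0 < t n" for n by (simp add: t_def)
  \<comment> \<open>A lower bound for the gap of the exponents, which makes the ratio t n / t (n +
    1) at most exp(-(n^(q - 1))).\<close>
  have gap: "real n powr (q - 1) \<le> real (Suc n) powr q - real n powr q" for n
  proof (cases "n = 0")
    case False
    have "(real n + 1) * real n powr (q - 1) \<le> (real n + 1) * (real n + 1) powr (q - 1)"
      using q by (intro mult_left_mono powr_mono2) auto
    moreover have "real n * real n powr (q - 1) = real n powr q" "(real n + 1) * (real n + 1) powr (q - 1) = (real n + 1) powr q"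
      using False by (simp_all add: powr_mult_base)
    ultimately show ?thesis by (simp add: algebra_simps)
  qed simp
  have tmono: "t n < t (Suc n)" for n
    using q by (auto simp: t_def intro!: powr_less_mono2)
  define D where "D n = t (Suc n) - t n" for n
  have D: "0 < D n" for n using tmono by (simp add: D_def)
  define x where "x n = t n / t (Suc n)" for n
  have x: "0 < x n" "x n < 1" "x n \<le> exp (- (real n powr (q - 1)))" for n
  proof -
    show "0 < x n" "x n < 1" using tpos tmono by (auto simp: x_def)
    show "x n \<le> exp (- (real n powr (q - 1)))"
      using gap[of n] by (simp add: x_def t_def flip: exp_diff)
  qed
  have lt: "ln (ln (t (Suc n))) = q * ln (real (Suc n))" for n
    by (simp add: t_def ln_powr)
  define B where "B n = {w \<in> space path_law. K' * N (ln (ln (t (Suc n)))) \<le> - path_gamma w}" for n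
  have B: "B n \<in> sets path_space" for n
    unfolding B_def sets_path_law[symmetric] by measurable
  define A where "A n = path (t n) (D n) -` B n \<inter> space M" for n
  have pathm: "path (t n) (D n) \<in> M \<rightarrow>\<^sub>M path_space" for n
    using tpos[of n] D[of n] by (intro measurable_path) auto
  have A_ev: "A n \<in> events" for n
    unfolding A_def using pathm B by (rule measurable_sets)
  have A_prob: "prob (A n) = tail (K' * N (ln (ln (t (Suc n)))))" for n
  proof -
    have "prob (A n) = measure (distr M path_space (path (t n) (D n))) (B n)"
      unfolding A_def by (rule measure_distr[OF pathm B, symmetric])
    also have "distr M path_space (path (t n) (D n)) = path_law"
      using tpos[of n] D[of n] by (intro distr_path_law) auto
    finally show ?thesis by (simp add: tail_def B_def)
  qed
  have A_Gam: "D n powr s * (K' * N (ln (ln (t (Suc n))))) \<le> - Gam (t n) (D n) \<omega>" if "\<omega> \<in> A n" for n \<omega>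
  proof -
    have "K' * N (ln (ln (t (Suc n)))) \<le> - path_gamma (path (t n) (D n) \<omega>)"
      using that by (simp add: A_def B_def)
    then have "D n powr s * (K' * N (ln (ln (t (Suc n))))) \<le> D n powr s * (- path_gamma (path (t n) (D n) \<omega>))"
      by (rule mult_left_mono) simp
    then show ?thesis by (simp add: Gam_def s_def)
  qed
  have lim_l: "filterlim (\<lambda>n. ln (ln (t (Suc n)))) at_top sequentially"
    unfolding lt using q by real_asymp
  obtain n0 where n0: "\<And>n. n0 \<le> n \<Longrightarrow> exp (- \<rho> * ln (ln (t (Suc n)))) \<le> tail (K' * N (ln (ln (t (Suc n)))))"
    using eventually_compose_filterlim[OF tail lim_l] by (auto simp: eventually_at_top_linorder)
  have often: "AE \<omega> in M. \<forall>m. \<exists>n\<ge>m. \<omega> \<in> A n"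
  proof (rule infinitely_often_of_independent[OF A_ev])
    fix J :: "nat set" assume J: "finite J" "J \<noteq> {}"
    have compl: "space M - A n = path (t n) (t (Suc n) - t n) -` (space path_space - B n) \<inter> space M" for n
      unfolding A_def D_def[symmetric] using measurable_space[OF pathm] by blast
    show "prob (\<Inter>n\<in>J. space M - A n) = (\<Prod>n\<in>J. prob (space M - A n))"
      unfolding compl using J B tmono tpos
      by (intro indep_segments_prob) (auto intro: less_imp_le)
  next
    fix n assume n: "n0 \<le> n"
    have "1 / real (Suc n) \<le> exp (- \<rho> * (q * ln (real (Suc n))))"
    proof -
      have "\<rho> * q * ln (real (Suc n)) \<le> 1 * ln (real (Suc n))" using q by (intro mult_right_mono) auto
      then have "exp (- ln (real (Suc n))) \<le> exp (- \<rho> * (q * ln (real (Suc n))))" by simp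
      then show ?thesis by (simp add: exp_minus inverse_eq_divide del: of_nat_Suc)
    qed
    then show "1 / real (Suc n) \<le> prob (A n)"
      using n0[OF n] unfolding A_prob lt by linarith
  qed
  define e where "e n = C * (t n * D n) powr (s / 2)" for n
  \<comment> \<open>The interaction must now be bounded from above. The bracket in Z is almost
    surely nonnegative by superadditivity and has mean e n because \<gamma> and \<open>Gam\<close>
    are centred, so Markov's inequality applies without higher moments.\<close>
  define Z where "Z n \<omega> = \<bar>\<gamma> (t n) \<omega>\<bar> + (\<gamma> (t (Suc n)) \<omega> - \<gamma> (t n) \<omega> - Gam (t n) (D n) \<omega> + e n)" for n \<omega>
  define c0 where "c0 = path_law.expectation (\<lambda>w. \<bar>path_gamma w\<bar>)"
  have c0: "0 \<le> c0" unfolding c0_def by (intro integral_nonneg_AE) auto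
  have gi: "integrable M (\<gamma> (t n))" "expectation (\<gamma> (t n)) = 0" "expectation (\<lambda>\<omega>. \<bar>\<gamma> (t n) \<omega>\<bar>) = t n powr s * c0" for n
  proof -
    have [measurable]: "\<gamma> (t n) \<in> borel_measurable M" "Gam 0 (t n) \<in> borel_measurable M"
      using tpos[of n] by (auto intro: gamma_measurable measurable_Gam)
    note g = Gam_integrable[of 0 "t n"] Gam_expectation[of 0 "t n"] Gam_abs_expectation[of 0 "t n"]
    have ae: "AE \<omega> in M. Gam 0 (t n) \<omega> = \<gamma> (t n) \<omega>" using gamma_eq_Gam[OF tpos, of n] by eventually_elim simp
    show "integrable M (\<gamma> (t n))"
      using g(1) tpos[of n] by (intro integrable_cong_AE_imp[OF _ _ ae]) auto
    have "expectation (\<gamma> (t n)) = expectation (Gam 0 (t n))"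
      using ae by (intro integral_cong_AE) auto
    then show "expectation (\<gamma> (t n)) = 0" using g(2) tpos[of n] by simp
    have "expectation (\<lambda>\<omega>. \<bar>\<gamma> (t n) \<omega>\<bar>) = expectation (\<lambda>\<omega>. \<bar>Gam 0 (t n) \<omega>\<bar>)"
      using ae by (intro integral_cong_AE) auto
    then show "expectation (\<lambda>\<omega>. \<bar>\<gamma> (t n) \<omega>\<bar>) = t n powr s * c0"
      using g(3) tpos[of n] by (simp add: c0_def s_def)
  qed
  have Zi: "integrable M (Z n)" "expectation (Z n) = t n powr s * c0 + e n" for n
    using gi[of n] gi[of "Suc n"] Gam_integrable[of "t n" "D n"] Gam_expectation[of "t n" "D n"] tpos[of n] D[of n]
    by (simp_all add: Z_def[abs_def] prob_space)
  have Z0: "AE \<omega> in M. 0 \<le> Z n \<omega>" for n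
    using super[OF tpos tmono, of n] by eventually_elim (simp add: Z_def D_def e_def)
  define bad where "bad n = {\<omega> \<in> space M. t (Suc n) powr s \<le> Z n \<omega>}" for n
  have bad_ev: "bad n \<in> events" for n
    unfolding bad_def using borel_measurable_integrable[OF Zi(1)] by measurable
  have bad_prob: "prob (bad n) \<le> (c0 + C) * exp (- (s / 2) * real n powr (q - 1))" for n
  proof -
    have "prob (bad n) \<le> expectation (Z n) / t (Suc n) powr s"
    proof -
      have p: "0 < t (Suc n) powr s" by (simp add: t_def)
      show ?thesis
        unfolding bad_def by (rule integral_Markov_inequality_measure[OF Zi(1) sets.empty_sets Z0 p])
    qed
    also have "\<dots> = x n powr s * c0 + e n / t (Suc n) powr s"
      using tpos[of n] tpos[of "Suc n"] by (simp add: Zi(2) x_def powr_divide add_divide_distrib)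
    also have "\<dots> \<le> x n powr (s / 2) * c0 + C * x n powr (s / 2)"
    proof (rule add_mono)
      show "x n powr s * c0 \<le> x n powr (s / 2) * c0"
        using x[of n] s c0 by (intro mult_right_mono powr_mono') auto
      have "(t n * D n) powr (s / 2) \<le> (t n * t (Suc n)) powr (s / 2)"
        using s tpos[of n] D[of n] by (intro powr_mono2 mult_left_mono) (auto simp: D_def)
      also have "\<dots> = x n powr (s / 2) * t (Suc n) powr s"
        using tpos[of n] tpos[of "Suc n"] by (simp add: x_def powr_divide powr_mult powr_half_sqrt_powr field_simps flip: powr_add)
      finally have "e n \<le> C * (x n powr (s / 2) * t (Suc n) powr s)"
        unfolding e_def using C by (rule mult_left_mono)
      then show "e n / t (Suc n) powr s \<le> C * x n powr (s / 2)"
        using tpos[of "Suc n"] by (simp add: divide_le_eq mult.assoc)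
    qed
    also have "\<dots> = (c0 + C) * x n powr (s / 2)" by (simp add: algebra_simps)
    also have "\<dots> \<le> (c0 + C) * (exp (- (real n powr (q - 1)))) powr (s / 2)"
      using x[of n] s c0 C by (intro mult_left_mono powr_mono2) auto
    also have "(exp (- (real n powr (q - 1)))) powr (s / 2) = exp (- (s / 2) * real n powr (q - 1))"
      by (simp add: powr_def)
    finally show ?thesis .
  qed
  have not_bad: "AE \<omega> in M. eventually (\<lambda>n. \<omega> \<notin> bad n) sequentially"
  proof (rule eventually_not_of_summable)
    show "bad n \<in> events" for n by (rule bad_ev)
    show "prob (bad n) \<le> (c0 + C) * exp (- (s / 2) * real n powr (q - 1))" if "0 \<le> n" for n by (rule bad_prob)
    have "summable (\<lambda>n. exp (- (s / 2) * real n powr (q - 1)))"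
    proof (rule summable_comparison_test_ev)
      have "eventually (\<lambda>n::nat. exp (- (s / 2) * real n powr (q - 1)) \<le> real n powr (- 2)) sequentially"
        using s q by real_asymp
      then show "eventually (\<lambda>n. norm (exp (- (s / 2) * real n powr (q - 1))) \<le> real n powr (- 2)) sequentially" by simp
    qed (simp add: summable_real_powr_iff)
    then show "summable (\<lambda>n. (c0 + C) * exp (- (s / 2) * real n powr (q - 1)))" by (rule summable_mult)
  qed
  have super_all: "AE \<omega> in M. \<forall>n. 0 \<le> \<gamma> (t (Suc n)) \<omega> - \<gamma> (t n) \<omega> - Gam (t n) (D n) \<omega> + e n"
    unfolding AE_all_countable
  proof
    fix n show "AE \<omega> in M. 0 \<le> \<gamma> (t (Suc n)) \<omega> - \<gamma> (t n) \<omega> - Gam (t n) (D n) \<omega> + e n"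
      using super[OF tpos tmono, of n] by eventually_elim (simp add: D_def e_def)
  qed
  have e0: "0 \<le> e n" for n using C by (simp add: e_def)
  \<comment> \<open>Passing from K' to K3 pays for the block being slightly shorter than t (n + 1);
    passing from K3 to K'' pays for Z.\<close>
  define K3 where "K3 = (K' + K'') / 2"
  have K3: "K'' < K3" "K3 < K'" using K by (auto simp: K3_def)
  have x0: "x \<longlonglongrightarrow> 0"
  proof (rule tendsto_sandwich[OF _ _ tendsto_const])
    show "(\<lambda>n::nat. exp (- (real n powr (q - 1)))) \<longlonglongrightarrow> 0" using q by real_asymp
  qed (use x in \<open>auto intro!: always_eventually less_imp_le\<close>)
  have "(\<lambda>n. K' * (1 - x n) powr s) \<longlonglongrightarrow> K' * (1 - 0) powr s"
    by (intro tendsto_intros x0) simp_all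
  then have ev1: "eventually (\<lambda>n. K3 < K' * (1 - x n) powr s) sequentially"
    using K3 by (intro order_tendstoD(1)) auto
  have "filterlim (\<lambda>n. N (ln (ln (t (Suc n))))) at_top sequentially"
    by (rule filterlim_compose[OF N_lim lim_l])
  then have ev2: "eventually (\<lambda>n. max 0 (1 / (K3 - K'')) \<le> N (ln (ln (t (Suc n))))) sequentially"
    unfolding filterlim_at_top by blast
  have lim_t: "filterlim (\<lambda>n. t (Suc n)) at_top sequentially"
    unfolding t_def using q by real_asymp
  show ?thesis
    using not_bad super_all often AE_space
  proof eventually_elim
    case (elim \<omega>)
    show ?case
    proof
      fix T :: real
      have "eventually (\<lambda>n. \<omega> \<notin> bad n \<and> K3 < K' * (1 - x n) powr s \<and> max 0 (1 / (K3 - K'')) \<le> N (ln (ln (t (Suc n)))) \<and> T \<le> t (Suc n)) sequentially"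
        using elim(1) ev1 ev2 filterlim_at_top[THEN iffD1, OF lim_t, rule_format, of T] by eventually_elim simp
      then obtain m where m: "\<And>n. m \<le> n \<Longrightarrow> \<omega> \<notin> bad n \<and> K3 < K' * (1 - x n) powr s \<and> max 0 (1 / (K3 - K'')) \<le> N (ln (ln (t (Suc n)))) \<and> T \<le> t (Suc n)"
        by (auto simp: eventually_at_top_linorder)
      obtain n where n: "m \<le> n" "\<omega> \<in> A n" using elim(3) by blast
      let ?N = "N (ln (ln (t (Suc n))))"
      have N: "0 \<le> ?N" "1 \<le> (K3 - K'') * ?N"
      proof -
        have mx: "max 0 (1 / (K3 - K'')) \<le> ?N" using m[OF n(1)] by blast
        show "0 \<le> ?N" by (rule order_trans[OF max.cobounded1 mx])
        show "1 \<le> (K3 - K'') * ?N"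
          using order_trans[OF max.cobounded2 mx] K3 by (simp add: divide_le_eq mult.commute)
      qed
      have z: "Z n \<omega> < t (Suc n) powr s" using m[OF n(1)] elim(4) by (auto simp: bad_def)
      have "D n = t (Suc n) * (1 - x n)" using tpos[of "Suc n"] by (simp add: D_def x_def field_simps)
      then have "D n powr s = t (Suc n) powr s * (1 - x n) powr s"
        using tpos[of "Suc n"] x[of n] by (simp add: powr_mult)
      then have "t (Suc n) powr s * (K' * (1 - x n) powr s * ?N) \<le> - Gam (t n) (D n) \<omega>"
        using A_Gam[OF n(2)] by (simp add: mult_ac)
      moreover have "t (Suc n) powr s * (K3 * ?N) \<le> t (Suc n) powr s * (K' * (1 - x n) powr s * ?N)"
        using m[OF n(1)] N by (intro mult_left_mono mult_right_mono) auto
      moreover have "- Gam (t n) (D n) \<omega> \<le> - \<gamma> (t (Suc n)) \<omega> + Z n \<omega>"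
        using e0[of n] by (simp add: Z_def)
      ultimately have "t (Suc n) powr s * (K3 * ?N) - t (Suc n) powr s \<le> - \<gamma> (t (Suc n)) \<omega>"
        using z by linarith
      moreover have "K'' * (t (Suc n) powr s * ?N) \<le> t (Suc n) powr s * (K3 * ?N) - t (Suc n) powr s"
      proof -
        have "t (Suc n) powr s * 1 \<le> t (Suc n) powr s * ((K3 - K'') * ?N)"
          using N by (intro mult_left_mono) auto
        then show ?thesis by (simp add: algebra_simps)
      qed
      ultimately have "K'' * (t (Suc n) powr s * ?N) \<le> - \<gamma> (t (Suc n)) \<omega>" by linarith
      moreover have "T \<le> t (Suc n)" using m[OF n(1)] by simp
      ultimately show "\<exists>t\<ge>T. K'' * (t powr (2 - \<alpha>) * N (ln (ln t))) \<le> - \<gamma> t \<omega>"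
        unfolding s_def by blast
    qed
  qed
qed

text \<open>N is the iterated-logarithm factor as a function of L = ln ln t, and K is the level at
  which the tail at K' N(L) crosses exp(-L), the order 1/n along geometric times. Countably many K'
  approach K from either side.\<close>

lemma LIL:
  fixes N :: "real \<Rightarrow> real"
  assumes N_mono: "\<And>x y. L0 \<le> x \<Longrightarrow> x \<le> y \<Longrightarrow> N x \<le> N y"
    and N_sub: "\<And>c x. 1 \<le> c \<Longrightarrow> L0 \<le> x \<Longrightarrow> N (c * x) \<le> c * N x"
    and N_lim: "filterlim N at_top at_top"
    and K: "0 < K"
    and upper: "\<And>K'. K < K' \<Longrightarrow> \<exists>\<rho>>1. eventually (\<lambda>L. tail (K' * N L) \<le> exp (- \<rho> * L)) at_top"
    and lower: "\<And>K'. 0 < K' \<Longrightarrow> K' < K \<Longrightarrow> \<exists>\<rho><1. eventually (\<lambda>L. exp (- \<rho> * L) \<le> tail (K' * N L)) at_top"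
  shows "AE \<omega> in M. Liminf at_top (\<lambda>t. ereal (\<gamma> t \<omega> / (t powr (2 - \<alpha>) * N (ln (ln t))))) = ereal (- K)"
proof -
  define d where "d j = K / real (j + 2)" for j :: nat
  have d: "0 < d j" "d j < K" for j
    using K by (auto simp: d_def field_simps intro!: add_pos_nonneg)
  have d0: "d \<longlonglongrightarrow> 0" unfolding d_def by real_asymp
  have U: "AE \<omega> in M. \<forall>j. eventually (\<lambda>t. - \<gamma> t \<omega> \<le> (K + d j) * (t powr (2 - \<alpha>) * N (ln (ln t)))) at_top"
    unfolding AE_all_countable
  proof
    fix j
    have "K < K + d j / 2" using d[of j] by simp
    from upper[OF this] obtain \<rho> where "1 < \<rho>" "eventually (\<lambda>L. tail ((K + d j / 2) * N L) \<le> exp (- \<rho> * L)) at_top" by blast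
    then show "AE \<omega> in M. eventually (\<lambda>t. - \<gamma> t \<omega> \<le> (K + d j) * (t powr (2 - \<alpha>) * N (ln (ln t)))) at_top"
      using K d[of j] by (intro LIL_upper[OF N_mono N_sub N_lim, of _ "K + d j / 2" \<rho>]) auto
  qed
  have L: "AE \<omega> in M. \<forall>j T. \<exists>t\<ge>T. (K - d j) * (t powr (2 - \<alpha>) * N (ln (ln t))) \<le> - \<gamma> t \<omega>"
    unfolding AE_all_countable
  proof
    fix j
    have k: "0 < K - d j / 2" "K - d j / 2 < K" using d[of j] by auto
    from lower[OF this] obtain \<rho> where "\<rho> < 1" "eventually (\<lambda>L. exp (- \<rho> * L) \<le> tail ((K - d j / 2) * N L)) at_top" by blast
    then show "AE \<omega> in M. \<forall>T. \<exists>t\<ge>T. (K - d j) * (t powr (2 - \<alpha>) * N (ln (ln t))) \<le> - \<gamma> t \<omega>"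
      using K d[of j] by (intro LIL_lower[OF N_lim, of _ "K - d j / 2" \<rho>]) auto
  qed
  have "filterlim (\<lambda>t. N (ln (ln t))) at_top at_top"
    by (intro filterlim_compose[OF N_lim] filterlim_compose[OF ln_at_top ln_at_top])
  then have "eventually (\<lambda>t. 1 \<le> N (ln (ln t))) at_top" by (simp add: filterlim_at_top)
  then have pos: "eventually (\<lambda>t. 0 < t powr (2 - \<alpha>) * N (ln (ln t))) at_top"
    using eventually_gt_at_top[of 0] by eventually_elim simp
  show ?thesis
    using U L
  proof eventually_elim
    case (elim \<omega>)
    let ?R = "\<lambda>t. \<gamma> t \<omega> / (t powr (2 - \<alpha>) * N (ln (ln t)))"
    let ?L = "Liminf at_top (\<lambda>t. ereal (?R t))"
    have "ereal (- K - d j) \<le> ?L" for j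
    proof (rule Liminf_bounded)
      show "eventually (\<lambda>t. ereal (- K - d j) \<le> ereal (?R t)) at_top"
        using elim(1)[rule_format, of j] pos
      proof eventually_elim
        case (elim t)
        have "(- K - d j) * (t powr (2 - \<alpha>) * N (ln (ln t))) = - ((K + d j) * (t powr (2 - \<alpha>) * N (ln (ln t))))"
          by (simp only: algebra_simps)
        also have "\<dots> \<le> \<gamma> t \<omega>" using elim(1) by linarith
        finally show ?case using elim(2) by (simp only: ereal_less_eq pos_le_divide_eq)
      qed
    qed
    moreover have "(\<lambda>j. ereal (- K - d j)) \<longlonglongrightarrow> ereal (- K - 0)"
      by (intro tendsto_intros d0)
    ultimately have "ereal (- K) \<le> ?L"
      by (intro LIMSEQ_le_const2[of "\<lambda>j. ereal (- K - d j)"]) auto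
    moreover have "?L \<le> ereal (- K + d j)" for j
    proof (rule ccontr)
      assume "\<not> ?L \<le> ereal (- K + d j)"
      then have "ereal (- K + d j) < ?L" by simp
      then have "eventually (\<lambda>t. ereal (- K + d j) < ereal (?R t)) at_top" by (rule less_LiminfD)
      then have "eventually (\<lambda>t. (- K + d j) * (t powr (2 - \<alpha>) * N (ln (ln t))) < \<gamma> t \<omega>) at_top"
        using pos by eventually_elim (simp add: pos_less_divide_eq)
      then obtain T where "\<And>t. T \<le> t \<Longrightarrow> (- K + d j) * (t powr (2 - \<alpha>) * N (ln (ln t))) < \<gamma> t \<omega>"
        by (auto simp: eventually_at_top_linorder)
      moreover obtain t where "T \<le> t" "(K - d j) * (t powr (2 - \<alpha>) * N (ln (ln t))) \<le> - \<gamma> t \<omega>"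
        using elim(2) by blast
      ultimately show False by (fastforce simp: algebra_simps)
    qed
    moreover have "(\<lambda>j. ereal (- K + d j)) \<longlonglongrightarrow> ereal (- K + 0)"
      by (intro tendsto_intros d0)
    ultimately have "?L \<le> ereal (- K)"
      by (intro LIMSEQ_le_const[of "\<lambda>j. ereal (- K + d j)"]) auto
    with \<open>ereal (- K) \<le> ?L\<close> show ?case by (rule antisym[rotated])
  qed
qed

end

section \<open>The subcritical case\<close>

context silt
begin

text \<open>By scaling, P(-\<gamma> t \<ge> t) is the tail at t^a with a = \<alpha> - 1, so tail (K'
  L^a) decays like exp(-b K'^(1/a) L). The coefficient b K'^(1/a) equals 1 exactly at K' =
  b^(-a).\<close>

lemma LIL_subcritical:
  assumes sub: "\<beta> < real DIM('a)" and b: "0 < b"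
    and lim: "((\<lambda>t. (1 / t) * ln (measure M {\<omega> \<in> space M. - \<gamma> t \<omega> \<ge> t})) \<longlongrightarrow> - b) at_top"
  shows "AE \<omega> in M. Liminf at_top (\<lambda>t. ereal (\<gamma> t \<omega> / (t powr (2 - \<alpha>) * ln (ln t) powr (\<alpha> - 1)))) = ereal (- (b powr (- (\<alpha> - 1))))"
proof -
  define a where "a = \<alpha> - 1"
  have a: "0 < a" "a < 1"
    using sub order_pos \<alpha>_bounds by (auto simp: a_def \<alpha>_def field_simps)
  have scale: "prob {\<omega> \<in> space M. - \<gamma> t \<omega> \<ge> t} = tail (t powr a)" if "0 < t" for t
  proof -
    have "t powr (2 - \<alpha>) * t powr a = t" using that by (simp add: a_def flip: powr_add)
    then show ?thesis using prob_gamma[OF that, of "t powr a"] by simp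
  qed
  text \<open>Substituting \<open>t = K' powr (1 / a) * L\<close> turns the assumed asymptotics into bounds for the tail at \<open>K' * L powr a\<close>.\<close>
  have tail_eq: "tail (K' * L powr a) = prob {\<omega> \<in> space M. - \<gamma> (K' powr (1 / a) * L) \<omega> \<ge> K' powr (1 / a) * L}"
    if "0 < K'" "0 < L" for K' L
    using that a by (subst scale) (simp_all add: powr_mult powr_powr)
  have rate: "((\<lambda>L. (1 / (K' powr (1 / a) * L)) * ln (tail (K' * L powr a))) \<longlongrightarrow> - b) at_top" if K': "0 < K'" for K'
  proof -
    have "filterlim (\<lambda>L. K' powr (1 / a) * L) at_top at_top"
      using K' by (intro filterlim_tendsto_pos_mult_at_top[OF tendsto_const]) (auto intro: filterlim_ident)
    from filterlim_compose[OF lim this]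
    show ?thesis
    proof (rule Lim_transform_eventually)
      show "eventually (\<lambda>L. 1 / (K' powr (1 / a) * L) * ln (prob {\<omega> \<in> space M. K' powr (1 / a) * L \<le> - \<gamma> (K' powr (1 / a) * L) \<omega>})
          = (1 / (K' powr (1 / a) * L)) * ln (tail (K' * L powr a))) at_top"
        using eventually_gt_at_top[of 0] by eventually_elim (simp add: tail_eq K')
    qed
  qed
  \<comment> \<open>Since \<open>ln 0 = 0\<close>, a vanishing tail would make the quotient 0, which
    the negative limit excludes; after that the logarithm can be inverted.\<close>
  have tail_pos: "eventually (\<lambda>L. 0 < tail (K' * L powr a)) at_top" if K': "0 < K'" for K'
  proof -
    have "eventually (\<lambda>L. (1 / (K' powr (1 / a) * L)) * ln (tail (K' * L powr a)) < 0) at_top"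
      using rate[OF K'] b by (intro order_tendstoD(2)) auto
    then show ?thesis
    proof eventually_elim
      case (elim L)
      then have "tail (K' * L powr a) \<noteq> 0" by auto
      then show ?case unfolding tail_def by (simp only: zero_less_measure_iff not_False_eq_True)
    qed
  qed
  define K where "K = b powr (- a)"
  have K: "0 < K" using b by (simp add: K_def)
  have Kb: "b * K powr (1 / a) = 1"
  proof -
    have "K powr (1 / a) = b powr (- a * (1 / a))" unfolding K_def by (rule powr_powr)
    also have "- a * (1 / a) = - 1" using a by simp
    finally show ?thesis using b by (simp add: powr_minus_divide)
  qed
  have "AE \<omega> in M. Liminf at_top (\<lambda>t. ereal (\<gamma> t \<omega> / (t powr (2 - \<alpha>) * ln (ln t) powr a))) = ereal (- K)"
  proof (rule LIL[where ?L0.0 = 1])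
    show "x powr a \<le> y powr a" if "1 \<le> x" "x \<le> y" for x y :: real
      using that a by (intro powr_mono2) auto
    show "(c * x) powr a \<le> c * x powr a" if "1 \<le> c" "1 \<le> x" for c x :: real
    proof -
      have "c powr a \<le> c powr 1" using that a by (intro powr_mono) auto
      then show ?thesis using that by (simp add: powr_mult mult_right_mono)
    qed
    show "filterlim (\<lambda>x::real. x powr a) at_top at_top" using a by real_asymp
    show "0 < K" by (rule K)
    fix K' :: real
    show "\<exists>\<rho>>1. eventually (\<lambda>L. tail (K' * L powr a) \<le> exp (- \<rho> * L)) at_top" if "K < K'"
    proof -
      have K': "0 < K'" using K that by simp
      define k where "k = K' powr (1 / a)"
      have k: "0 < k" using K' by (simp add: k_def)
      have bk: "1 < b * k"
      proof -
        have "b * K powr (1 / a) < b * k" unfolding k_def using a b K that by (intro mult_strict_left_mono powr_less_mono2) auto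
        then show ?thesis using Kb by simp
      qed
      define \<rho> where "\<rho> = (1 + b * k) / 2"
      have \<rho>: "1 < \<rho>" "\<rho> < b * k" using bk by (auto simp: \<rho>_def)
      have "- b < - \<rho> / k" using \<rho> k by (simp add: field_simps)
      then have "eventually (\<lambda>L. (1 / (k * L)) * ln (tail (K' * L powr a)) < - \<rho> / k) at_top"
        using rate[OF K'] unfolding k_def by (rule order_tendstoD(2)[rotated])
      then have "eventually (\<lambda>L. tail (K' * L powr a) \<le> exp (- \<rho> * L)) at_top"
        using tail_pos[OF K'] eventually_gt_at_top[of 0]
      proof eventually_elim
        case (elim L)
        then have "ln (tail (K' * L powr a)) \<le> - \<rho> * L" using k by (simp add: field_simps)
        then show ?case using elim(2) by (metis exp_le_cancel_iff exp_ln)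
      qed
      then show ?thesis using \<rho> by blast
    qed
    show "\<exists>\<rho><1. eventually (\<lambda>L. exp (- \<rho> * L) \<le> tail (K' * L powr a)) at_top" if K': "0 < K'" "K' < K"
    proof -
      define k where "k = K' powr (1 / a)"
      have k: "0 < k" using K' by (simp add: k_def)
      have bk: "b * k < 1"
      proof -
        have "b * k < b * K powr (1 / a)" unfolding k_def using a b K' by (intro mult_strict_left_mono powr_less_mono2) auto
        then show ?thesis using Kb by simp
      qed
      define \<rho> where "\<rho> = (1 + b * k) / 2"
      have \<rho>: "\<rho> < 1" "b * k < \<rho>" using bk by (auto simp: \<rho>_def)
      have "- \<rho> / k < - b" using \<rho> k by (simp add: field_simps)
      then have "eventually (\<lambda>L. - \<rho> / k < (1 / (k * L)) * ln (tail (K' * L powr a))) at_top"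
        using rate[OF K'(1)] unfolding k_def by (rule order_tendstoD(1)[rotated])
      then have "eventually (\<lambda>L. exp (- \<rho> * L) \<le> tail (K' * L powr a)) at_top"
        using tail_pos[OF K'(1)] eventually_gt_at_top[of 0]
      proof eventually_elim
        case (elim L)
        then have "- \<rho> * L \<le> ln (tail (K' * L powr a))" using k by (simp add: field_simps)
        then show ?case using elim(2) by (metis exp_le_cancel_iff exp_ln)
      qed
      then show ?thesis using \<rho> by blast
    qed
  qed
  then show ?thesis by (simp add: K_def a_def)
qed

end

section \<open>The critical case: upper tail\<close>

context silt
begin

lemma tail_eq_gamma_nat:
  assumes "\<alpha> = 1" "0 < n"
  shows "prob {\<omega> \<in> space M. real n * y \<le> - \<gamma> (real n) \<omega>} = tail y"
  using prob_gamma[of "real n" y] assms by simp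

text \<open>Adding unit segments one at a time costs \<kappa> (4 + ln i) of mean interaction at step
  i, and each of these costs is at most \<kappa> (4 + ln n).\<close>

lemma gamma_nat_lower:
  assumes \<kappa>: "density_bound \<kappa>" and \<alpha>: "\<alpha> = 1"
  shows "1 \<le> n \<Longrightarrow> AE \<omega> in M. - \<gamma> (real n) \<omega> \<le> (\<Sum>i<n. - Gam (real i) 1 \<omega>) + \<kappa> * real n * (4 + ln (real n))"
proof (induction n rule: nat_induct_at_least)
  case base
  have "0 \<le> \<kappa>" using \<kappa> by (simp add: density_bound_def)
  then show ?case using gamma_eq_Gam[of 1] by (auto elim!: eventually_mono)
next
  case (Suc n)
  have k: "0 \<le> \<kappa>" using \<kappa> by (simp add: density_bound_def)
  have "AE \<omega> in M. \<gamma> (real n) \<omega> + Gam (real n) (real n + 1 - real n) \<omega> - \<kappa> * (4 + ln (real n)) \<le> \<gamma> (real n + 1) \<omega>"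
    using Suc.hyps by (intro gamma_superadditive expectation_occ_rect_unit_le \<kappa> \<alpha>) auto
  then show ?case
    using Suc.IH
  proof eventually_elim
    case (elim \<omega>)
    have "(real n + 1) * (4 + ln (real n)) \<le> (real n + 1) * (4 + ln (real n + 1))"
      using Suc.hyps by (intro mult_left_mono add_left_mono ln_mono) auto
    from mult_left_mono[OF this k] have "\<kappa> * real n * (4 + ln (real n)) + \<kappa> * (4 + ln (real n)) \<le> \<kappa> * (real n + 1) * (4 + ln (real n + 1))"
      by (simp add: algebra_simps)
    then show ?case using elim by (simp add: add.commute)
  qed
qed

lemma Gam_unit: "Gam a 1 \<omega> = path_gamma (path a 1 \<omega>)"
  by (simp add: Gam_def)

lemma indep_unit_paths: "indep_vars (\<lambda>_. path_space) (\<lambda>i. path (real i) 1) {..<m::nat}"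
  using indep_paths[of real m] by simp

text \<open>For \<alpha> = 1 the variable \<gamma> n has the law of n times \<gamma> 1. So the tail
  of one variable is bounded by that of an average of n independent copies, at a threshold lowered
  by \<kappa> (4 + ln n).\<close>

lemma tail_le_sum:
  assumes \<kappa>: "density_bound \<kappa>" and \<alpha>: "\<alpha> = 1" and n: "1 \<le> n"
  shows "tail y \<le> prob {\<omega> \<in> space M. real n * (y - \<kappa> * (4 + ln (real n))) \<le> (\<Sum>i<n. - Gam (real i) 1 \<omega>)}"
proof -
  have [measurable]: "Gam (real i) 1 \<in> borel_measurable M" for i by (rule measurable_Gam) auto
  have [measurable]: "\<gamma> (real n) \<in> borel_measurable M" by (rule gamma_measurable) simp
  have "tail y = prob {\<omega> \<in> space M. real n * y \<le> - \<gamma> (real n) \<omega>}"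
    using tail_eq_gamma_nat[OF \<alpha>, of n y] n by simp
  also have "\<dots> \<le> prob {\<omega> \<in> space M. real n * (y - \<kappa> * (4 + ln (real n))) \<le> (\<Sum>i<n. - Gam (real i) 1 \<omega>)}"
  proof (rule finite_measure_mono_AE)
    show "AE \<omega> in M. \<omega> \<in> {\<omega> \<in> space M. real n * y \<le> - \<gamma> (real n) \<omega>} \<longrightarrow>
      \<omega> \<in> {\<omega> \<in> space M. real n * (y - \<kappa> * (4 + ln (real n))) \<le> (\<Sum>i<n. - Gam (real i) 1 \<omega>)}"
      using gamma_nat_lower[OF \<kappa> \<alpha> n]
    proof eventually_elim
      case (elim \<omega>)
      show ?case
      proof (intro impI CollectI conjI)
        assume a: "\<omega> \<in> {\<omega> \<in> space M. real n * y \<le> - \<gamma> (real n) \<omega>}"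
        then show "\<omega> \<in> space M" by simp
        have "real n * (y - \<kappa> * (4 + ln (real n))) = real n * y - \<kappa> * real n * (4 + ln (real n))"
          by (simp only: algebra_simps)
        then show "real n * (y - \<kappa> * (4 + ln (real n))) \<le> (\<Sum>i<n. - Gam (real i) 1 \<omega>)"
          using a elim by simp
      qed
    qed
  qed measurable
  finally show ?thesis .
qed

text \<open>Independent centred summands are orthogonal, so their variances add.\<close>

lemma Gam_sum_square:
  "integrable M (\<lambda>\<omega>. (\<Sum>i<n. - Gam (real i) 1 \<omega>)\<^sup>2)"
  "expectation (\<lambda>\<omega>. (\<Sum>i<n. - Gam (real i) 1 \<omega>)\<^sup>2) = real n * path_law.expectation (\<lambda>w. (path_gamma w)\<^sup>2)"
proof -
  define v where "v = path_law.expectation (\<lambda>w. (path_gamma w)\<^sup>2)"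
  define \<xi> where "\<xi> i \<omega> = - Gam (real i) 1 \<omega>" for i \<omega>
  have i1: "integrable M (\<xi> i)" "expectation (\<xi> i) = 0" for i
    unfolding \<xi>_def[abs_def] using Gam_integrable[of "real i" 1] Gam_expectation[of "real i" 1] by auto
  have i2: "integrable M (\<lambda>\<omega>. (\<xi> i \<omega>)\<^sup>2)" for i
    unfolding \<xi>_def using Gam_square_integrable[of "real i" 1] by simp
  have e2: "expectation (\<lambda>\<omega>. (\<xi> i \<omega>)\<^sup>2) = v" for i
  proof -
    have "(\<lambda>w. (path_gamma w)\<^sup>2) \<in> borel_measurable path_space" by measurable
    from integral_path_law(1)[OF _ _ this, of "real i" 1] show ?thesis
      by (simp add: \<xi>_def Gam_unit v_def)
  qed
  have cross: "integrable M (\<lambda>\<omega>. \<xi> i \<omega> * \<xi> j \<omega>)" "expectation (\<lambda>\<omega>. \<xi> i \<omega> * \<xi> j \<omega>) = 0" if "i < j" for i j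
  proof -
    have "indep_vars (\<lambda>_. borel) (\<lambda>k \<omega>. - path_gamma (path (real k) 1 \<omega>)) {..<Suc j}"
      by (rule indep_vars_compose2[OF indep_unit_paths]) measurable
    then have "indep_vars (\<lambda>_. borel) \<xi> {..<Suc j}" by (simp add: \<xi>_def[abs_def] Gam_unit)
    then have ind: "indep_vars (\<lambda>_. borel) \<xi> {i, j}"
      by (rule indep_vars_subset) (use that in auto)
    have "(\<Prod>k\<in>{i, j}. \<xi> k \<omega>) = \<xi> i \<omega> * \<xi> j \<omega>" for \<omega> using that by simp
    then show "integrable M (\<lambda>\<omega>. \<xi> i \<omega> * \<xi> j \<omega>)" "expectation (\<lambda>\<omega>. \<xi> i \<omega> * \<xi> j \<omega>) = 0"
      using indep_vars_integrable[OF _ ind i1(1)] indep_vars_lebesgue_integral[OF _ ind i1(1)] i1(2) that by simp_all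
  qed
  have "integrable M (\<lambda>\<omega>. (\<Sum>i<n. \<xi> i \<omega>)\<^sup>2) \<and> expectation (\<lambda>\<omega>. (\<Sum>i<n. \<xi> i \<omega>)\<^sup>2) = real n * v"
  proof (induction n)
    case (Suc n)
    have eq: "(\<Sum>i<Suc n. \<xi> i \<omega>)\<^sup>2 = (\<Sum>i<n. \<xi> i \<omega>)\<^sup>2 + (2 * (\<Sum>i<n. \<xi> i \<omega> * \<xi> n \<omega>) + (\<xi> n \<omega>)\<^sup>2)" for \<omega>
    proof -
      have "(\<Sum>i<n. \<xi> i \<omega>) * \<xi> n \<omega> = (\<Sum>i<n. \<xi> i \<omega> * \<xi> n \<omega>)" by (rule sum_distrib_right)
      then show ?thesis by (simp add: power2_sum mult.assoc)
    qed
    have c: "integrable M (\<lambda>\<omega>. \<Sum>i<n. \<xi> i \<omega> * \<xi> n \<omega>)" "expectation (\<lambda>\<omega>. \<Sum>i<n. \<xi> i \<omega> * \<xi> n \<omega>) = 0"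
      using cross by (auto intro!: Bochner_Integration.integrable_sum simp: Bochner_Integration.integral_sum)
    show ?case
      unfolding eq using Suc c i2 e2 by (simp add: algebra_simps)
  qed simp
  then show "integrable M (\<lambda>\<omega>. (\<Sum>i<n. - Gam (real i) 1 \<omega>)\<^sup>2)"
    "expectation (\<lambda>\<omega>. (\<Sum>i<n. - Gam (real i) 1 \<omega>)\<^sup>2) = real n * path_law.expectation (\<lambda>w. (path_gamma w)\<^sup>2)"
    by (simp_all add: \<xi>_def v_def)
qed

text \<open>Averaging over about \<open>exp (y / (2 * \<kappa>))\<close> independent copies costs only \<open>y / 2\<close> in the threshold,
  so Chebyshev's inequality already yields an exponential tail.\<close>

lemma tail_exponential:
  assumes \<kappa>: "density_bound \<kappa>" and \<alpha>: "\<alpha> = 1"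
  shows "\<exists>C>0. \<forall>y\<ge>0. tail y \<le> C * exp (- y / (2 * \<kappa>))"
proof -
  have k: "0 < \<kappa>" by (rule density_bound_pos[OF \<kappa>])
  define v where "v = path_law.expectation (\<lambda>w. (path_gamma w)\<^sup>2)"
  have v: "0 \<le> v" unfolding v_def by (intro integral_nonneg_AE) auto
  \<comment> \<open>From y1 on, y / 2 - 4 \<kappa> is at least 1, so the lowered threshold z is
    too.\<close>
  define y1 where "y1 = 8 * \<kappa> + 2"
  have large: "tail y \<le> 2 * v * exp (- y / (2 * \<kappa>))" if y: "y1 \<le> y" for y
  proof -
    define n where "n = nat \<lfloor>exp (y / (2 * \<kappa>))\<rfloor>"
    have "1 \<le> exp (y / (2 * \<kappa>))" using y k by (simp add: y1_def)
    then have fl: "1 \<le> \<lfloor>exp (y / (2 * \<kappa>))\<rfloor>" by linarith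
    then have nf: "real n = real_of_int \<lfloor>exp (y / (2 * \<kappa>))\<rfloor>" by (simp add: n_def)
    have "1 \<le> real n" using fl unfolding nf by linarith
    then have n: "1 \<le> n" by simp
    have n2: "real n \<le> exp (y / (2 * \<kappa>))" "exp (y / (2 * \<kappa>)) \<le> 2 * real n"
      using fl unfolding nf by linarith+
    note n = n n2
    define z where "z = y - \<kappa> * (4 + ln (real n))"
    have "ln (real n) \<le> y / (2 * \<kappa>)" using n by (metis exp_gt_zero ln_exp ln_mono of_nat_0_less_iff order_less_le_trans zero_less_one)
    then have "\<kappa> * ln (real n) \<le> \<kappa> * (y / (2 * \<kappa>))" using k by (intro mult_left_mono) auto
    also have "\<dots> = y / 2" using k by simp
    finally have z: "1 \<le> z" using y by (simp add: z_def y1_def algebra_simps)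
    have nz: "0 < real n * z" using n z by (intro mult_pos_pos) auto
    have "tail y \<le> prob {\<omega> \<in> space M. real n * z \<le> (\<Sum>i<n. - Gam (real i) 1 \<omega>)}"
      unfolding z_def by (rule tail_le_sum[OF \<kappa> \<alpha> n(1)])
    also have "\<dots> \<le> prob {\<omega> \<in> space M. (real n * z)\<^sup>2 \<le> (\<Sum>i<n. - Gam (real i) 1 \<omega>)\<^sup>2}"
    proof (rule finite_measure_mono)
      have [measurable]: "(\<lambda>\<omega>. (\<Sum>i<n. - Gam (real i) 1 \<omega>)\<^sup>2) \<in> borel_measurable M"
        using Gam_sum_square(1)[of n] by (rule borel_measurable_integrable)
      show "{\<omega> \<in> space M. (real n * z)\<^sup>2 \<le> (\<Sum>i<n. - Gam (real i) 1 \<omega>)\<^sup>2} \<in> events" by measurable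
      show "{\<omega> \<in> space M. real n * z \<le> (\<Sum>i<n. - Gam (real i) 1 \<omega>)} \<subseteq> {\<omega> \<in> space M. (real n * z)\<^sup>2 \<le> (\<Sum>i<n. - Gam (real i) 1 \<omega>)\<^sup>2}"
        using power_mono[of "real n * z" _ 2] nz by (intro Collect_mono) (blast intro: less_imp_le)
    qed
    also have "\<dots> \<le> expectation (\<lambda>\<omega>. (\<Sum>i<n. - Gam (real i) 1 \<omega>)\<^sup>2) / (real n * z)\<^sup>2"
      by (rule integral_Markov_inequality_measure[OF Gam_sum_square(1) sets.empty_sets _ zero_less_power[OF nz]]) simp
    also have "\<dots> = v / (real n * z\<^sup>2)"
      unfolding Gam_sum_square(2) v_def[symmetric] using n by (simp add: power2_eq_square)
    also have "\<dots> \<le> v / (real n * 1)"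
      using v n z by (intro divide_left_mono mult_left_mono) (auto simp: one_le_power)
    also have "\<dots> \<le> v / (exp (y / (2 * \<kappa>)) / 2)"
      using v n by (intro divide_left_mono) auto
    also have "\<dots> = 2 * v * exp (- y / (2 * \<kappa>))"
    proof -
      have "exp (- y / (2 * \<kappa>)) = inverse (exp (y / (2 * \<kappa>)))"
        by (simp only: minus_divide_left[symmetric] exp_minus)
      moreover have "v / (E / 2) = 2 * v * inverse E" for E :: real by (metis (no_types, opaque_lifting) divide_divide_eq_right divide_inverse mult.commute)
      ultimately show ?thesis by (simp only:)
    qed
    finally show ?thesis .
  qed
  define C where "C = 2 * v + exp (y1 / (2 * \<kappa>))"
  have "tail y \<le> C * exp (- y / (2 * \<kappa>))" if "0 \<le> y" for y
  proof (cases "y1 \<le> y")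
    case True
    have "2 * v * exp (- y / (2 * \<kappa>)) \<le> C * exp (- y / (2 * \<kappa>))"
      by (intro mult_right_mono) (auto simp: C_def)
    then show ?thesis using large[OF True] by linarith
  next
    case False
    have "tail y \<le> 1" unfolding tail_def by (rule path_law.prob_le_1)
    also have "1 \<le> exp (y1 / (2 * \<kappa>)) * exp (- y / (2 * \<kappa>))"
      using False k by (simp add: divide_right_mono flip: exp_add diff_divide_distrib)
    also have "\<dots> \<le> C * exp (- y / (2 * \<kappa>))" using v by (intro mult_right_mono) (auto simp: C_def)
    finally show ?thesis .
  qed
  moreover have "0 < C" using v by (simp add: C_def add_nonneg_pos)
  ultimately show ?thesis by blast
qed

text \<open>Half of the exponential rate is spent: with l = 1 / (4 \<kappa>) the layer where
  \<open>- path_gamma\<close> lies in [j, j + 1] contributes at most C exp(l) exp(-l j), a geometric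
  series.\<close>

lemma exponential_moment:
  assumes \<kappa>: "density_bound \<kappa>" and \<alpha>: "\<alpha> = 1"
  shows "integrable path_law (\<lambda>w. exp (- path_gamma w / (4 * \<kappa>)))"
proof (rule integrableI_nonneg)
  have k: "0 < \<kappa>" by (rule density_bound_pos[OF \<kappa>])
  define l where "l = 1 / (4 * \<kappa>)"
  have l: "0 < l" using k by (simp add: l_def)
  obtain C where C: "0 < C" "\<And>y. 0 \<le> y \<Longrightarrow> tail y \<le> C * exp (- y / (2 * \<kappa>))"
    using tail_exponential[OF \<kappa> \<alpha>] by blast
  define E where "E j = {w \<in> space path_law. real j \<le> - path_gamma w}" for j
  have E [measurable]: "E j \<in> sets path_law" for j unfolding E_def by measurable
  have pt: "ennreal (exp (- path_gamma w / (4 * \<kappa>))) \<le> 1 + (\<Sum>j. ennreal (exp (l * (real j + 1))) * indicator (E j) w)"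
    if w: "w \<in> space path_law" for w
  proof (cases "0 \<le> - path_gamma w")
    case True
    define j where "j = nat \<lfloor>- path_gamma w\<rfloor>"
    have j: "real j \<le> - path_gamma w" "- path_gamma w \<le> real j + 1" using True unfolding j_def by linarith+
    have "- path_gamma w / (4 * \<kappa>) \<le> l * (real j + 1)"
      using j(2) l mult_left_mono[OF j(2), of l] by (simp add: l_def)
    then have "ennreal (exp (- path_gamma w / (4 * \<kappa>))) \<le> ennreal (exp (l * (real j + 1))) * indicator (E j) w"
      using j(1) w by (simp add: E_def ennreal_leI)
    also have "\<dots> \<le> (\<Sum>i. ennreal (exp (l * (real i + 1))) * indicator (E i) w)"
    proof -
      define g where "g i = ennreal (exp (l * (real i + 1))) * indicator (E i) w" for i
      have "g j = sum g {j}" by simp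
      also have "\<dots> \<le> suminf g" by (rule sum_le_suminf) auto
      finally have "g j \<le> suminf g" .
      then show ?thesis unfolding g_def .
    qed
    finally show ?thesis by (rule order_trans) simp
  next
    case False
    then have "exp (- path_gamma w / (4 * \<kappa>)) \<le> 1" using k by (simp add: divide_le_0_iff)
    then have "ennreal (exp (- path_gamma w / (4 * \<kappa>))) \<le> 1" by (metis ennreal_1 ennreal_leI)
    then show ?thesis by (rule order_trans) simp
  qed
  have "(\<integral>\<^sup>+w. ennreal (exp (- path_gamma w / (4 * \<kappa>))) \<partial>path_law) \<le> (\<integral>\<^sup>+w. 1 + (\<Sum>j. ennreal (exp (l * (real j + 1))) * indicator (E j) w) \<partial>path_law)"
    by (intro nn_integral_mono pt)
  also have "\<dots> = 1 + (\<Sum>j. ennreal (exp (l * (real j + 1))) * emeasure path_law (E j))"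
  proof -
    have "integral\<^sup>N path_law (indicator (E j)) = emeasure path_law (E j)" for j
      by (rule nn_integral_indicator[OF E])
    then show ?thesis
      by (simp add: nn_integral_add nn_integral_suminf nn_integral_cmult path_law.emeasure_space_1)
  qed
  also have "\<dots> \<le> 1 + (\<Sum>j. ennreal (C * exp l * exp (- l) ^ j))"
  proof (intro add_left_mono suminf_le)
    fix j :: nat
    have "emeasure path_law (E j) = ennreal (tail (real j))" by (simp add: E_def tail_def path_law.emeasure_eq_measure)
    also have "\<dots> \<le> ennreal (C * exp (- real j / (2 * \<kappa>)))" by (intro ennreal_leI C(2) of_nat_0_le_iff)
    finally have "ennreal (exp (l * (real j + 1))) * emeasure path_law (E j) \<le> ennreal (exp (l * (real j + 1))) * ennreal (C * exp (- real j / (2 * \<kappa>)))"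
      by (intro mult_left_mono) auto
    also have "\<dots> = ennreal (C * exp l * exp (- l) ^ j)"
    proof -
      have "- real j / (2 * \<kappa>) = - (2 * l * real j)" using k by (simp add: l_def)
      then have "exp (l * (real j + 1)) * (C * exp (- real j / (2 * \<kappa>))) = C * exp l * exp (- l) ^ j"
        by (simp add: exp_of_nat_mult[symmetric] exp_add[symmetric] algebra_simps)
      then show ?thesis using C(1) by (simp flip: ennreal_mult)
    qed
    finally show "ennreal (exp (l * (real j + 1))) * emeasure path_law (E j) \<le> ennreal (C * exp l * exp (- l) ^ j)" .
  qed auto
  also have "\<dots> < \<infinity>"
  proof -
    have "summable (\<lambda>j. C * exp l * exp (- l) ^ j)" using l by (intro summable_mult summable_geometric) auto
    then have "(\<Sum>j. ennreal (C * exp l * exp (- l) ^ j)) = ennreal (\<Sum>j. C * exp l * exp (- l) ^ j)"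
      using C(1) by (intro suminf_ennreal2) auto
    then show ?thesis by (simp add: less_top[symmetric])
  qed
  finally show "(\<integral>\<^sup>+w. ennreal (exp (- path_gamma w / (4 * \<kappa>))) \<partial>path_law) < \<infinity>" .
qed auto

text \<open>Chernoff's inequality with as many copies as the threshold affords. For n about exp(y /
  \<kappa> - c) the lowered threshold y - \<kappa> (4 + ln n) is still a large constant, each copy
  contributes a factor of at most 1/e, and exp(-n) is doubly exponential in y.\<close>

lemma tail_double_exponential:
  assumes \<kappa>: "density_bound \<kappa>" and \<alpha>: "\<alpha> = 1"
  shows "\<exists>c. \<forall>y. c \<le> y / \<kappa> \<longrightarrow> tail y \<le> exp (1 - exp (y / \<kappa> - c))"
proof -
  have k: "0 < \<kappa>" by (rule density_bound_pos[OF \<kappa>])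
  define l where "l = 1 / (4 * \<kappa>)"
  have l: "0 < l" using k by (simp add: l_def)
  define m where "m = path_law.expectation (\<lambda>w. exp (- path_gamma w / (4 * \<kappa>)))"
  define m' where "m' = max m 1"
  \<comment> \<open>With this c, l times the lowered threshold is at least c / 4 - 1 = ln m' + 1;
    the term ln m' cancels the exponential moment and the 1 leaves a factor 1/e per copy.\<close>
  define c where "c = 4 * (ln m' + 2)"
  have "tail y \<le> exp (1 - exp (y / \<kappa> - c))" if y: "c \<le> y / \<kappa>" for y
  proof -
    define n where "n = nat \<lfloor>exp (y / \<kappa> - c)\<rfloor>"
    have "1 \<le> exp (y / \<kappa> - c)" using y by simp
    then have n: "1 \<le> n" "real n \<le> exp (y / \<kappa> - c)" "exp (y / \<kappa> - c) \<le> real n + 1"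
      unfolding n_def by linarith+
    have "ln (real n) \<le> y / \<kappa> - c"
      using n ln_mono[of "real n" "exp (y / \<kappa> - c)"] by simp
    then have "l * (\<kappa> * (4 + ln (real n))) \<le> l * (\<kappa> * (4 + (y / \<kappa> - c)))"
      using k l by (intro mult_left_mono) auto
    also have "\<dots> = l * y + 1 - c / 4" using k by (simp add: l_def field_simps)
    finally have z0: "l * (\<kappa> * (4 + ln (real n))) \<le> l * y + 1 - c / 4" .
    have "c / 4 = ln m' + 2" by (simp add: c_def)
    then have z: "ln m' + 1 \<le> l * (y - \<kappa> * (4 + ln (real n)))"
      using z0 unfolding right_diff_distrib by linarith
    define S where "S \<omega> = (\<Sum>i<n. - Gam (real i) 1 \<omega>)" for \<omega>
    define V where "V i \<omega> = exp (- path_gamma (path (real i) 1 \<omega>) / (4 * \<kappa>))" for i \<omega>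
    have em: "(\<lambda>w. exp (- path_gamma w / (4 * \<kappa>))) \<in> borel_measurable path_space" by measurable
    have Vi: "integrable M (V i)" "expectation (V i) = m" for i
      unfolding V_def[abs_def] m_def
      using integral_path_law[OF _ _ em, of "real i" 1] exponential_moment[OF \<kappa> \<alpha>] by auto
    have ind: "indep_vars (\<lambda>_. borel) V {..<n}"
      unfolding V_def[abs_def] by (rule indep_vars_compose2[OF indep_unit_paths]) (rule em)
    have prod: "exp (l * S \<omega>) = (\<Prod>i<n. V i \<omega>)" for \<omega>
      unfolding S_def V_def sum_distrib_left exp_sum[OF finite_lessThan] Gam_unit
      by (intro prod.cong refl) (simp add: l_def)
    have Si: "integrable M (\<lambda>\<omega>. exp (l * S \<omega>))" "expectation (\<lambda>\<omega>. exp (l * S \<omega>)) = m ^ n"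
      unfolding prod using indep_vars_integrable[OF _ ind Vi(1)] indep_vars_lebesgue_integral[OF _ ind Vi(1)] Vi(2)
      by simp_all
    let ?z = "y - \<kappa> * (4 + ln (real n))"
    have "tail y \<le> prob {\<omega> \<in> space M. real n * ?z \<le> S \<omega>}"
      unfolding S_def by (rule tail_le_sum[OF \<kappa> \<alpha> n(1)])
    also have "{\<omega> \<in> space M. real n * ?z \<le> S \<omega>} = {\<omega> \<in> space M. exp (l * (real n * ?z)) \<le> exp (l * S \<omega>)}"
      using l by simp
    also have "prob \<dots> \<le> expectation (\<lambda>\<omega>. exp (l * S \<omega>)) / exp (l * (real n * ?z))"
      by (rule integral_Markov_inequality_measure[OF Si(1) sets.empty_sets]) auto
    also have "\<dots> \<le> m' ^ n / exp (real n * (ln m' + 1))"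
    proof (rule frac_le)
      have "0 \<le> m" unfolding m_def by (intro integral_nonneg_AE) auto
      then show "expectation (\<lambda>\<omega>. exp (l * S \<omega>)) \<le> m' ^ n"
        unfolding Si(2) m'_def by (intro power_mono) auto
      have "real n * (ln m' + 1) \<le> real n * (l * ?z)" by (intro mult_left_mono z) simp
      then show "exp (real n * (ln m' + 1)) \<le> exp (l * (real n * ?z))" by (simp only: exp_le_cancel_iff mult.left_commute)
    qed (auto simp: m'_def)
    also have "\<dots> = exp (- real n)"
    proof -
      have "m' ^ n = exp (real n * ln m')" by (simp add: exp_of_nat_mult m'_def)
      then show ?thesis by (simp add: algebra_simps flip: exp_diff)
    qed
    also have "\<dots> \<le> exp (1 - exp (y / \<kappa> - c))" using n(3) by simp
    finally show ?thesis .
  qed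
  then show ?thesis by blast
qed

end

section \<open>The critical case: lower tail\<close>

text \<open>One-sided limits bound the path near each point, and compactness does the rest. At time
  0 only the right side is controlled, hence the intersections with \<open>{0..}\<close>.\<close>

lemma cadlag_bounded:
  fixes g :: "real \<Rightarrow> 'a::real_normed_vector"
  assumes g: "cadlag g" and a: "0 \<le> a"
  shows "\<exists>B. \<forall>t\<in>{a..b}. norm (g t) \<le> B"
proof -
  have loc: "\<exists>U. open U \<and> t \<in> U \<and> bounded (g ` U)" if t: "0 < t" for t
  proof -
    have ev: "\<exists>B. eventually (\<lambda>s. norm (g s) \<le> B) F" if "(g \<longlongrightarrow> l) F" for l F
    proof -
      have "eventually (\<lambda>s. norm (g s) < norm l + 1) F"
        using tendsto_norm[OF that] by (rule order_tendstoD) simp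
      then show ?thesis by (auto intro: eventually_mono less_imp_le)
    qed
    have "\<exists>l. (g \<longlongrightarrow> l) (at_left t)" using g t by (simp add: cadlag_def)
    then obtain l where "(g \<longlongrightarrow> l) (at_left t)" by blast
    from ev[OF this] obtain B1 where B1: "eventually (\<lambda>s. norm (g s) \<le> B1) (at_left t)" by blast
    have "(g \<longlongrightarrow> g t) (at_right t)" using g t by (simp add: cadlag_def)
    from ev[OF this] obtain B2 where B2: "eventually (\<lambda>s. norm (g s) \<le> B2) (at_right t)" by blast
    define B where "B = max (norm (g t)) (max B1 B2)"
    have "eventually (\<lambda>s. norm (g s) \<le> B) (at t)"
      unfolding eventually_at_split
      using B1 B2 by (auto elim!: eventually_mono simp: B_def)
    then have "eventually (\<lambda>s. norm (g s) \<le> B) (nhds t)"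
      by (simp add: eventually_nhds_conv_at B_def)
    then obtain U where "open U" "t \<in> U" "\<forall>s\<in>U. norm (g s) \<le> B" by (auto simp: eventually_nhds)
    then show ?thesis by (intro exI[of _ U]) (auto simp: bounded_iff)
  qed
  have "\<exists>U. open U \<and> 0 \<in> U \<and> bounded (g ` (U \<inter> {0..}))"
  proof -
    have "(g \<longlongrightarrow> g 0) (at_right 0)" using g by (simp add: cadlag_def)
    then have "eventually (\<lambda>s. norm (g s) < norm (g 0) + 1) (at_right 0)"
      by (rule order_tendstoD(2)[OF tendsto_norm]) simp
    then obtain d where d: "0 < d" "\<And>s. 0 < s \<Longrightarrow> s < d \<Longrightarrow> norm (g s) < norm (g 0) + 1"
      unfolding eventually_at_right_field by auto
    have "norm (g s) \<le> norm (g 0) + 1" if "s \<in> {..<d} \<inter> {0..}" for s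
      using d(2)[of s] that by (cases "s = 0") auto
    then show ?thesis using d(1) by (intro exI[of _ "{..<d}"]) (auto simp: bounded_iff)
  qed
  with loc have "\<forall>t\<in>{a..b}. \<exists>U. open U \<and> t \<in> U \<and> bounded (g ` (U \<inter> {0..}))"
    using a by (metis atLeastAtMost_iff bounded_subset image_mono inf_le1 less_eq_real_def order_trans)
  then obtain U where U: "\<And>t. t \<in> {a..b} \<Longrightarrow> open (U t) \<and> t \<in> U t \<and> bounded (g ` (U t \<inter> {0..}))" by metis
  have "{a..b} \<subseteq> (\<Union>t\<in>{a..b}. U t)" using U by auto
  then obtain K where K: "K \<subseteq> {a..b}" "finite K" "{a..b} \<subseteq> (\<Union>t\<in>K. U t)"
    using compactE_image[OF compact_Icc, of "{a..b}" U] U by metis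
  have "bounded (\<Union>t\<in>K. g ` (U t \<inter> {0..}))" using K U by (intro bounded_UN) auto
  moreover have "g ` {a..b} \<subseteq> (\<Union>t\<in>K. g ` (U t \<inter> {0..}))" using K(3) a by fastforce
  ultimately have "bounded (g ` {a..b})" by (rule bounded_subset)
  then show ?thesis by (auto simp: bounded_iff)
qed

text \<open>The elementary half of Stirling's formula, ln n! \<ge> n ln n - n.\<close>

lemma sum_ln_lower: "real n * ln (real n) - real n \<le> (\<Sum>i<n. ln (real i + 1))"
proof (induction n)
  case (Suc n)
  show ?case
  proof (cases "n = 0")
    case False
    have "ln (real n + 1) - ln (real n) = ln (1 + 1 / real n)"
    proof -
      have "1 + 1 / real n = (real n + 1) / real n" using False by (simp add: field_simps)
      then show ?thesis using False by (simp add: ln_div)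
    qed
    also have "\<dots> \<le> 1 / real n" by (rule ln_add_one_self_le_self) simp
    finally have "real n * (ln (real n + 1) - ln (real n)) \<le> real n * (1 / real n)"
      by (intro mult_left_mono) auto
    then have "real n * ln (real n + 1) \<le> real n * ln (real n) + 1" using False by (simp add: right_diff_distrib)
    then show ?thesis using Suc by (simp add: algebra_simps)
  qed simp
qed simp

section \<open>Segments that drift in one direction, and what survives on the drift event\<close>

context silt
begin

text \<open>The segment stays within B of its start and advances by at least s0 along b. Testing
  dyadic times suffices by right continuity and keeps the set measurable.\<close>

definition drift_set :: "'a \<Rightarrow> real \<Rightarrow> real \<Rightarrow> (nat \<times> nat \<Rightarrow> 'a) set" where
  "drift_set b s0 B = {w \<in> space path_law. (\<forall>q. norm (w q) \<le> B) \<and> s0 \<le> w (0, 1) \<bullet> b}"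

lemma sets_drift_set [measurable]: "drift_set b s0 B \<in> sets path_space"
proof -
  have [measurable]: "(\<lambda>w. w q) \<in> path_law \<rightarrow>\<^sub>M borel" for q
    unfolding measurable_cong_sets[OF sets_path_law refl] by (rule measurable_component_singleton) simp
  have "drift_set b s0 B \<in> sets path_law" unfolding drift_set_def by measurable
  then show ?thesis by simp
qed

text \<open>Paths are bounded on [0, 1]. So if all these sets were null, X 1 would almost surely
  have no positive component along b; by symmetry the component would vanish and \<psi> b would be
  0, against nondegeneracy.\<close>

lemma drift_set_positive:
  assumes b: "b \<in> Basis"
  shows "\<exists>s0>0. \<exists>B>0. 0 < path_law.prob (drift_set b s0 B)"
proof (rule ccontr)
  assume neg: "\<not> ?thesis"
  have X1m: "X 1 \<in> borel_measurable M" by simp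
  have null: "path_law.prob (drift_set b (1 / real (Suc j)) (real (Suc k))) = 0" for j k
  proof -
    have "\<not> 0 < path_law.prob (drift_set b (1 / real (Suc j)) (real (Suc k)))"
      using neg by (metis of_nat_0_less_iff zero_less_Suc zero_less_divide_1_iff)
    then show ?thesis by (simp add: zero_less_measure_iff)
  qed
  have "AE w in path_law. w \<notin> drift_set b (1 / real (Suc j)) (real (Suc k))" for j k
    using null[of j k] by (subst (asm) path_law.prob_eq_0) auto
  then have "AE w in path_law. \<forall>j k. w \<notin> drift_set b (1 / real (Suc j)) (real (Suc k))"
    by (simp add: AE_all_countable)
  then have "AE \<omega> in M. \<forall>j k. path 0 1 \<omega> \<notin> drift_set b (1 / real (Suc j)) (real (Suc k))"
    unfolding path_law_def by (rule AE_distrD[OF path_01_measurable])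
  then have up: "AE \<omega> in M. X 1 \<omega> \<bullet> b \<le> 0"
    using start_at_0 AE_space
  proof eventually_elim
    case (elim \<omega>)
    obtain C where C: "\<forall>t\<in>{0..1}. norm (X t \<omega>) \<le> C"
      using cadlag_bounded[OF cadlag_paths[OF elim(3)], of 0 1] by blast
    obtain k where k: "C \<le> real (Suc k)" by (metis real_nat_ceiling_ge le_SucI of_nat_le_iff order_trans order_refl)
    show ?case
    proof (rule ccontr)
      assume "\<not> X 1 \<omega> \<bullet> b \<le> 0"
      then obtain j where j: "1 / real (Suc j) < X 1 \<omega> \<bullet> b"
        using reals_Archimedean[of "X 1 \<omega> \<bullet> b"] by (auto simp: inverse_eq_divide)
      have "norm (path 0 1 \<omega> q) \<le> real (Suc k)" for q
      proof (cases q)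
        case (Pair n i)
        have "norm (X (min (real i / 2 ^ n) 1) \<omega>) \<le> C" by (rule bspec[OF C]) (auto simp: min_def)
        then show ?thesis using elim(2) k by (simp add: path_def Pair)
      qed
      moreover have "path 0 1 \<omega> (0, 1) = X 1 \<omega>" using elim(2) by (simp add: path_def)
      ultimately have "path 0 1 \<omega> \<in> drift_set b (1 / real (Suc j)) (real (Suc k))"
        using j by (simp add: drift_set_def path_law_def space_PiM)
      then show False using elim(1) by blast
    qed
  qed
  have sym: "distr M borel (\<lambda>\<omega>. - X 1 \<omega>) = distr M borel (X 1)"
  proof (rule cf_unique)
    fix l
    have "cf (distr M borel (\<lambda>\<omega>. - X 1 \<omega>)) l = cf (distr M borel (X 1)) (- l)"
      by (simp add: integral_distr)
    then show "cf (distr M borel (\<lambda>\<omega>. - X 1 \<omega>)) l = cf (distr M borel (X 1)) l"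
      by (simp only: X1_cf exponent_symmetric)
  qed (auto intro!: prob_space_distr)
  have hs: "{x. x \<bullet> b \<le> 0} \<in> sets borel" by measurable
  have "AE x in distr M borel (X 1). x \<bullet> b \<le> 0"
    using up by (subst AE_distr_iff[OF X1m]) (use hs in auto)
  then have "AE x in distr M borel (\<lambda>\<omega>. - X 1 \<omega>). x \<bullet> b \<le> 0" unfolding sym .
  then have "AE \<omega> in M. - X 1 \<omega> \<bullet> b \<le> 0"
    by (subst (asm) AE_distr_iff) (use hs in auto)
  with up have "AE \<omega> in M. b \<bullet> X 1 \<omega> = 0"
    by eventually_elim (simp add: inner_commute)
  then have "(CLINT \<omega>|M. iexp (b \<bullet> X 1 \<omega>)) = (CLINT \<omega>|M. 1)"
    by (intro integral_cong_AE) (auto elim!: eventually_mono)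
  then have "complex_of_real (exp (- \<psi> b)) = 1"
    using characteristic_exponent[of 1 b] by (simp add: prob_space)
  then have "\<psi> b = 0" by (metis exp_eq_one_iff neg_equal_0_iff_equal of_real_eq_1_iff)
  moreover obtain c where "0 < c" "c * norm b powr \<beta> \<le> \<psi> b" using exponent_bounds by blast
  ultimately show False using b by simp
qed

text \<open>The b - a unit segments under \<open>Gam\<close> are merged into one and their
  indicators are bounded by 1; the other n - (b - a) indicators are independent of the merged
  segment. So restriction to the drift event costs a local quantity only a bounded number of
  factors.\<close>

lemma expectation_Gam_on_blocks:
  assumes H: "H \<in> sets path_space" and ab: "a < b" "b \<le> n" and \<alpha>: "\<alpha> = 1"
  shows "expectation (\<lambda>\<omega>. \<bar>Gam (real a) (real b - real a) \<omega>\<bar> * indicator {\<omega>. \<forall>j<n. path (real j) 1 \<omega> \<in> H} \<omega>) \<le>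
    (real b - real a) * path_law.expectation (\<lambda>w. \<bar>path_gamma w\<bar>) * path_law.prob H ^ (n - (b - a))"
proof -
  \<comment> \<open>Coarsened partition: index a carries the merged segment from a to b, and later
    indices are shifted by b - a - 1.\<close>
  define T where "T k = real (if k \<le> a then k else k + (b - a - 1))" for k
  define L where "L k = T (Suc k) - T k" for k
  have T: "0 \<le> T 0" "T i \<le> T (Suc i)" for i by (auto simp: T_def)
  have La: "T a = real a" "L a = real b - real a" using ab by (auto simp: T_def L_def)
  have Lk: "L k = 1" if "k \<noteq> a" for k using that by (auto simp: T_def L_def)
  define h where "h k = (if k = a then (\<lambda>w. \<bar>path_gamma w\<bar>) else indicator H)" for k :: nat
  have hm: "h k \<in> borel_measurable path_space" for k
    using H by (auto simp: h_def)
  define V where "V k \<omega> = h k (path (T k) (L k) \<omega>)" for k \<omega>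
  define m where "m = n - (b - a) + 1"
  have am: "a < m" using ab by (simp add: m_def)
  have T0: "0 \<le> T k" "0 < L k" for k
    using Lk[of k] La ab by (cases "k = a"; simp add: T_def)+
  have ind: "indep_vars (\<lambda>_. borel) V {..<m}"
    unfolding V_def[abs_def] L_def by (rule indep_vars_compose2[OF indep_paths[OF T]]) (rule hm)
  have hi: "integrable path_law (h k)" for k
  proof (cases "k = a")
    case False
    have "integrable path_law (indicator H :: _ \<Rightarrow> real)"
      using H by (intro integrable_real_indicator) (simp_all add: path_law.emeasure_eq_measure)
    then show ?thesis using False by (simp add: h_def)
  qed (simp add: h_def path_gamma_integrable)
  have Vi: "integrable M (V k)" and Ve: "expectation (V k) = path_law.expectation (h k)" for k
    unfolding V_def[abs_def] using integral_path_law[OF T0 hm, of k k] hi[of k] by auto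
  have prodE: "expectation (\<lambda>\<omega>. \<Prod>k<m. V k \<omega>) = path_law.expectation (\<lambda>w. \<bar>path_gamma w\<bar>) * path_law.prob H ^ (n - (b - a))"
  proof -
    have "expectation (\<lambda>\<omega>. \<Prod>k<m. V k \<omega>) = (\<Prod>k<m. path_law.expectation (h k))"
      by (subst indep_vars_lebesgue_integral[OF finite_lessThan ind Vi]) (simp add: Ve)
    also have "\<dots> = path_law.expectation (h a) * (\<Prod>k\<in>{..<m} - {a}. path_law.expectation (h k))"
      using am by (intro prod.remove) auto
    also have "(\<Prod>k\<in>{..<m} - {a}. path_law.expectation (h k)) = (\<Prod>k\<in>{..<m} - {a}. path_law.prob H)"
      using H by (intro prod.cong refl) (auto simp: h_def)
    finally show ?thesis using am by (simp add: h_def m_def)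
  qed
  have "expectation (\<lambda>\<omega>. \<bar>Gam (real a) (real b - real a) \<omega>\<bar> * indicator {\<omega>. \<forall>j<n. path (real j) 1 \<omega> \<in> H} \<omega>) \<le>
    expectation (\<lambda>\<omega>. (real b - real a) * (\<Prod>k<m. V k \<omega>))"
  proof (rule integral_mono')
    show "integrable M (\<lambda>\<omega>. (real b - real a) * (\<Prod>k<m. V k \<omega>))"
      by (intro integrable_mult_right indep_vars_integrable[OF finite_lessThan ind Vi])
    have V0: "0 \<le> V k \<omega>" for k \<omega> by (simp add: V_def h_def)
    show "0 \<le> (real b - real a) * (\<Prod>k<m. V k \<omega>)" for \<omega>
      using ab V0 by (intro mult_nonneg_nonneg prod_nonneg) auto
    show "\<bar>Gam (real a) (real b - real a) \<omega>\<bar> * indicator {\<omega>. \<forall>j<n. path (real j) 1 \<omega> \<in> H} \<omega> \<le> (real b - real a) * (\<Prod>k<m. V k \<omega>)" for \<omega>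
    proof (cases "\<forall>j<n. path (real j) 1 \<omega> \<in> H")
      case True
      have "V k \<omega> = 1" if k: "k \<in> {..<m} - {a}" for k
      proof -
        define j where "j = (if k \<le> a then k else k + (b - a - 1))"
        have "j < n" using k ab by (auto simp: j_def m_def split: if_splits)
        then show ?thesis using k True Lk[of k] by (simp add: V_def h_def T_def flip: j_def)
      qed
      then have "(\<Prod>k\<in>{..<m} - {a}. V k \<omega>) = 1" by (intro prod.neutral) auto
      then have "(\<Prod>k<m. V k \<omega>) = V a \<omega>" using am by (subst prod.remove[of _ a]) auto
      then show ?thesis using True ab \<alpha> by (simp add: V_def h_def La Gam_def abs_mult)
    next
      case False
      then show ?thesis using ab V0 by (auto intro!: mult_nonneg_nonneg prod_nonneg)
    qed
  qed
  then show ?thesis by (simp add: prodE)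
qed

section \<open>Interaction of a unit segment with the near and the far past\<close>

definition near :: "real \<Rightarrow> real \<Rightarrow> (real \<times> real) set" where
  "near a i = {z. i \<le> fst z \<and> fst z < i + 1 \<and> a \<le> snd z \<and> snd z \<le> fst z}"

definition far :: "real \<Rightarrow> real \<Rightarrow> (real \<times> real) set" where
  "far a i = {z. i \<le> fst z \<and> fst z < i + 1 \<and> 0 \<le> snd z \<and> snd z < a}"

lemma sets_near: "near a i \<in> sets borel" and sets_far: "far a i \<in> sets borel"
proof -
  have "{z \<in> space (borel \<Otimes>\<^sub>M borel :: (real \<times> real) measure). i \<le> fst z \<and> fst z < i + 1 \<and> a \<le> snd z \<and> snd z \<le> fst z} \<in> sets (borel \<Otimes>\<^sub>M borel)"
    by measurable
  then show "near a i \<in> sets borel" unfolding borel_prod by (simp add: near_def)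
  have "{z \<in> space (borel \<Otimes>\<^sub>M borel :: (real \<times> real) measure). i \<le> fst z \<and> fst z < i + 1 \<and> 0 \<le> snd z \<and> snd z < a} \<in> sets (borel \<Otimes>\<^sub>M borel)"
    by measurable
  then show "far a i \<in> sets borel" unfolding borel_prod by (simp add: far_def)
qed

lemma bounded_region_near: "0 \<le> a \<Longrightarrow> bounded_region (near a i)"
  unfolding bounded_region_def by (intro conjI sets_near exI[of _ "\<bar>i\<bar> + 1"]) (auto simp: near_def)

lemma bounded_region_far: "a \<le> i \<Longrightarrow> 0 \<le> i \<Longrightarrow> bounded_region (far a i)"
  unfolding bounded_region_def by (intro conjI sets_far exI[of _ "\<bar>i\<bar> + 1"]) (auto simp: far_def)

text \<open>The near strip is the difference of the triangles over [a, i + 1] and [a, i]. So besides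
  triangles, whose centred limits are known, only the far region occurs.\<close>

lemma occ_near_far:
  assumes "0 \<le> a" "a \<le> i" "0 < \<epsilon>" "\<omega> \<in> space M"
  shows "occ (tri 0 (i + 1)) \<epsilon> \<omega> + occ (tri a i) \<epsilon> \<omega> = occ (tri 0 i) \<epsilon> \<omega> + occ (tri a (i + 1)) \<epsilon> \<omega> + occ (far a i) \<epsilon> \<omega>"
proof -
  have 1: "tri 0 (i + 1) = (tri 0 i \<union> near a i) \<union> far a i" "tri 0 i \<inter> near a i = {}" "(tri 0 i \<union> near a i) \<inter> far a i = {}"
    using assms by (auto simp: tri_def near_def far_def)
  have 2: "tri a (i + 1) = tri a i \<union> near a i" "tri a i \<inter> near a i = {}"
    using assms by (auto simp: tri_def near_def)
  show ?thesis
    unfolding 1(1) 2(1) using assms 1 2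
    by (simp add: occ_Un bounded_region_Un bounded_region_tri bounded_region_near bounded_region_far)
qed

text \<open>Admits the empty segment: its triangle is empty, and \<open>Gam\<close> vanishes there
  because \<open>0 powr x = 0\<close>.\<close>

lemma L1_lim_Gam0:
  assumes "0 \<le> a" "a \<le> b"
  shows "L1_lim M (\<lambda>\<epsilon> \<omega>. occ (tri a b) \<epsilon> \<omega> - expectation (occ (tri a b) \<epsilon>)) (Gam a (b - a))"
proof (cases "a = b")
  case True
  have "tri b b = {}" by (auto simp: tri_def)
  then have "occ (tri b b) \<epsilon> = (\<lambda>_. 0)" for \<epsilon> by (simp add: occ_def fun_eq_iff)
  moreover have "Gam b 0 = (\<lambda>_. 0)" by (simp add: Gam_def fun_eq_iff)
  ultimately show ?thesis using True by (simp add: L1_lim_const)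
next
  case False
  then show ?thesis using L1_lim_Gam[of a "b - a"] assms by simp
qed

text \<open>For s - r \<ge> 1 the rescaled width is at most \<epsilon>, so the lower bound for the
  kernel means applies uniformly. What remains is \<kappa>' / (s - r) \<ge> \<kappa>' / (i + 1 - r),
  integrated over r in [0, i - m].\<close>

lemma expectation_far_lower:
  assumes \<alpha>: "\<alpha> = 1" and i: "real m \<le> real i" and \<kappa>: "0 \<le> \<kappa>'" and \<epsilon>: "0 < \<epsilon>" "\<epsilon> \<le> \<epsilon>0"
    and low: "\<And>e. 0 < e \<Longrightarrow> e \<le> \<epsilon>0 \<Longrightarrow> \<kappa>' \<le> expectation (\<lambda>\<omega>. rescale f e (X 1 \<omega>))" and m: "1 \<le> m"
  shows "\<kappa>' * (ln (real i + 1) - ln (real m + 1)) \<le> expectation (occ (far (real i - real m) (real i)) \<epsilon>)"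
proof -
  let ?R = "far (real i - real m) (real i)"
  have R: "bounded_region ?R" by (rule bounded_region_far) auto
  let ?E = "\<lambda>z. expectation (\<lambda>\<omega>. rescale f \<epsilon> (X (fst z) \<omega> - X (snd z) \<omega>))"
  have E0: "0 \<le> ?E z" for z
    by (intro integral_nonneg_AE) (auto simp: rescale_kernel_nonneg[OF kernel \<epsilon>(1)])
  define i' where "i' = real i"
  define m' where "m' = real m"
  have im: "m' \<le> i'" "1 \<le> m'" using i m by (auto simp: i'_def m'_def)
  let ?h = "\<lambda>z. indicator {i'..<i' + 1} (fst z) * (ennreal (\<kappa>' * (1 / (i' + 1 - snd z))) * indicator {0..<i' - m'} (snd z))"
  have "(\<integral>\<^sup>+r. ennreal (\<kappa>' * (1 / (i' + 1 - r))) * indicator {0..<i' - m'} r \<partial>lborel) = (\<integral>\<^sup>+r. ennreal (\<kappa>' * (1 / (i' + 1 - r))) * indicator {0..i' - m'} r \<partial>lborel)"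
    by (rule nn_integral_cong_AE, use AE_lborel_singleton[of "i' - m'"] in eventually_elim) (auto simp: indicator_def)
  also have "\<dots> = ennreal (- (\<kappa>' * ln (i' + 1 - (i' - m'))) - (- (\<kappa>' * ln (i' + 1 - 0))))"
    using im \<kappa> by (intro nn_integral_FTC_Icc) (auto intro!: derivative_eq_intros simp: divide_simps)
  finally have "(\<integral>\<^sup>+z. ?h z \<partial>lborel) = ennreal (\<kappa>' * (ln (i' + 1) - ln (m' + 1)))"
    by (subst nn_integral_lborel_pair_mult) (simp_all add: algebra_simps)
  then have "ennreal (\<kappa>' * (ln (i' + 1) - ln (m' + 1))) = (\<integral>\<^sup>+z. ?h z \<partial>lborel)" ..
  also have "\<dots> \<le> (\<integral>\<^sup>+z. ennreal (indicator ?R z * ?E z) \<partial>lborel)"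
  proof (rule nn_integral_mono)
    fix z :: "real \<times> real"
    show "?h z \<le> ennreal (indicator ?R z * ?E z)"
    proof (cases "z \<in> ?R")
      case True
      then have z: "0 \<le> snd z" "snd z < i' - m'" "i' \<le> fst z" "fst z < i' + 1" by (auto simp: far_def i'_def m'_def)
      then have u: "snd z < fst z" "1 \<le> fst z - snd z" using im by auto
      have p: "1 \<le> (fst z - snd z) powr (1 / \<beta>)" using u order_pos by (intro ge_one_powr_ge_zero) auto
      have "\<kappa>' * (1 / (i' + 1 - snd z)) \<le> \<kappa>' * (fst z - snd z) powr (- \<alpha>)"
        using z u \<kappa> \<alpha> by (intro mult_left_mono) (auto simp: powr_minus_divide intro!: divide_left_mono)
      also have "\<dots> \<le> expectation (\<lambda>\<omega>. rescale f (\<epsilon> / (fst z - snd z) powr (1 / \<beta>)) (X 1 \<omega>)) * (fst z - snd z) powr (- \<alpha>)"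
      proof (intro mult_right_mono low)
        show "0 < \<epsilon> / (fst z - snd z) powr (1 / \<beta>)" using \<epsilon> p by (intro divide_pos_pos) auto
        have "\<epsilon> / (fst z - snd z) powr (1 / \<beta>) \<le> \<epsilon> / 1" using \<epsilon> p by (intro divide_left_mono) auto
        then show "\<epsilon> / (fst z - snd z) powr (1 / \<beta>) \<le> \<epsilon>0" using \<epsilon> by simp
      qed simp
      also have "\<dots> = ?E z" using expectation_rescale_increment[OF z(1) u(1), of \<epsilon>] by (simp add: mult.commute)
      finally have "ennreal (\<kappa>' * (1 / (i' + 1 - snd z))) \<le> ennreal (?E z)" by (rule ennreal_leI)
      then show ?thesis using True z by simp
    next
      case False
      then have "\<not> (fst z \<in> {i'..<i' + 1} \<and> snd z \<in> {0..<i' - m'})" by (auto simp: far_def i'_def m'_def)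
      then show ?thesis by (auto simp: indicator_def)
    qed
  qed
  also have "\<dots> = ennreal (expectation (occ ?R \<epsilon>))"
    unfolding expectation_occ[OF R \<epsilon>(1)]
    by (intro nn_integral_eq_integral integrable_expectation_occ R \<epsilon>) (auto simp: E0)
  finally show ?thesis
    using occ_nonneg[OF \<epsilon>(1)] by (subst (asm) ennreal_le_iff) (auto simp: i'_def m'_def intro!: integral_nonneg_AE)
qed

text \<open>At distance at least s0, decay of f of order d + 1 beats the factor \<epsilon>^(-d) in
  the kernel and leaves one power of \<epsilon>, with a constant common to all outcomes.\<close>

lemma occ_far_small:
  assumes s0: "0 < s0" and R: "bounded_region R"
  shows "\<exists>C\<ge>0. \<forall>\<epsilon>>0. \<forall>\<omega>\<in>space M. (\<forall>z\<in>R. s0 \<le> norm (X (fst z) \<omega> - X (snd z) \<omega>)) \<longrightarrow> occ R \<epsilon> \<omega> \<le> C * \<epsilon>"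
proof -
  obtain B where B: "\<And>x. norm x ^ (DIM('a) + 1) * f x \<le> B" using kernel_decay[OF kernel] by blast
  have B0: "0 \<le> B" using B[of 0] by simp
  define C where "C = B / s0 ^ (DIM('a) + 1)"
  have C0: "0 \<le> C" using B0 s0 by (simp add: C_def)
  define A where "A = (LBINT z. indicator R z :: real)"
  have A0: "0 \<le> A" unfolding A_def by (intro integral_nonneg_AE) auto
  have "occ R \<epsilon> \<omega> \<le> C * A * \<epsilon>"
    if \<epsilon>: "0 < \<epsilon>" and w: "\<omega> \<in> space M" and far: "\<forall>z\<in>R. s0 \<le> norm (X (fst z) \<omega> - X (snd z) \<omega>)" for \<epsilon> \<omega>
  proof -
    have resc: "rescale f \<epsilon> x \<le> C * \<epsilon>" if x: "s0 \<le> norm x" for x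
    proof -
      have r0: "0 \<le> rescale f \<epsilon> x" by (rule rescale_kernel_nonneg[OF kernel \<epsilon>])
      have "rescale f \<epsilon> x * s0 ^ (DIM('a) + 1) \<le> rescale f \<epsilon> x * norm x ^ (DIM('a) + 1)"
        using x s0 r0 by (intro mult_left_mono power_mono) auto
      also have "\<dots> = \<epsilon> * (norm (x /\<^sub>R \<epsilon>) ^ (DIM('a) + 1) * f (x /\<^sub>R \<epsilon>))"
        using \<epsilon> by (simp add: rescale_def power_mult_distrib power_inverse field_simps)
      also have "\<dots> \<le> \<epsilon> * B" by (rule mult_left_mono[OF B less_imp_le[OF \<epsilon>]])
      finally show ?thesis using s0 by (simp add: C_def field_simps)
    qed
    have "occ R \<epsilon> \<omega> \<le> (LBINT z. C * \<epsilon> * indicator R z)"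
      unfolding occ_def
    proof (rule integral_mono[OF integrable_occ_integrand(2)[OF R \<epsilon> w]])
      show "integrable lborel (\<lambda>z. C * \<epsilon> * indicator R z)" using bounded_region_integrable[OF R] by simp
      show "indicator R z * rescale f \<epsilon> (X (fst z) \<omega> - X (snd z) \<omega>) \<le> C * \<epsilon> * indicator R z" for z
        using resc far by (auto simp: indicator_def)
    qed
    then show ?thesis by (simp add: A_def mult_ac)
  qed
  then show ?thesis using C0 A0 by (intro exI[of _ "C * A"]) auto
qed

text \<open>At least m + 1 whole blocks separate the starts of the blocks that contain the two
  times. They advance the path by (m + 1) s0, the two incomplete blocks take back at most B each,
  and 2 B \<le> m s0 leaves s0.\<close>

lemma drift_separates:
  assumes w: "\<omega> \<in> space M" and b: "b \<in> Basis" and H: "\<forall>j\<le>i. path (real j) 1 \<omega> \<in> drift_set b s0 B"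
    and s0: "0 < s0" and m: "2 * B \<le> real m * s0" and z: "z \<in> far (real i - real m) (real i)"
  shows "s0 \<le> norm (X (fst z) \<omega> - X (snd z) \<omega>)"
proof -
  have close: "norm (X t \<omega> - X (real j) \<omega>) \<le> B" if j: "j \<le> i" and t: "real j \<le> t" "t \<le> real j + 1" for j t
  proof -
    have "(\<lambda>n. path (real j) 1 \<omega> (n, nat \<lceil>(t - real j) * 2 ^ n\<rceil>)) \<longlonglongrightarrow> (X (real j + 1 * (t - real j)) \<omega> - X (real j) \<omega>) /\<^sub>R 1 powr (1 / \<beta>)"
      using t by (intro path_tendsto w) auto
    then have "(\<lambda>n. path (real j) 1 \<omega> (n, nat \<lceil>(t - real j) * 2 ^ n\<rceil>)) \<longlonglongrightarrow> X t \<omega> - X (real j) \<omega>" by simp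
    from tendsto_norm[OF this] show ?thesis
      by (rule LIMSEQ_le_const2) (use H j in \<open>auto simp: drift_set_def\<close>)
  qed
  have step: "X (real j) \<omega> \<bullet> b + s0 \<le> X (real (Suc j)) \<omega> \<bullet> b" if "j \<le> i" for j
    using H that by (auto simp: drift_set_def path_def inner_diff_left add.commute)
  have mono: "X (real j) \<omega> \<bullet> b + real (k - j) * s0 \<le> X (real k) \<omega> \<bullet> b" if "j \<le> k" "k \<le> i" for j k
    using that
  proof (induction k rule: dec_induct)
    case (step k)
    have "real (Suc k - j) * s0 = real (k - j) * s0 + s0" using step.hyps by (simp add: Suc_diff_le algebra_simps)
    then show ?case using step.IH step.prems \<open>\<And>j. j \<le> i \<Longrightarrow> X (real j) \<omega> \<bullet> b + s0 \<le> X (real (Suc j)) \<omega> \<bullet> b\<close>[of k] by linarith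
  qed simp
  have zz: "real i \<le> fst z" "fst z < real i + 1" "0 \<le> snd z" "snd z < real i - real m" using z by (auto simp: far_def)
  define j where "j = nat \<lfloor>snd z\<rfloor>"
  have j: "real j \<le> snd z" "snd z < real j + 1" using zz(3) by (auto simp: j_def)
  have jm: "Suc (j + m) \<le> i" using j zz by linarith
  have b1: "\<bar>x \<bullet> b\<bar> \<le> norm x" for x by (rule Basis_le_norm[OF b])
  have "X (real j) \<omega> \<bullet> b + real (i - j) * s0 \<le> X (real i) \<omega> \<bullet> b" using jm by (intro mono) auto
  moreover have "(real m + 1) * s0 \<le> real (i - j) * s0" using jm s0 by (intro mult_right_mono) auto
  moreover have "\<bar>(X (fst z) \<omega> - X (real i) \<omega>) \<bullet> b\<bar> \<le> B" using b1 close[of i "fst z"] zz order_trans by fastforce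
  moreover have "\<bar>(X (snd z) \<omega> - X (real j) \<omega>) \<bullet> b\<bar> \<le> B" using b1 close[of j "snd z"] j jm order_trans by fastforce
  ultimately have "s0 \<le> (X (fst z) \<omega> - X (snd z) \<omega>) \<bullet> b"
    using m by (simp add: inner_diff_left algebra_simps)
  also have "\<dots> \<le> norm (X (fst z) \<omega> - X (snd z) \<omega>)" using b1 abs_le_D1 by blast
  finally show ?thesis .
qed

text \<open>On the drift event the far occupation vanishes with \<epsilon>, yet centring still
  subtracts its mean, about p 0 (ln (i + 1) - ln (m + 1)). So \<gamma> drops by this amount up to
  the near contribution. The slack 1 is one half for the mean and one half for the
  occupation.\<close>

lemma gamma_step_on_drift:
  fixes i m :: nat
  assumes p: "continuous_density M (X 1) p" and \<alpha>: "\<alpha> = 1" and b: "b \<in> Basis" and s0: "0 < s0"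
    and m: "1 \<le> m" "2 * B \<le> real m * s0"
  defines "a \<equiv> real (i - m)"
  shows "AE \<omega> in M. (\<forall>j\<le>i. path (real j) 1 \<omega> \<in> drift_set b s0 B) \<longrightarrow>
    \<gamma> (real i + 1) \<omega> \<le> \<gamma> (real i) \<omega> + (Gam a (real i + 1 - a) \<omega> - Gam a (real i - a) \<omega>) - p 0 * (ln (real i + 1) - ln (real m + 1)) + 1"
proof -
  define \<kappa> where "\<kappa> = p 0"
  have \<kappa>: "0 < \<kappa>" unfolding \<kappa>_def by (rule density_bound_pos[OF density_bound_density[OF p]])
  have a: "0 \<le> a" "a \<le> real i" by (auto simp: a_def)
  define H where "H = {\<omega> \<in> space M. \<forall>j\<le>i. path (real j) 1 \<omega> \<in> drift_set b s0 B}"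
  have pm: "path (real j) 1 \<in> M \<rightarrow>\<^sub>M path_space" for j by (rule measurable_path) auto
  have "H = (\<Inter>j\<in>{..i}. path (real j) 1 -` drift_set b s0 B \<inter> space M)" by (auto simp: H_def)
  then have H: "H \<in> events" using measurable_sets[OF pm sets_drift_set] by auto
  define D where "D = ln (real i + 1) - ln (real m + 1)"
  let ?R = "far a (real i)"
  have R: "bounded_region ?R" using a by (intro bounded_region_far) auto
  \<comment> \<open>For i < m the truncated subtraction gives a = 0; then the far region is empty
    and D is negative, so there is nothing to gain or lose.\<close>
  have low: "eventually (\<lambda>\<epsilon>. \<kappa> * D - 1 / 2 \<le> expectation (occ ?R \<epsilon>)) (at_right 0)"
  proof (cases "m \<le> i")
    case True
    then have D0: "0 \<le> D" by (simp add: D_def)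
    \<comment> \<open>Replacing \<kappa> by \<kappa> - \<delta> must cost at most 1/2 over the whole
      logarithm D.\<close>
    define \<delta> where "\<delta> = min \<kappa> (1 / (2 * (D + 1)))"
    have \<delta>: "0 < \<delta>" "\<delta> \<le> \<kappa>" "\<delta> * D \<le> 1 / 2"
    proof -
      show "0 < \<delta>" "\<delta> \<le> \<kappa>" using \<kappa> D0 by (auto simp: \<delta>_def)
      have "\<delta> * D \<le> 1 / (2 * (D + 1)) * D" using D0 by (intro mult_right_mono) (auto simp: \<delta>_def)
      also have "\<dots> \<le> 1 / 2" using D0 by (simp add: field_simps)
      finally show "\<delta> * D \<le> 1 / 2" .
    qed
    have "eventually (\<lambda>e. \<kappa> - \<delta> < expectation (\<lambda>\<omega>. rescale f e (X 1 \<omega>))) (at_right 0)"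
      using density_limit[OF p] \<delta>(1) unfolding \<kappa>_def by (intro order_tendstoD(1)) auto
    then obtain e1 where e1: "0 < e1" "\<And>e. 0 < e \<Longrightarrow> e < e1 \<Longrightarrow> \<kappa> - \<delta> < expectation (\<lambda>\<omega>. rescale f e (X 1 \<omega>))"
      unfolding eventually_at_right_field by auto
    have "\<kappa> * D - 1 / 2 \<le> expectation (occ ?R \<epsilon>)" if "0 < \<epsilon>" "\<epsilon> < e1" for \<epsilon>
    proof -
      have "(\<kappa> - \<delta>) * D \<le> expectation (occ (far (real i - real m) (real i)) \<epsilon>)"
        unfolding D_def
      proof (rule expectation_far_lower[OF \<alpha>])
        show "\<kappa> - \<delta> \<le> expectation (\<lambda>\<omega>. rescale f e (X 1 \<omega>))" if "0 < e" "e \<le> \<epsilon>" for e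
          using e1(2)[of e] that \<open>\<epsilon> < e1\<close> by simp
      qed (use True that \<delta> m in auto)
      moreover have "real i - real m = a" using True by (simp add: a_def of_nat_diff)
      ultimately show ?thesis using \<delta>(3) by (simp add: left_diff_distrib)
    qed
    then show ?thesis unfolding eventually_at_right_field using e1(1) by blast
  next
    case False
    have "\<kappa> * D \<le> 0" using \<kappa> False by (intro mult_nonneg_nonpos) (auto simp: D_def)
    moreover have "0 \<le> expectation (occ ?R \<epsilon>)" if "0 < \<epsilon>" for \<epsilon>
      using occ_nonneg[OF that] by (intro integral_nonneg_AE) auto
    ultimately show ?thesis
      using eventually_pos_at_right by (auto elim!: eventually_mono intro: order_trans[of _ 0])
  qed
  have sep: "s0 \<le> norm (X (fst z) \<omega> - X (snd z) \<omega>)" if w: "\<omega> \<in> H" and z: "z \<in> ?R" for z \<omega>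
  proof (cases "m \<le> i")
    case True
    then have "real i - real m = a" by (simp add: a_def of_nat_diff)
    then show ?thesis
      using w z by (intro drift_separates[where i = i, OF _ b _ s0 m(2)]) (auto simp: H_def)
  next
    case False
    then have "a = 0" by (simp add: a_def)
    then show ?thesis using z by (auto simp: far_def)
  qed
  obtain C where C: "0 \<le> C" "\<And>\<epsilon> \<omega>. 0 < \<epsilon> \<Longrightarrow> \<omega> \<in> H \<Longrightarrow> occ ?R \<epsilon> \<omega> \<le> C * \<epsilon>"
    using occ_far_small[OF s0 R] sep by (metis (no_types, lifting) H_def mem_Collect_eq)
  have small: "eventually (\<lambda>\<epsilon>. C * \<epsilon> < 1 / 2) (at_right 0)"
  proof -
    have "((\<lambda>\<epsilon>. C * \<epsilon>) \<longlongrightarrow> C * 0) (at_right 0)" by (intro tendsto_intros)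
    then show ?thesis by (rule order_tendstoD) simp
  qed
  let ?C = "\<lambda>R \<epsilon> \<omega>. occ R \<epsilon> \<omega> - expectation (occ R \<epsilon>)"
  let ?c = "- (\<kappa> * D) + 1"
  have lim: "L1_lim M (\<lambda>\<epsilon> \<omega>. ((?C (tri 0 (real i)) \<epsilon> \<omega> + ?C (tri a (real i + 1)) \<epsilon> \<omega>) - (?C (tri 0 (real i + 1)) \<epsilon> \<omega> + ?C (tri a (real i)) \<epsilon> \<omega>)) + ?c)
      (\<lambda>\<omega>. ((\<gamma> (real i) \<omega> + Gam a (real i + 1 - a) \<omega>) - (\<gamma> (real i + 1) \<omega> + Gam a (real i - a) \<omega>)) + ?c)"
    using a by (intro L1_lim_add L1_lim_diff L1_lim_gamma L1_lim_Gam0 L1_lim_const) auto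
  have "AE \<omega> in M. \<omega> \<in> H \<longrightarrow> 0 \<le> ((\<gamma> (real i) \<omega> + Gam a (real i + 1 - a) \<omega>) - (\<gamma> (real i + 1) \<omega> + Gam a (real i - a) \<omega>)) + ?c"
  proof (rule L1_lim_nonneg_on[OF lim H])
    show "eventually (\<lambda>\<epsilon>. \<forall>\<omega>\<in>H. 0 \<le> ((?C (tri 0 (real i)) \<epsilon> \<omega> + ?C (tri a (real i + 1)) \<epsilon> \<omega>) - (?C (tri 0 (real i + 1)) \<epsilon> \<omega> + ?C (tri a (real i)) \<epsilon> \<omega>)) + ?c) (at_right 0)"
      using eventually_pos_at_right low small
    proof eventually_elim
      case (elim \<epsilon>)
      have nf: "occ (tri 0 (real i + 1)) \<epsilon> \<omega> + occ (tri a (real i)) \<epsilon> \<omega> = occ (tri 0 (real i)) \<epsilon> \<omega> + occ (tri a (real i + 1)) \<epsilon> \<omega> + occ ?R \<epsilon> \<omega>"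
        if "\<omega> \<in> space M" for \<omega> using a elim(1) that by (intro occ_near_far)
      have "expectation (\<lambda>\<omega>. occ (tri 0 (real i + 1)) \<epsilon> \<omega> + occ (tri a (real i)) \<epsilon> \<omega>) =
          expectation (\<lambda>\<omega>. occ (tri 0 (real i)) \<epsilon> \<omega> + occ (tri a (real i + 1)) \<epsilon> \<omega> + occ ?R \<epsilon> \<omega>)"
        by (intro Bochner_Integration.integral_cong refl nf)
      then have es: "expectation (occ (tri 0 (real i + 1)) \<epsilon>) + expectation (occ (tri a (real i)) \<epsilon>) =
          expectation (occ (tri 0 (real i)) \<epsilon>) + expectation (occ (tri a (real i + 1)) \<epsilon>) + expectation (occ ?R \<epsilon>)"
        using a elim(1) R by (simp add: integrable_occ bounded_region_tri)
      show ?case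
      proof
        fix \<omega> assume w: "\<omega> \<in> H"
        then have "\<omega> \<in> space M" by (simp add: H_def)
        from nf[OF this] es elim(2,3) C(2)[OF elim(1) w]
        show "0 \<le> ((?C (tri 0 (real i)) \<epsilon> \<omega> + ?C (tri a (real i + 1)) \<epsilon> \<omega>) - (?C (tri 0 (real i + 1)) \<epsilon> \<omega> + ?C (tri a (real i)) \<epsilon> \<omega>)) + ?c"
          by linarith
      qed
    qed
  qed
  then show ?thesis
    using AE_space
  proof eventually_elim
    case (elim \<omega>)
    show ?case
    proof
      assume "\<forall>j\<le>i. path (real j) 1 \<omega> \<in> drift_set b s0 B"
      then have "\<omega> \<in> H" using elim(2) by (simp add: H_def)
      then show "\<gamma> (real i + 1) \<omega> \<le> \<gamma> (real i) \<omega> + (Gam a (real i + 1 - a) \<omega> - Gam a (real i - a) \<omega>) - p 0 * (ln (real i + 1) - ln (real m + 1)) + 1"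
        using elim(1) unfolding \<kappa>_def D_def by simp
    qed
  qed
qed

section \<open>The lower tail and the critical law\<close>

lemma gamma_zero: "AE \<omega> in M. \<gamma> 0 \<omega> = 0"
proof -
  have "AE \<omega> in M. \<gamma> 0 \<omega> = Gam 0 (0 - 0) \<omega>"
    by (rule L1_lim_unique[OF L1_lim_gamma L1_lim_Gam0]) auto
  then show ?thesis by eventually_elim (simp add: Gam_def)
qed

text \<open>The drift event over n unit segments has probability \<pi>^n, and on it the steps add up
  to p 0 n ln n + O(n). Each near contribution involves at most m + 1 segments, so their total has
  mean O(n) \<pi>^n on the event and Markov's inequality discards at most half of it. Scaling by n
  turns the bound into one for the tail of -\<gamma> 1.\<close>

lemma tail_lower:
  assumes p: "continuous_density M (X 1) p" and \<alpha>: "\<alpha> = 1"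
  shows "\<exists>C \<pi>. 0 < \<pi> \<and> \<pi> \<le> 1 \<and> (\<forall>n\<ge>1. \<pi> ^ n / 2 \<le> tail (p 0 * ln (real n) - C))"
proof -
  define \<kappa> where "\<kappa> = p 0"
  have \<kappa>: "0 < \<kappa>" unfolding \<kappa>_def by (rule density_bound_pos[OF density_bound_density[OF p]])
  obtain b :: 'a where b: "b \<in> Basis" using nonempty_Basis by blast
  obtain s0 B where s0: "0 < s0" and B: "0 < B" and pos: "0 < path_law.prob (drift_set b s0 B)"
    using drift_set_positive[OF b] by blast
  define Hs where "Hs = drift_set b s0 B"
  have Hs: "Hs \<in> sets path_space" by (simp add: Hs_def sets_drift_set)
  define \<pi> where "\<pi> = path_law.prob Hs"
  have \<pi>: "0 < \<pi>" "\<pi> \<le> 1" using pos by (auto simp: \<pi>_def Hs_def)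
  define m where "m = Suc (nat \<lceil>2 * B / s0\<rceil>)"
  have m: "1 \<le> m" "2 * B \<le> real m * s0"
  proof -
    have "2 * B / s0 \<le> real m" unfolding m_def by linarith
    then show "2 * B \<le> real m * s0" using s0 by (simp add: divide_le_eq)
  qed (simp add: m_def)
  define c0 where "c0 = path_law.expectation (\<lambda>w. \<bar>path_gamma w\<bar>)"
  have c0: "0 \<le> c0" unfolding c0_def by (intro integral_nonneg_AE) auto
  define A where "A i = real (i - m)" for i
  define N where "N i \<omega> = Gam (A i) (real i + 1 - A i) \<omega> - Gam (A i) (real i - A i) \<omega>" for i \<omega>
  \<comment> \<open>Dividing by \<pi>^(m + 1) makes up for the indicators given up on the near
    segments; the constant does not depend on n.\<close>
  define E where "E = (real m + 1) * c0 / \<pi> ^ (m + 1)"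
  have E0: "0 \<le> E" using c0 \<pi> by (simp add: E_def)
  \<comment> \<open>Makes the Markov ratio 2 E / C2 at most 1/2.\<close>
  define C2 where "C2 = 4 * E + 1"
  \<comment> \<open>Per unit of time: the Stirling error \<kappa>, the logarithm lost to the near
    past together with the slack 1 of each step, and the near contributions.\<close>
  define C where "C = \<kappa> + \<kappa> * ln (real m + 1) + 1 + C2"
  have "\<pi> ^ n / 2 \<le> tail (\<kappa> * ln (real n) - C)" if n: "1 \<le> n" for n
  proof -
    let ?I = "indicator {\<omega>. \<forall>j<n. path (real j) 1 \<omega> \<in> Hs} :: 'w \<Rightarrow> real"
    define Hn where "Hn = (\<Inter>j\<in>{..<n}. path (real j) (real (Suc j) - real j) -` Hs \<inter> space M)"
    have n0: "{..<n} \<noteq> {}" using n by (auto simp: lessThan_empty_iff)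
    have Hn_iff: "\<omega> \<in> Hn \<longleftrightarrow> \<omega> \<in> space M \<and> (\<forall>j<n. path (real j) 1 \<omega> \<in> Hs)" for \<omega>
      using n0 unfolding Hn_def by (auto simp del: lessThan_empty_iff)
    have pm: "path (real j) 1 \<in> M \<rightarrow>\<^sub>M path_space" for j by (rule measurable_path) auto
    have Hn_ev: "Hn \<in> events"
      unfolding Hn_def using measurable_sets[OF pm Hs] n0 by (intro sets.finite_INT) auto
    have Hn_prob: "prob Hn = \<pi> ^ n"
    proof -
      have "prob Hn = (\<Prod>j<n. prob (path (real j) (real (Suc j) - real j) -` Hs \<inter> space M))"
        unfolding Hn_def using n0 Hs by (intro indep_segments_prob) auto
      also have "\<dots> = (\<Prod>j<n. \<pi>)"
      proof (rule prod.cong[OF refl])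
        fix j
        have "prob (path (real j) 1 -` Hs \<inter> space M) = measure (distr M path_space (path (real j) 1)) Hs"
          by (rule measure_distr[OF pm Hs, symmetric])
        also have "distr M path_space (path (real j) 1) = path_law" by (rule distr_path_law) auto
        finally show "prob (path (real j) (real (Suc j) - real j) -` Hs \<inter> space M) = \<pi>" by (simp add: \<pi>_def)
      qed
      finally show ?thesis by simp
    qed
    have Im: "?I \<omega> = indicator Hn \<omega>" if "\<omega> \<in> space M" for \<omega>
      using that by (simp add: indicator_def Hn_iff)
    have Gm: "Gam a L \<in> borel_measurable M" if "0 \<le> a" "0 \<le> L" for a L using that by (rule measurable_Gam)
    have block: "expectation (\<lambda>\<omega>. \<bar>Gam (real a) (real b' - real a) \<omega>\<bar> * ?I \<omega>) \<le> E * \<pi> ^ n"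
      if ab: "a \<le> b'" "b' \<le> n" "b' - a \<le> m + 1" for a b'
    proof (cases "a = b'")
      case True
      have "0 \<le> E * \<pi> ^ n" using E0 \<pi> by (intro mult_nonneg_nonneg zero_le_power) auto
      then show ?thesis using True by (simp add: Gam_def)
    next
      case False
      then have "a < b'" using ab by simp
      then have "expectation (\<lambda>\<omega>. \<bar>Gam (real a) (real b' - real a) \<omega>\<bar> * ?I \<omega>) \<le> (real b' - real a) * c0 * \<pi> ^ (n - (b' - a))"
        unfolding c0_def \<pi>_def using ab by (intro expectation_Gam_on_blocks Hs \<alpha>) auto
      also have "\<dots> \<le> (real m + 1) * c0 * (\<pi> ^ n / \<pi> ^ (m + 1))"
      proof (intro mult_mono)
        show "real b' - real a \<le> real m + 1" using ab by linarith
        have "\<pi> ^ (n - (b' - a)) * \<pi> ^ (m + 1) = \<pi> ^ (n - (b' - a) + (m + 1))" by (rule power_add[symmetric])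
        also have "\<dots> \<le> \<pi> ^ n" using ab \<pi> by (intro power_decreasing) auto
        finally show "\<pi> ^ (n - (b' - a)) \<le> \<pi> ^ n / \<pi> ^ (m + 1)" using \<pi> by (simp add: pos_le_divide_eq)
      qed (use c0 \<pi> in auto)
      finally show ?thesis by (simp add: E_def)
    qed
    define W where "W \<omega> = (\<Sum>i<n. \<bar>N i \<omega>\<bar>) * indicator Hn \<omega>" for \<omega>
    have Gi: "integrable M (\<lambda>\<omega>. \<bar>Gam (real a) (real b' - real a) \<omega>\<bar> * ?I \<omega>)" if "a \<le> b'" for a b'
    proof -
      have "integrable M (Gam (real a) (real b' - real a))"
      proof (cases "a = b'")
        case True
        then have "Gam (real a) (real b' - real a) = (\<lambda>_. 0)" by (simp add: Gam_def fun_eq_iff)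
        then show ?thesis by simp
      qed (use that in \<open>auto intro!: Gam_integrable\<close>)
      then have "integrable M (\<lambda>\<omega>. \<bar>Gam (real a) (real b' - real a) \<omega>\<bar> * indicator Hn \<omega>)"
        using Hn_ev by (intro integrable_real_mult_indicator) auto
      then show ?thesis
        by (rule Bochner_Integration.integrable_cong[THEN iffD1, OF refl, rotated]) (simp add: Im)
    qed
    define U where "U i \<omega> = \<bar>Gam (real (i - m)) (real (Suc i) - real (i - m)) \<omega>\<bar> * ?I \<omega> + \<bar>Gam (real (i - m)) (real i - real (i - m)) \<omega>\<bar> * ?I \<omega>" for i \<omega>
    have Ui: "integrable M (U i)" for i
      unfolding U_def[abs_def] by (intro Bochner_Integration.integrable_add Gi) auto
    have Ue: "expectation (U i) \<le> 2 * E * \<pi> ^ n" if "i < n" for i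
    proof -
      have "expectation (U i) = expectation (\<lambda>\<omega>. \<bar>Gam (real (i - m)) (real (Suc i) - real (i - m)) \<omega>\<bar> * ?I \<omega>) + expectation (\<lambda>\<omega>. \<bar>Gam (real (i - m)) (real i - real (i - m)) \<omega>\<bar> * ?I \<omega>)"
        unfolding U_def[abs_def] by (intro Bochner_Integration.integral_add Gi) auto
      also have "\<dots> \<le> E * \<pi> ^ n + E * \<pi> ^ n" using that by (intro add_mono block) auto
      finally show ?thesis by simp
    qed
    have WU: "W \<omega> \<le> (\<Sum>i<n. U i \<omega>)" if "\<omega> \<in> space M" for \<omega>
      unfolding W_def sum_distrib_right
    proof (rule sum_mono)
      fix i
      have "\<bar>N i \<omega>\<bar> \<le> \<bar>Gam (real (i - m)) (real (Suc i) - real (i - m)) \<omega>\<bar> + \<bar>Gam (real (i - m)) (real i - real (i - m)) \<omega>\<bar>"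
        unfolding N_def A_def of_nat_Suc add.commute[of 1] by (rule abs_triangle_ineq4)
      from mult_right_mono[OF this, of "indicator Hn \<omega>"]
      show "\<bar>N i \<omega>\<bar> * indicator Hn \<omega> \<le> U i \<omega>"
        unfolding U_def Im[OF that] by (simp add: distrib_right)
    qed
    define bad where "bad = {\<omega> \<in> space M. C2 * real n \<le> (\<Sum>i<n. U i \<omega>)}"
    have Us: "integrable M (\<lambda>\<omega>. \<Sum>i<n. U i \<omega>)" by (intro Bochner_Integration.integrable_sum Ui)
    have bad_ev: "bad \<in> events" unfolding bad_def using borel_measurable_integrable[OF Us] by measurable
    have C2n: "0 < C2 * real n" using E0 n by (simp add: C2_def add_nonneg_pos)
    have bad_prob: "prob bad \<le> \<pi> ^ n / 2"
    proof -
      have "prob bad \<le> expectation (\<lambda>\<omega>. \<Sum>i<n. U i \<omega>) / (C2 * real n)"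
        unfolding bad_def
        by (rule integral_Markov_inequality_measure[OF Us sets.empty_sets _ C2n]) (auto intro!: AE_I2 sum_nonneg simp: U_def)
      also have "\<dots> \<le> (real n * (2 * E * \<pi> ^ n)) / (C2 * real n)"
      proof (rule divide_right_mono)
        have "expectation (\<lambda>\<omega>. \<Sum>i<n. U i \<omega>) = (\<Sum>i<n. expectation (U i))" by (rule Bochner_Integration.integral_sum[OF Ui])
        also have "\<dots> \<le> (\<Sum>i<n. 2 * E * \<pi> ^ n)" by (intro sum_mono Ue) auto
        finally show "expectation (\<lambda>\<omega>. \<Sum>i<n. U i \<omega>) \<le> real n * (2 * E * \<pi> ^ n)" by simp
      qed (use C2n in simp)
      also have "\<dots> = (2 * E / C2) * \<pi> ^ n" using n by simp
      also have "\<dots> \<le> (1 / 2) * \<pi> ^ n"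
        using E0 \<pi> by (intro mult_right_mono) (auto simp: C2_def divide_le_eq)
      finally show ?thesis by simp
    qed
    have "AE \<omega> in M. \<forall>i. (\<forall>j\<le>i. path (real j) 1 \<omega> \<in> Hs) \<longrightarrow> \<gamma> (real i + 1) \<omega> \<le> \<gamma> (real i) \<omega> + N i \<omega> - \<kappa> * (ln (real i + 1) - ln (real m + 1)) + 1"
      unfolding AE_all_countable N_def A_def Hs_def \<kappa>_def
      by (intro allI gamma_step_on_drift p \<alpha> b s0 m)
    then have ae: "AE \<omega> in M. \<omega> \<in> Hn - bad \<longrightarrow> \<omega> \<in> {\<omega> \<in> space M. real n * (\<kappa> * ln (real n) - C) \<le> - \<gamma> (real n) \<omega>}"
      using gamma_zero
    proof eventually_elim
      case (elim \<omega>)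
      show ?case
      proof
        assume w: "\<omega> \<in> Hn - bad"
        then have sp: "\<omega> \<in> space M" and Hj: "\<And>j. j < n \<Longrightarrow> path (real j) 1 \<omega> \<in> Hs" by (auto simp: Hn_iff)
        have "k \<le> n \<Longrightarrow> \<gamma> (real k) \<omega> \<le> (\<Sum>i<k. N i \<omega>) - \<kappa> * (\<Sum>i<k. ln (real i + 1)) + real k * (\<kappa> * ln (real m + 1) + 1)" for k
        proof (induction k)
          case (Suc k)
          have "\<gamma> (real k + 1) \<omega> \<le> \<gamma> (real k) \<omega> + N k \<omega> - \<kappa> * (ln (real k + 1) - ln (real m + 1)) + 1"
            using elim(1) Hj Suc.prems by simp
          then show ?case using Suc by (simp add: algebra_simps)
        qed (simp add: elim(2))
        from this[of n] have g: "\<gamma> (real n) \<omega> \<le> (\<Sum>i<n. N i \<omega>) - \<kappa> * (\<Sum>i<n. ln (real i + 1)) + real n * (\<kappa> * ln (real m + 1) + 1)" by simp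
        have "(\<Sum>i<n. N i \<omega>) \<le> (\<Sum>i<n. \<bar>N i \<omega>\<bar>)" by (intro sum_mono) simp
        also have "\<dots> = W \<omega>" using w by (simp add: W_def)
        also have "\<dots> \<le> C2 * real n" using w WU[OF sp] sp by (auto simp: bad_def not_le)
        finally have N: "(\<Sum>i<n. N i \<omega>) \<le> C2 * real n" .
        have "\<kappa> * (real n * ln (real n) - real n) \<le> \<kappa> * (\<Sum>i<n. ln (real i + 1))"
          using \<kappa> by (intro mult_left_mono sum_ln_lower) auto
        then have "real n * (\<kappa> * ln (real n) - C) \<le> - \<gamma> (real n) \<omega>"
          using g N by (simp add: C_def algebra_simps)
        then show "\<omega> \<in> {\<omega> \<in> space M. real n * (\<kappa> * ln (real n) - C) \<le> - \<gamma> (real n) \<omega>}" using sp by simp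
      qed
    qed
    have gm: "\<gamma> (real n) \<in> borel_measurable M" by (rule gamma_measurable) simp
    have "\<pi> ^ n / 2 \<le> prob Hn - prob bad" using Hn_prob bad_prob by simp
    also have "\<dots> \<le> prob (Hn - bad)"
      using Hn_ev bad_ev finite_measure_mono[of Hn "(Hn - bad) \<union> bad"] measure_Un_le[of "Hn - bad" M bad] by auto
    also have "\<dots> \<le> prob {\<omega> \<in> space M. real n * (\<kappa> * ln (real n) - C) \<le> - \<gamma> (real n) \<omega>}"
      using gm by (intro finite_measure_mono_AE[OF ae]) measurable
    also have "\<dots> = tail (\<kappa> * ln (real n) - C)" using n by (intro tail_eq_gamma_nat \<alpha>) simp
    finally show ?thesis .
  qed
  then show ?thesis using \<pi> unfolding \<kappa>_def by blast
qed

text \<open>Here N = ln. Up to constants the tail at K' ln L is exp(-L^(K' / p 0)) from above, far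
  below exp(-L) if K' > p 0, and of the same form from below, far above exp(-L) if K' < p 0. So p 0
  is the threshold.\<close>

lemma LIL_critical:
  assumes p: "continuous_density M (X 1) p" and \<alpha>: "\<alpha> = 1"
  shows "AE \<omega> in M. Liminf at_top (\<lambda>t. ereal (1 / (t * ln (ln (ln t))) * \<gamma> t \<omega>)) = ereal (- p 0)"
proof -
  define \<kappa> where "\<kappa> = p 0"
  have db: "density_bound \<kappa>" unfolding \<kappa>_def by (rule density_bound_density[OF p])
  have \<kappa>: "0 < \<kappa>" by (rule density_bound_pos[OF db])
  have "AE \<omega> in M. Liminf at_top (\<lambda>t. ereal (\<gamma> t \<omega> / (t powr (2 - \<alpha>) * ln (ln (ln t))))) = ereal (- \<kappa>)"
  proof (rule LIL[where ?L0.0 = "exp 1"])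
    have e1: "0 < x \<and> 1 \<le> ln x" if "exp 1 \<le> x" for x :: real
      using that ln_mono[of "exp 1" x] exp_gt_zero[of "1::real"] by (simp add: order_less_le_trans[OF exp_gt_zero that])
    show "ln x \<le> ln y" if "exp 1 \<le> x" "x \<le> y" for x y :: real
      using that e1[OF that(1)] by (intro ln_mono) auto
    \<comment> \<open>The reason for starting at exp 1: ln c \<le> c - 1 is absorbed into (c - 1) ln
      x once ln x \<ge> 1.\<close>
    show "ln (c * x) \<le> c * ln x" if "1 \<le> c" "exp 1 \<le> x" for c x :: real
    proof -
      have "ln c \<le> (c - 1) * 1" using that ln_le_minus_one[of c] by simp
      also have "\<dots> \<le> (c - 1) * ln x" using that e1[OF that(2)] by (intro mult_left_mono) auto
      finally show ?thesis using that e1[OF that(2)] by (simp add: ln_mult algebra_simps)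
    qed
    show "filterlim (ln :: real \<Rightarrow> real) at_top at_top" by (rule ln_at_top)
    show "0 < \<kappa>" by (rule \<kappa>)
    fix K' :: real
    show "\<exists>\<rho>>1. eventually (\<lambda>L. tail (K' * ln L) \<le> exp (- \<rho> * L)) at_top" if K': "\<kappa> < K'"
    proof -
      obtain c where c: "\<And>y. c \<le> y / \<kappa> \<Longrightarrow> tail y \<le> exp (1 - exp (y / \<kappa> - c))"
        using tail_double_exponential[OF db \<alpha>] by blast
      define q where "q = K' / \<kappa>"
      have q: "1 < q" using K' \<kappa> by (simp add: q_def)
      have "eventually (\<lambda>L. c \<le> q * ln L) at_top" using q by real_asymp
      moreover have "eventually (\<lambda>L. 1 - exp (q * ln L - c) \<le> - 2 * L) at_top"
      proof -
        have "eventually (\<lambda>L. 1 - exp (- c) * L powr q \<le> - 2 * L) at_top" using q by real_asymp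
        then show ?thesis
          using eventually_gt_at_top[of 0]
          by eventually_elim (simp add: powr_def exp_diff exp_minus divide_inverse mult.commute)
      qed
      ultimately have "eventually (\<lambda>L. tail (K' * ln L) \<le> exp (- 2 * L)) at_top"
      proof eventually_elim
        case (elim L)
        have eq: "K' * ln L / \<kappa> = q * ln L" by (simp add: q_def)
        have "tail (K' * ln L) \<le> exp (1 - exp (q * ln L - c))"
          using c[of "K' * ln L"] elim(1) unfolding eq by blast
        also have "\<dots> \<le> exp (- 2 * L)" using elim(2) by (simp only: exp_le_cancel_iff)
        finally show ?case .
      qed
      then show ?thesis by (intro exI[of _ 2]) simp
    qed
    show "\<exists>\<rho><1. eventually (\<lambda>L. exp (- \<rho> * L) \<le> tail (K' * ln L)) at_top" if K': "0 < K'" "K' < \<kappa>"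
    proof -
      obtain C \<pi> where \<pi>: "0 < \<pi>" "\<pi> \<le> 1" and low: "\<And>n. 1 \<le> n \<Longrightarrow> \<pi> ^ n / 2 \<le> tail (\<kappa> * ln (real n) - C)"
        using tail_lower[OF p \<alpha>] unfolding \<kappa>_def by blast
      define q where "q = K' / \<kappa>"
      have q: "0 < q" "q < 1" using K' \<kappa> by (auto simp: q_def)
      \<comment> \<open>With n about D L^q, the level \<kappa> ln n - C of the lower tail just
        reaches K' ln L; since q < 1, n is negligible against L.\<close>
      define D where "D = exp (C / \<kappa>)"
      have D: "0 < D" by (simp add: D_def)
      define v where "v = - ln \<pi>"
      have v: "0 \<le> v" using \<pi> by (simp add: v_def)
      have "eventually (\<lambda>L. (D * L powr q + 1) * v + ln 2 \<le> L / 2) at_top"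
      proof (cases "v = 0")
        case True
        show ?thesis unfolding True mult_zero_right add_0_left by real_asymp
      next
        case False
        then have "0 < v" using v by simp
        then show ?thesis using D q by real_asymp
      qed
      then have "eventually (\<lambda>L. exp (- (1 / 2) * L) \<le> tail (K' * ln L)) at_top"
        using eventually_gt_at_top[of 0]
      proof eventually_elim
        case (elim L)
        define n where "n = nat \<lceil>D * L powr q\<rceil>"
        have pos: "0 < D * L powr q" using D elim by simp
        then have n: "1 \<le> n" "D * L powr q \<le> real n" "real n \<le> D * L powr q + 1"
          unfolding n_def by linarith+
        have "C / \<kappa> + q * ln L = ln (D * L powr q)" using D elim by (simp add: ln_mult D_def ln_powr)
        also have "\<dots> \<le> ln (real n)" using n(2) pos by (intro ln_mono) auto
        finally have "\<kappa> * (C / \<kappa> + q * ln L) \<le> \<kappa> * ln (real n)" using \<kappa> by (intro mult_left_mono) auto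
        then have "K' * ln L \<le> \<kappa> * ln (real n) - C" using \<kappa> by (simp add: q_def distrib_left)
        then have t: "tail (\<kappa> * ln (real n) - C) \<le> tail (K' * ln L)" by (rule tail_antimono)
        have "real n * v \<le> (D * L powr q + 1) * v" using n(3) v by (intro mult_right_mono)
        then have "- (1 / 2) * L \<le> - (real n * v) - ln 2" using elim(1) by simp
        then have "exp (- (1 / 2) * L) \<le> exp (- (real n * v) - ln 2)" by (simp only: exp_le_cancel_iff)
        also have "\<dots> = \<pi> ^ n / 2" using \<pi> by (simp add: exp_diff v_def exp_of_nat_mult)
        finally show ?case using low[OF n(1)] t by linarith
      qed
      then show ?thesis by (intro exI[of _ "1 / 2"]) simp
    qed
  qed
  then show ?thesis
  proof eventually_elim
    case (elim \<omega>)
    have "Liminf at_top (\<lambda>t. ereal (1 / (t * ln (ln (ln t))) * \<gamma> t \<omega>)) = Liminf at_top (\<lambda>t. ereal (\<gamma> t \<omega> / (t powr (2 - \<alpha>) * ln (ln (ln t)))))"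
    proof (rule Liminf_eq)
      show "eventually (\<lambda>t. ereal (1 / (t * ln (ln (ln t))) * \<gamma> t \<omega>) = ereal (\<gamma> t \<omega> / (t powr (2 - \<alpha>) * ln (ln (ln t))))) at_top"
        using eventually_gt_at_top[of 0] by eventually_elim (simp add: \<alpha>)
    qed
    then show ?case using elim by (simp add: \<kappa>_def)
  qed
qed

end

theorem theorem4:
  fixes M :: "'w measure" and X :: "real \<Rightarrow> 'w \<Rightarrow> 'a::euclidean_space"
    and \<beta> :: real and \<psi> :: "'a \<Rightarrow> real" and f :: "'a \<Rightarrow> real" and \<gamma> :: "real \<Rightarrow> 'w \<Rightarrow> real"
  assumes "symmetric_stable_process M X \<beta> \<psi>"
    and "2 * real DIM('a) / 3 < \<beta>" and "\<beta> \<le> real DIM('a)"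
    and "mollifier_kernel f"
    and "renormalized_silt M X f \<gamma>"
  shows
    "(\<beta> < real DIM('a) \<longrightarrow>
        (\<forall>b::real. 0 < b \<and>
           ((\<lambda>t. (1 / t) * ln (measure M {\<omega> \<in> space M. - \<gamma> t \<omega> \<ge> t})) \<longlongrightarrow> - b) at_top \<longrightarrow>
           (AE \<omega> in M.
              Liminf at_top (\<lambda>t. ereal (\<gamma> t \<omega> /
                (t powr (2 - real DIM('a) / \<beta>) * ln (ln t) powr (real DIM('a) / \<beta> - 1))))
              = ereal (- (b powr (- (real DIM('a) / \<beta> - 1))))))) \<and>
     (\<beta> = real DIM('a) \<longrightarrow>
        (\<forall>p::real \<Rightarrow> 'a \<Rightarrow> real. (\<forall>t>0. continuous_density M (X t) (p t)) \<longrightarrow>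
           (AE \<omega> in M.
              Liminf at_top (\<lambda>t. ereal (1 / (t * ln (ln (ln t))) * \<gamma> t \<omega>))
              = ereal (- p 1 0))))"
proof -
  interpret symmetric_stable_process M X \<beta> \<psi> by fact
  interpret silt M X \<beta> \<psi> f \<gamma>
    by unfold_locales (use assms in auto)
  have critical: "\<alpha> = 1" if "\<beta> = real DIM('a)"
    unfolding \<alpha>_def using that by simp
  show ?thesis
    using LIL_subcritical LIL_critical[OF _ critical] unfolding \<alpha>_def by simp
qed

end
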